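(* Let $r \geq 2$ and $m \geq 2$ be integers. Let $\mathbb{S}^m\subset\mathbb{R}^{m+1}$ be the Euclidean unit sphere. The small hypersphere $i : \mathbb{S}^{m-1}(R) \hookrightarrow \mathbb{S}^{m}$ is a proper $ES$-$r$-harmonic submanifold of $\mathbb{S}^{m}$ if and only if the radius $R$ is equal to $1/\sqrt{r}$.
   Context: $\mathbb{S}^{m-1}(R)$ denotes the Euclidean sphere of radius $R$ with its standard metric; the small hypersphere of radius $R\in(0,1)$ is the isometric embedding $i(x)=(x,\sqrt{1-R^2})\in\mathbb{R}^m\times\mathbb{R}$, $x\in\mathbb{R}^m$, $|x|=R$. For a smooth map $\varphi:(M,g)\to(N,h)$ between Riemannian manifolds, let $\nabla^\varphi$ be the pull-back connection on $\varphi^{-1}TN$, let $A^k(\varphi^{-1}TN)$ be the space of $k$-forms on $M$ with values in $\varphi^{-1}TN$, let $d:A^k(\varphi^{-1}TN)\to A^{k+1}(\varphi^{-1}TN)$ be the exterior differential determined by $\nabla^\varphi$ (and the Levi-Civita connection of $M$), and let $d^*$ be its formal adjoint. The tension field is $\tau(\varphi)=-d^*d\varphi=\operatorname{trace}\nabla d\varphi$; $\varphi$ is harmonic if $\tau(\varphi)=0$. The $ES$-$r$-energy is $$E^{ES}_r(\varphi)=\frac12\int_M|(d^*+d)^r(\varphi)|^2\,dV .$$ Here $d$ applied to $\varphi$ is $d\varphi\in A^1(\varphi^{-1}TN)$, $d^*\varphi=0$ and $d^2\varphi=0$, so for $r\ge2$ one has $(d^*+d)^r(\varphi)=-(d^*+d)^{r-2}\tau(\varphi)$,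 a sum of forms of various degrees; components of different degree are orthogonal, and $|\omega|^2=\sum_{i_1<\dots<i_k}|\omega(e_{i_1},\dots,e_{i_k})|^2$ for a $k$-form $\omega$ and a local orthonormal frame $\{e_i\}$. A map is $ES$-$r$-harmonic if it is a critical point of $E^{ES}_r$ with respect to all smooth variations. It is proper if it is not harmonic. An isometric immersion which is a (proper) $ES$-$r$-harmonic map is called a (proper) $ES$-$r$-harmonic submanifold (for isometric immersions, proper means not minimal). *)

theory Defs
  imports "HOL-Analysis.Analysis"
begin

text \<open>
  Riemannian manifolds are embedded submanifolds of Euclidean spaces, given as subsets
  \<open>M\<close> (source) and \<open>N\<close> (target) and carrying the induced metric.  Maps and tensors on \<open>M\<close> are
  functions on the ambient space of which only the values on \<open>M\<close> matter.
\<close>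

section \<open>Smooth maps\<close>

primrec Ck_on :: "nat \<Rightarrow> ('a::real_normed_vector \<Rightarrow> 'b::real_normed_vector) \<Rightarrow> 'a set \<Rightarrow> bool" where
  "Ck_on 0 f U \<longleftrightarrow> continuous_on U f"
| "Ck_on (Suc k) f U \<longleftrightarrow>
     (\<forall>x\<in>U. f differentiable (at x)) \<and> (\<forall>v. Ck_on k (\<lambda>x. frechet_derivative f (at x) v) U)"

text \<open>A map on an arbitrary subset \<open>S\<close> is smooth if it extends locally to smooth maps on open sets.\<close>

definition smooth_map_on :: "'a::euclidean_space set \<Rightarrow> ('a \<Rightarrow> 'b::euclidean_space) \<Rightarrow> bool" where
  "smooth_map_on S f \<longleftrightarrow>
     (\<forall>x\<in>S. \<exists>U g. open U \<and> x \<in> U \<and> (\<forall>k. Ck_on k g U) \<and> (\<forall>y\<in>S \<inter> U. f y = g y))"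

definition smooth_map :: "'a::euclidean_space set \<Rightarrow> 'b::euclidean_space set \<Rightarrow> ('a \<Rightarrow> 'b) \<Rightarrow> bool" where
  "smooth_map M N \<phi> \<longleftrightarrow> smooth_map_on M \<phi> \<and> \<phi> ` M \<subseteq> N"


section \<open>Tangent spaces and connections\<close>

definition tangent_space :: "'a::euclidean_space set \<Rightarrow> 'a \<Rightarrow> 'a set" where
  "tangent_space M x =
     {v. \<exists>\<epsilon>>0. \<exists>c::real \<Rightarrow> 'a. smooth_map {-\<epsilon><..<\<epsilon>} M c \<and> c 0 = x \<and> (c has_vector_derivative v) (at 0)}"

definition orth_proj :: "'a::euclidean_space set \<Rightarrow> 'a \<Rightarrow> 'a" where
  "orth_proj T v = (THE w. w \<in> T \<and> (\<forall>u\<in>T. (v - w) \<bullet> u = 0))"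

text \<open>
  \<open>differential M f x u\<close> is meant for \<open>u\<close> tangent to \<open>M\<close> at \<open>x\<close>: the Frechet derivative within \<open>M\<close>
  is not unique, but its values on tangent vectors are.
\<close>

definition differential ::
  "'a::euclidean_space set \<Rightarrow> ('a \<Rightarrow> 'b::euclidean_space) \<Rightarrow> 'a \<Rightarrow> 'a \<Rightarrow> 'b" where
  "differential M f x u = frechet_derivative f (at x within M) u"

text \<open>
  The Levi-Civita connection of a submanifold of Euclidean space is the tangential part of the
  flat connection; hence the pull-back connection \<open>\<nabla>\<^sup>\<phi>\<close> acts on a section \<open>\<sigma>\<close> of
  \<open>\<phi>\<^sup>-\<^sup>1TN\<close> as follows.
\<close>

definition pullback_connection ::
  "'a::euclidean_space set \<Rightarrow> 'b::euclidean_space set \<Rightarrow> ('a \<Rightarrow> 'b) \<Rightarrow> ('a \<Rightarrow> 'b) \<Rightarrow> 'a \<Rightarrow> 'a \<Rightarrow> 'b" where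
  "pullback_connection M N \<phi> \<sigma> x u = orth_proj (tangent_space N (\<phi> x)) (differential M \<sigma> x u)"

definition levi_civita :: "'a::euclidean_space set \<Rightarrow> ('a \<Rightarrow> 'a) \<Rightarrow> 'a \<Rightarrow> 'a \<Rightarrow> 'a" where
  "levi_civita M Y x u = pullback_connection M M (\<lambda>y. y) Y x u"

definition smooth_vector_field :: "'a::euclidean_space set \<Rightarrow> ('a \<Rightarrow> 'a) \<Rightarrow> bool" where
  "smooth_vector_field M X \<longleftrightarrow> smooth_map_on M X \<and> (\<forall>x\<in>M. X x \<in> tangent_space M x)"


section \<open>Forms with values in the pull-back bundle\<close>

text \<open>
  \<open>forms M N \<phi>\<close> is the direct sum over \<open>k\<close> of the spaces \<open>A\<^sup>k(\<phi>\<^sup>-\<^sup>1TN)\<close>: the degree-\<open>k\<close> component of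
  \<open>\<omega>\<close> at \<open>x\<close> is the restriction of \<open>\<omega> x\<close> to lists of length \<open>k\<close>.  Forms are normalised to be \<open>0\<close> on
  arguments that are not tangent vectors at a point of \<open>M\<close>, which makes them equal as soon as they
  agree as forms.
\<close>

definition forms ::
  "'a::euclidean_space set \<Rightarrow> 'b::euclidean_space set \<Rightarrow> ('a \<Rightarrow> 'b) \<Rightarrow> ('a \<Rightarrow> 'a list \<Rightarrow> 'b) set" where
  "forms M N \<phi> = {\<omega>.
     (\<forall>x vs. \<not> (x \<in> M \<and> set vs \<subseteq> tangent_space M x) \<longrightarrow> \<omega> x vs = 0) \<and>
     (\<forall>x\<in>M. \<forall>vs. set vs \<subseteq> tangent_space M x \<longrightarrow>
        \<omega> x vs \<in> tangent_space N (\<phi> x) \<and>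
        (\<forall>i<length vs. \<forall>a b. \<forall>u\<in>tangent_space M x. \<forall>w\<in>tangent_space M x.
           \<omega> x (vs[i := a *\<^sub>R u + b *\<^sub>R w]) = a *\<^sub>R \<omega> x (vs[i := u]) + b *\<^sub>R \<omega> x (vs[i := w])) \<and>
        (\<forall>i j. i < j \<and> j < length vs \<and> vs ! i = vs ! j \<longrightarrow> \<omega> x vs = 0)) \<and>
     (\<forall>Xs. (\<forall>X\<in>set Xs. smooth_vector_field M X) \<longrightarrow>
        smooth_map_on M (\<lambda>x. \<omega> x (map (\<lambda>X. X x) Xs)))}"

text \<open>
  \<open>(\<nabla>\<^sub>u\<omega>)(v\<^sub>1,\<dots>,v\<^sub>k)\<close> at \<open>x\<close>, by the Leibniz rule.  It does not depend on the tangent vector fields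
  that extend \<open>v\<^sub>1,\<dots>,v\<^sub>k\<close>; the fields used here are the tangential projections of constant fields.
\<close>

definition tangent_extension :: "'a::euclidean_space set \<Rightarrow> 'a \<Rightarrow> 'a \<Rightarrow> 'a" where
  "tangent_extension M v y = orth_proj (tangent_space M y) v"

definition cov_deriv_form ::
  "'a::euclidean_space set \<Rightarrow> 'b::euclidean_space set \<Rightarrow> ('a \<Rightarrow> 'b) \<Rightarrow>
   ('a \<Rightarrow> 'a list \<Rightarrow> 'b) \<Rightarrow> 'a \<Rightarrow> 'a \<Rightarrow> 'a list \<Rightarrow> 'b" where
  "cov_deriv_form M N \<phi> \<omega> x u vs =
     pullback_connection M N \<phi> (\<lambda>y. \<omega> y (map (\<lambda>v. tangent_extension M v y) vs)) x u
     - (\<Sum>i<length vs. \<omega> x (vs[i := levi_civita M (tangent_extension M (vs ! i)) x u]))"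

definition ext_d ::
  "'a::euclidean_space set \<Rightarrow> 'b::euclidean_space set \<Rightarrow> ('a \<Rightarrow> 'b) \<Rightarrow>
   ('a \<Rightarrow> 'a list \<Rightarrow> 'b) \<Rightarrow> 'a \<Rightarrow> 'a list \<Rightarrow> 'b" where
  "ext_d M N \<phi> \<omega> x vs =
     (if x \<in> M \<and> set vs \<subseteq> tangent_space M x
      then \<Sum>i<length vs. (-1) ^ i *\<^sub>R
             cov_deriv_form M N \<phi> \<omega> x (vs ! i) (take i vs @ drop (Suc i) vs)
      else 0)"

definition orthonormal_frame :: "'a::euclidean_space set \<Rightarrow> 'a list \<Rightarrow> bool" where
  "orthonormal_frame T es \<longleftrightarrow>
     distinct es \<and> pairwise orthogonal (set es) \<and> (\<forall>e\<in>set es. norm e = 1) \<and> span (set es) = T"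

text \<open>
  The sublists \<open>nths es I\<close> of an orthonormal frame \<open>es\<close> are the tuples \<open>(e\<^sub>i\<^sub>1,\<dots>,e\<^sub>i\<^sub>k)\<close> with
  \<open>i\<^sub>1 < \<dots> < i\<^sub>k\<close>, for all \<open>k\<close>.  Components of different degree are thus orthogonal.
\<close>

definition form_inner ::
  "'a::euclidean_space set \<Rightarrow> ('a \<Rightarrow> 'a list \<Rightarrow> 'b::euclidean_space) \<Rightarrow> ('a \<Rightarrow> 'a list \<Rightarrow> 'b) \<Rightarrow> 'a \<Rightarrow> real" where
  "form_inner M \<omega> \<eta> x =
     (let es = SOME es. orthonormal_frame (tangent_space M x) es
      in \<Sum>I\<in>Pow {..<length es}. \<omega> x (nths es I) \<bullet> \<eta> x (nths es I))"

text \<open>The formal adjoint of \<open>ext_d\<close>, where \<open>\<mu>\<close> is the Riemannian measure of the closed manifold \<open>M\<close>.\<close>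

definition ext_d_adj ::
  "'a::euclidean_space set \<Rightarrow> 'a measure \<Rightarrow> 'b::euclidean_space set \<Rightarrow> ('a \<Rightarrow> 'b) \<Rightarrow>
   ('a \<Rightarrow> 'a list \<Rightarrow> 'b) \<Rightarrow> 'a \<Rightarrow> 'a list \<Rightarrow> 'b" where
  "ext_d_adj M \<mu> N \<phi> \<omega> =
     (THE \<beta>. \<beta> \<in> forms M N \<phi> \<and>
        (\<forall>\<sigma>\<in>forms M N \<phi>.
           (\<integral>x. form_inner M (ext_d M N \<phi> \<sigma>) \<omega> x \<partial>\<mu>) = (\<integral>x. form_inner M \<sigma> \<beta> x \<partial>\<mu>)))"

text \<open>The differential \<open>d\<phi>\<close> of the map \<open>\<phi>\<close>, as a 1-form with values in the pull-back bundle.\<close>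

definition d_map ::
  "'a::euclidean_space set \<Rightarrow> ('a \<Rightarrow> 'b::euclidean_space) \<Rightarrow> 'a \<Rightarrow> 'a list \<Rightarrow> 'b" where
  "d_map M \<phi> x vs =
     (if x \<in> M \<and> length vs = 1 \<and> set vs \<subseteq> tangent_space M x then differential M \<phi> x (vs ! 0) else 0)"


section \<open>Harmonic and ES-r-harmonic maps\<close>

definition tension_field ::
  "'a::euclidean_space set \<Rightarrow> 'a measure \<Rightarrow> 'b::euclidean_space set \<Rightarrow> ('a \<Rightarrow> 'b) \<Rightarrow> 'a \<Rightarrow> 'b" where
  "tension_field M \<mu> N \<phi> x = - ext_d_adj M \<mu> N \<phi> (d_map M \<phi>) x []"

definition harmonic_map ::
  "'a::euclidean_space set \<Rightarrow> 'a measure \<Rightarrow> 'b::euclidean_space set \<Rightarrow> ('a \<Rightarrow> 'b) \<Rightarrow> bool" where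
  "harmonic_map M \<mu> N \<phi> \<longleftrightarrow> smooth_map M N \<phi> \<and> (\<forall>x\<in>M. tension_field M \<mu> N \<phi> x = 0)"

text \<open>
  \<open>(d\<^sup>* + d)\<^sup>r(\<phi>)\<close> for \<open>r \<ge> 1\<close>: the first application of \<open>d\<^sup>* + d\<close>, to the map \<open>\<phi>\<close> itself, yields \<open>d\<phi>\<close>
  since \<open>d\<^sup>*\<phi> = 0\<close>.
\<close>

definition ES_form ::
  "nat \<Rightarrow> 'a::euclidean_space set \<Rightarrow> 'a measure \<Rightarrow> 'b::euclidean_space set \<Rightarrow> ('a \<Rightarrow> 'b) \<Rightarrow>
   'a \<Rightarrow> 'a list \<Rightarrow> 'b" where
  "ES_form r M \<mu> N \<phi> =
     ((\<lambda>\<omega> x vs. ext_d_adj M \<mu> N \<phi> \<omega> x vs + ext_d M N \<phi> \<omega> x vs) ^^ (r - 1)) (d_map M \<phi>)"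

definition ES_energy ::
  "nat \<Rightarrow> 'a::euclidean_space set \<Rightarrow> 'a measure \<Rightarrow> 'b::euclidean_space set \<Rightarrow> ('a \<Rightarrow> 'b) \<Rightarrow> real" where
  "ES_energy r M \<mu> N \<phi> =
     1/2 * (\<integral>x. form_inner M (ES_form r M \<mu> N \<phi>) (ES_form r M \<mu> N \<phi>) x \<partial>\<mu>)"

definition ES_harmonic_map ::
  "nat \<Rightarrow> 'a::euclidean_space set \<Rightarrow> 'a measure \<Rightarrow> 'b::euclidean_space set \<Rightarrow> ('a \<Rightarrow> 'b) \<Rightarrow> bool" where
  "ES_harmonic_map r M \<mu> N \<phi> \<longleftrightarrow>
     smooth_map M N \<phi> \<and>
     (\<forall>\<epsilon>>0. \<forall>\<Phi> :: real \<times> 'a \<Rightarrow> 'b.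
        smooth_map ({-\<epsilon><..<\<epsilon>} \<times> M) N \<Phi> \<and> (\<forall>x\<in>M. \<Phi> (0, x) = \<phi> x) \<longrightarrow>
        ((\<lambda>t. ES_energy r M \<mu> N (\<lambda>x. \<Phi> (t, x))) has_real_derivative 0) (at 0))"

definition isometric_immersion ::
  "'a::euclidean_space set \<Rightarrow> 'b::euclidean_space set \<Rightarrow> ('a \<Rightarrow> 'b) \<Rightarrow> bool" where
  "isometric_immersion M N \<phi> \<longleftrightarrow>
     smooth_map M N \<phi> \<and>
     (\<forall>x\<in>M. \<forall>u\<in>tangent_space M x. \<forall>v\<in>tangent_space M x.
        differential M \<phi> x u \<bullet> differential M \<phi> x v = u \<bullet> v)"

definition proper_ES_harmonic_submanifold ::
  "nat \<Rightarrow> 'a::euclidean_space set \<Rightarrow> 'a measure \<Rightarrow> 'b::euclidean_space set \<Rightarrow> ('a \<Rightarrow> 'b) \<Rightarrow> bool" where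
  "proper_ES_harmonic_submanifold r M \<mu> N \<phi> \<longleftrightarrow>
     isometric_immersion M N \<phi> \<and> ES_harmonic_map r M \<mu> N \<phi> \<and> \<not> harmonic_map M \<mu> N \<phi>"


section \<open>Spheres\<close>

text \<open>
  The Riemannian (surface) measure of \<open>sphere 0 R\<close> in a Euclidean space of dimension \<open>m\<close>, from polar
  coordinates: a subset \<open>A\<close> has area \<open>m/R\<close> times the volume of the cone \<open>{t x | x \<in> A, 0 < t < 1}\<close>.
\<close>

definition sphere_measure :: "real \<Rightarrow> 'a::euclidean_space measure" where
  "sphere_measure R =
     scale_measure (ennreal (real DIM('a) / R))
       (distr (restrict_space lborel (ball 0 R)) borel (\<lambda>x. (R / norm x) *\<^sub>R x))"

definition small_hypersphere :: "real \<Rightarrow> 'a::euclidean_space \<Rightarrow> 'a \<times> real" where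
  "small_hypersphere R x = (x, sqrt (1 - R\<^sup>2))"

end

theory Submission
  imports Defs
begin

text \<open>
  Write \<open>D = d\<^sup>* + d\<close> and \<open>W\<^sub>j(t) = D\<^sup>j d\<phi>\<^sub>t\<close> for a variation \<open>\<phi>\<^sub>t\<close> of the small hypersphere
  \<open>i\<close>, with variation field \<open>V\<close>.  Since \<open>D\<close> is self-adjoint for every \<open>t\<close>, the pairings
  \<open>A(j,l) = \<integral>\<langle>\<partial>\<^sub>t W\<^sub>j, W\<^sub>l\<rangle>\<close> at \<open>t = 0\<close> are such that \<open>A(j+1,l) - A(j,l+1)\<close> is symmetric in \<open>j\<close> and
  \<open>l\<close>.  At \<open>t = 0\<close> everything is spanned by \<open>di\<close> and the unit normal \<open>\<eta>\<close>: \<open>D di = c \<eta>\<close> and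
  \<open>D \<eta> = (h/R) di\<close>, where \<open>h\<^sup>2 = 1 - R\<^sup>2\<close> and \<open>c = (m-1) h/R\<close>, so that \<open>D\<^sup>2 di = \<kappa> di\<close> with
  \<open>\<kappa> = (m-1) h\<^sup>2/R\<^sup>2\<close>.  This periodicity reduces \<open>A(n,n)\<close>, the derivative of the energy for \<open>n = r - 1\<close>,
  to \<open>A(0,0) = c \<integral>\<langle>V,\<eta>\<rangle>\<close> and \<open>A(2,0) - A(1,1) = - c (m-1) \<integral>\<langle>V,\<eta>\<rangle>\<close>; the result is a nonzero multiple
  of \<open>(h\<^sup>2/R\<^sup>2 - n) \<integral>\<langle>V,\<eta>\<rangle>\<close>.  Moving \<open>i\<close> through the parallel hyperspheres makes the integral nonzero.
\<close>

section \<open>Smooth functions\<close>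

text \<open>The obstacle: for t \<noteq> 0 the iterates W_j(t) mix several degrees, and
  \<open>D\<close> itself depends on t, its derivative containing curvature terms. That derivative
  is never computed. For a family that vanishes at t = 0, \<open>D\<close> crosses the pairing as if
  it did not depend on t. Applied to W_{j+2} - \<kappa> W_j, this makes A(j+1,l) - A(j,l+1) acquire
  the factor \<kappa> when j grows by 2. With the symmetry, all these differences on the
  antidiagonal j + l = 2n - 1 agree, and n of them lead from A(0,2n) to A(n,n): this is where the
  factor n comes from. Applied to W_1 - c Z, with Z_t the projection of \<eta> to the tangent spaces
  along \<phi>_t, the same argument reduces A(2,0) - A(1,1) to the derivative of a section. The
  operator \<open>d\<^sup>*\<close> is given by a definite description, so it has to be identified
  by integration by parts. The divergence theorem on the sphere that this needs is obtained from
  rotation invariance of the cone measure. All differentiation is done in the ambient space, on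
  extensions that are homogeneous of degree 0.\<close>

definition smooth_on :: "'a::real_normed_vector set \<Rightarrow> ('a \<Rightarrow> 'b::real_normed_vector) \<Rightarrow> bool" where
  "smooth_on U f \<longleftrightarrow> (\<forall>k. Ck_on k f U)"

lemma Ck_on_continuous: "Ck_on k f U \<Longrightarrow> continuous_on U f"
  by (cases k) (auto intro: differentiable_imp_continuous_on simp: differentiable_on_def
      differentiable_at_withinI)

lemma Ck_on_pred: "Ck_on (Suc k) f U \<Longrightarrow> Ck_on k f U"
proof (induction k arbitrary: f)
  case 0
  then show ?case using Ck_on_continuous by (metis Ck_on.simps(1))
next
  case (Suc k)
  then show ?case by (metis Ck_on.simps(2))
qed

text \<open>Openness of \<open>U\<close> lets agreement on \<open>U\<close> pass to the derivatives,
  which \<open>Ck_on\<close> takes in the full space.\<close>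

lemma Ck_on_cong:
  assumes "open U" "\<And>x. x \<in> U \<Longrightarrow> f x = g x" "Ck_on k f U"
  shows "Ck_on k g U"
  using assms(2,3)
proof (induction k arbitrary: f g)
  case 0
  then show ?case by (simp cong: continuous_on_cong)
next
  case (Suc k)
  have d: "g differentiable (at x)" "frechet_derivative f (at x) = frechet_derivative g (at x)"
    if "x \<in> U" for x
  proof -
    have fd: "f differentiable (at x)" using Suc.prems that by simp
    show "frechet_derivative f (at x) = frechet_derivative g (at x)"
      using frechet_derivative_transform_within_open[OF fd assms(1) that] Suc.prems by blast
    obtain D where "(f has_derivative D) (at x)" using fd by (auto simp: differentiable_def)
    then have "(g has_derivative D) (at x)"
      using has_derivative_transform_within_open[OF _ assms(1) that] Suc.prems by blast
    then show "g differentiable (at x)" by (auto simp: differentiable_def)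
  qed
  show ?case using Suc.IH[of "\<lambda>x. frechet_derivative f (at x) _" "\<lambda>x. frechet_derivative g (at x) _"] Suc.prems d by auto
qed

text \<open>Allows the inductions on the order to work with an explicit derivative \<open>f'\<close>
  in place of \<open>frechet_derivative\<close>.\<close>

lemma Ck_on_Suc_derivI:
  assumes "open U" "\<And>x. x \<in> U \<Longrightarrow> (f has_derivative f' x) (at x)" "\<And>v. Ck_on k (\<lambda>x. f' x v) U"
  shows "Ck_on (Suc k) f U"
proof -
  have "frechet_derivative f (at x) = f' x" if "x \<in> U" for x
    using frechet_derivative_at[OF assms(2)[OF that]] by simp
  then have "Ck_on k (\<lambda>x. frechet_derivative f (at x) v) U" for v
    using Ck_on_cong[OF assms(1) _ assms(3)[of v]] by simp
  then show ?thesis using assms(2) by (auto simp: differentiable_def)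
qed

lemma Ck_on_has_derivative:
  "Ck_on (Suc k) f U \<Longrightarrow> x \<in> U \<Longrightarrow> (f has_derivative frechet_derivative f (at x)) (at x)"
  by (simp add: frechet_derivative_works)

lemma Ck_on_const: "Ck_on k (\<lambda>x. c) U"
  by (induction k arbitrary: c) auto

lemma Ck_on_bounded_linear: "open U \<Longrightarrow> bounded_linear f \<Longrightarrow> Ck_on k f U"
proof (cases k)
  case 0
  assume "bounded_linear f" then show ?thesis using 0
    by (simp add: linear_continuous_on)
next
  case (Suc j)
  assume "open U" "bounded_linear f"
  then show ?thesis unfolding Suc
    by (intro Ck_on_Suc_derivI[where f' = "\<lambda>x. f"])
       (auto intro: bounded_linear_imp_has_derivative Ck_on_const)
qed

lemma Ck_on_add:
  assumes "open U" "Ck_on k f U" "Ck_on k g U"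
  shows "Ck_on k (\<lambda>x. f x + g x) U"
  using assms(2,3)
proof (induction k arbitrary: f g)
  case (Suc k)
  show ?case
    by (rule Ck_on_Suc_derivI[OF assms(1) has_derivative_add[OF Ck_on_has_derivative[OF Suc.prems(1)]
          Ck_on_has_derivative[OF Suc.prems(2)]]])
       (use Suc in auto)
qed (auto intro: continuous_intros)

text \<open>By the product rule the derivative is again a sum of values of \<open>h\<close> at
  functions of one order less, so the induction closes. Multiplication by scalars, products and
  inner products are all instances.\<close>

lemma Ck_on_bilinear:
  assumes "bounded_bilinear h" "open U" "Ck_on k f U" "Ck_on k g U"
  shows "Ck_on k (\<lambda>x. h (f x) (g x)) U"
  using assms(3,4)
proof (induction k arbitrary: f g)
  case 0
  then show ?case using bounded_bilinear.continuous_on[OF assms(1)] by simp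
next
  case (Suc k)
  show ?case
  proof (rule Ck_on_Suc_derivI[OF assms(2) bounded_bilinear.FDERIV[OF assms(1)
          Ck_on_has_derivative[OF Suc.prems(1)] Ck_on_has_derivative[OF Suc.prems(2)]]])
    fix v
    show "Ck_on k (\<lambda>x. h (f x) (frechet_derivative g (at x) v) + h (frechet_derivative f (at x) v) (g x)) U"
      using Suc.prems by (intro Ck_on_add[OF assms(2)] Suc.IH) (auto intro: Ck_on_pred simp del: Ck_on.simps(1))
  qed auto
qed

lemma Ck_on_sum:
  assumes "open U" "\<And>i. i \<in> I \<Longrightarrow> Ck_on k (f i) U"
  shows "Ck_on k (\<lambda>x. \<Sum>i\<in>I. f i x) U"
  using assms(2)
  by (induction I rule: infinite_finite_induct) (auto intro: Ck_on_const Ck_on_add[OF assms(1)])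

text \<open>In the chain rule the direction in which \<open>g\<close> is differentiated varies with
  the point, while \<open>Ck_on\<close> speaks of fixed directions. Expanding that direction in
  \<open>Basis\<close> gives a sum of products, to whose factors the induction hypothesis for the
  partial derivatives of \<open>g\<close> applies.\<close>

lemma Ck_on_compose:
  fixes f :: "'a::real_normed_vector \<Rightarrow> 'b::euclidean_space" and g :: "'b \<Rightarrow> 'c::real_normed_vector"
  assumes "open U" "open V" "f ` U \<subseteq> V" "Ck_on k g V" "Ck_on k f U"
  shows "Ck_on k (\<lambda>x. g (f x)) U"
  using assms(4,5)
proof (induction k arbitrary: g)
  case 0
  then show ?case using continuous_on_compose2[of V g U f] assms(3) by simp
next
  case (Suc k)
  show ?case
  proof (rule Ck_on_Suc_derivI[OF assms(1)])
    fix x assume x: "x \<in> U"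
    have 1: "(f has_derivative frechet_derivative f (at x)) (at x)"
      using Suc.prems x by (intro Ck_on_has_derivative)
    have 2: "(g has_derivative frechet_derivative g (at (f x))) (at (f x))"
      using Suc.prems x assms(3) by (intro Ck_on_has_derivative) auto
    have l: "linear (frechet_derivative g (at (f x)))"
      using 2 has_derivative_linear by blast
    have "frechet_derivative g (at (f x)) (frechet_derivative f (at x) v) =
        (\<Sum>b\<in>Basis. (frechet_derivative f (at x) v \<bullet> b) *\<^sub>R frechet_derivative g (at (f x)) b)" for v
    proof -
      have "frechet_derivative g (at (f x)) (frechet_derivative f (at x) v) =
         frechet_derivative g (at (f x)) (\<Sum>b\<in>Basis. (frechet_derivative f (at x) v \<bullet> b) *\<^sub>R b)"
        by (simp only: euclidean_representation)
      then show ?thesis by (simp only: linear_sum[OF l] linear_cmul[OF l])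
    qed
    then have "(\<lambda>v. frechet_derivative g (at (f x)) (frechet_derivative f (at x) v)) = (\<lambda>v. \<Sum>b\<in>Basis. (frechet_derivative f (at x) v \<bullet> b) *\<^sub>R frechet_derivative g (at (f x)) b)"
      by blast
    then show "((\<lambda>x. g (f x)) has_derivative (\<lambda>v. \<Sum>b\<in>Basis. (frechet_derivative f (at x) v \<bullet> b) *\<^sub>R frechet_derivative g (at (f x)) b)) (at x)"
      using has_derivative_compose[OF 1 2] by simp
  next
    fix v
    show "Ck_on k (\<lambda>x. \<Sum>b\<in>Basis. (frechet_derivative f (at x) v \<bullet> b) *\<^sub>R frechet_derivative g (at (f x)) b) U"
    proof (intro Ck_on_sum[OF assms(1)] Ck_on_bilinear[OF bounded_bilinear_scaleR assms(1)]
          Ck_on_bilinear[OF bounded_bilinear_inner assms(1)] Ck_on_const)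
      fix b :: 'b assume "b \<in> Basis"
      show "Ck_on k (\<lambda>x. frechet_derivative f (at x) v) U" using Suc.prems by simp
      show "Ck_on k (\<lambda>x. frechet_derivative g (at (f x)) b) U"
        using Suc.prems Ck_on_pred[OF Suc.prems(2)] by (intro Suc.IH) auto
    qed
  qed
qed

section \<open>Smooth functions and their closure properties\<close>

lemma smooth_onI: "(\<And>k. Ck_on k f U) \<Longrightarrow> smooth_on U f"
  by (simp add: smooth_on_def)

lemma smooth_onD: "smooth_on U f \<Longrightarrow> Ck_on k f U"
  by (simp add: smooth_on_def)

lemma smooth_on_cong:
  "open U \<Longrightarrow> smooth_on U f \<Longrightarrow> (\<And>x. x \<in> U \<Longrightarrow> f x = g x) \<Longrightarrow> smooth_on U g"
  unfolding smooth_on_def using Ck_on_cong by metis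

lemma smooth_on_const [intro]: "smooth_on U (\<lambda>x. c)"
  by (simp add: smooth_on_def Ck_on_const)

lemma smooth_on_bounded_linear: "open U \<Longrightarrow> bounded_linear f \<Longrightarrow> smooth_on U f"
  by (simp add: smooth_on_def Ck_on_bounded_linear)

lemma smooth_on_ident: "open U \<Longrightarrow> smooth_on U (\<lambda>x. x)"
  by (simp add: bounded_linear_ident smooth_on_bounded_linear)

lemma smooth_on_fst: "open U \<Longrightarrow> smooth_on U fst"
  by (simp add: bounded_linear_fst smooth_on_bounded_linear)

lemma smooth_on_snd: "open U \<Longrightarrow> smooth_on U snd"
  by (simp add: bounded_linear_snd smooth_on_bounded_linear)

lemma smooth_on_add:
  "open U \<Longrightarrow> smooth_on U f \<Longrightarrow> smooth_on U g \<Longrightarrow> smooth_on U (\<lambda>x. f x + g x)"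
  by (simp add: smooth_on_def Ck_on_add)

lemma smooth_on_scaleR:
  "open U \<Longrightarrow> smooth_on U f \<Longrightarrow> smooth_on U g \<Longrightarrow> smooth_on U (\<lambda>x. f x *\<^sub>R g x)"
  by (simp add: smooth_on_def Ck_on_bilinear[OF bounded_bilinear_scaleR])

lemma smooth_on_mult:
  fixes f g :: "_ \<Rightarrow> real"
  shows "open U \<Longrightarrow> smooth_on U f \<Longrightarrow> smooth_on U g \<Longrightarrow> smooth_on U (\<lambda>x. f x * g x)"
  by (simp add: smooth_on_def Ck_on_bilinear[OF bounded_bilinear_mult])

lemma smooth_on_inner:
  "open U \<Longrightarrow> smooth_on U f \<Longrightarrow> smooth_on U g \<Longrightarrow> smooth_on U (\<lambda>x. f x \<bullet> g x)"
  by (simp add: smooth_on_def Ck_on_bilinear[OF bounded_bilinear_inner])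

lemma smooth_on_minus:
  assumes "open U" "smooth_on U f"
  shows "smooth_on U (\<lambda>x. - f x)"
  using smooth_on_scaleR[OF assms(1) smooth_on_const[of U "-1"] assms(2)] by simp

lemma smooth_on_diff:
  assumes "open U" "smooth_on U f" "smooth_on U g" shows "smooth_on U (\<lambda>x. f x - g x)"
  using smooth_on_add[OF assms(1,2) smooth_on_minus[OF assms(1,3)]] by simp

lemma smooth_on_sum:
  "open U \<Longrightarrow> (\<And>i. i \<in> I \<Longrightarrow> smooth_on U (f i)) \<Longrightarrow> smooth_on U (\<lambda>x. \<Sum>i\<in>I. f i x)"
  by (simp add: smooth_on_def Ck_on_sum)

lemma smooth_on_compose:
  fixes f :: "'a::real_normed_vector \<Rightarrow> 'b::euclidean_space" and g :: "'b \<Rightarrow> 'c::real_normed_vector"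
  shows "open U \<Longrightarrow> open V \<Longrightarrow> f ` U \<subseteq> V \<Longrightarrow> smooth_on V g \<Longrightarrow> smooth_on U f \<Longrightarrow> smooth_on U (\<lambda>x. g (f x))"
  unfolding smooth_on_def using Ck_on_compose by blast

lemma smooth_on_Pair:
  fixes f :: "'a::real_normed_vector \<Rightarrow> 'b::real_normed_vector" and g :: "'a \<Rightarrow> 'c::real_normed_vector"
  assumes "open U" "smooth_on U f" "smooth_on U g"
  shows "smooth_on U (\<lambda>x. (f x, g x))"
proof -
  have "Ck_on k (\<lambda>x. (f x, g x)) U" for k
    using smooth_onD[OF assms(2), of k] smooth_onD[OF assms(3), of k]
  proof (induction k arbitrary: f g)
    case (Suc k)
    show ?case
      by (rule Ck_on_Suc_derivI[OF assms(1) has_derivative_Pair[OF Ck_on_has_derivative[OF Suc.prems(1)]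
            Ck_on_has_derivative[OF Suc.prems(2)]]])
         (use Suc in auto)
  qed (auto intro: continuous_intros)
  then show ?thesis by (simp add: smooth_on_def)
qed

lemma smooth_on_continuous: "smooth_on U f \<Longrightarrow> continuous_on U f"
  by (metis Ck_on_continuous smooth_onD)

lemma smooth_on_has_derivative:
  "smooth_on U f \<Longrightarrow> x \<in> U \<Longrightarrow> (f has_derivative frechet_derivative f (at x)) (at x)"
  by (metis Ck_on_has_derivative smooth_onD)

lemma smooth_on_frechet_derivative:
  "smooth_on U f \<Longrightarrow> smooth_on U (\<lambda>x. frechet_derivative f (at x) v)"
  unfolding smooth_on_def by (metis Ck_on.simps(2))

lemma smooth_on_subset: "smooth_on U f \<Longrightarrow> V \<subseteq> U \<Longrightarrow> smooth_on V f"
proof -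
  have "Ck_on k f U \<Longrightarrow> V \<subseteq> U \<Longrightarrow> Ck_on k f V" for k
    by (induction k arbitrary: f) (auto intro: continuous_on_subset)
  then show "smooth_on U f \<Longrightarrow> V \<subseteq> U \<Longrightarrow> smooth_on V f" by (simp add: smooth_on_def)
qed

text \<open>Glues the local extensions that \<open>smooth_map_on\<close> provides into one smooth
  function.\<close>

lemma smooth_on_local:
  assumes "open U" "\<And>x. x \<in> U \<Longrightarrow> \<exists>V g. open V \<and> x \<in> V \<and> smooth_on V g \<and> (\<forall>y\<in>U \<inter> V. f y = g y)"
  shows "smooth_on U f"
proof -
  have loc: "\<exists>V. open V \<and> x \<in> V \<and> V \<subseteq> U \<and> smooth_on V f" if x: "x \<in> U" for x
  proof -
    obtain V g where V: "open V" "x \<in> V" "smooth_on V g" "\<forall>y\<in>U \<inter> V. f y = g y"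
      using assms(2)[OF x] by blast
    have "smooth_on (U \<inter> V) f"
      using smooth_on_cong[of "U \<inter> V" g f] smooth_on_subset[OF V(3), of "U \<inter> V"] V assms(1) by auto
    then show ?thesis using V x assms(1) by (intro exI[of _ "U \<inter> V"]) auto
  qed
  have "Ck_on k h U" if "\<And>x. x \<in> U \<Longrightarrow> \<exists>V. open V \<and> x \<in> V \<and> V \<subseteq> U \<and> smooth_on V h" for k h
    using that
  proof (induction k arbitrary: h)
    case 0
    have "\<forall>x\<in>U. isCont h x"
      using 0 by (meson smooth_on_continuous continuous_on_eq_continuous_at)
    then show ?case by (simp add: continuous_at_imp_continuous_on)
  next
    case (Suc k)
    have "\<forall>x\<in>U. h differentiable (at x)"
      using Suc.prems by (meson smooth_on_has_derivative differentiable_def)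
    moreover have "Ck_on k (\<lambda>x. frechet_derivative h (at x) v) U" for v
    proof (rule Suc.IH)
      fix x assume "x \<in> U"
      then obtain V where "open V" "x \<in> V" "V \<subseteq> U" "smooth_on V h" using Suc.prems by blast
      then show "\<exists>V. open V \<and> x \<in> V \<and> V \<subseteq> U \<and> smooth_on V (\<lambda>x. frechet_derivative h (at x) v)"
        using smooth_on_frechet_derivative by blast
    qed
    ultimately show ?case by simp
  qed
  then show ?thesis using loc by (auto simp: smooth_on_def)
qed

text \<open>The derivative is a product of copies of \<open>inverse\<close> itself, so each order of
  differentiability yields the next.\<close>

lemma smooth_on_inverse_real: "smooth_on (- {0}) (inverse :: real \<Rightarrow> real)"
proof (rule smooth_onI)
  fix k
  have o: "open (- {0::real})" by auto
  show "Ck_on k (inverse :: real \<Rightarrow> real) (- {0})"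
  proof (induction k)
    case 0
    then show ?case by (auto intro!: continuous_intros)
  next
    case (Suc k)
    show ?case
    proof (rule Ck_on_Suc_derivI[OF o])
      show "x \<in> - {0} \<Longrightarrow> (inverse has_derivative (\<lambda>v. - (inverse x * v * inverse x))) (at x)" for x :: real
        by (rule has_derivative_inverse') simp
      fix v :: real
      have "Ck_on k (\<lambda>x::real. (- v) * (inverse x * inverse x)) (- {0})"
        by (intro Ck_on_bilinear[OF bounded_bilinear_mult o] Ck_on_const Suc)
      then show "Ck_on k (\<lambda>x::real. - (inverse x * v * inverse x)) (- {0})"
        by (simp add: mult_ac)
    qed
  qed
qed

lemma smooth_on_inverse:
  assumes "open U" "smooth_on U f" "\<And>x. x \<in> U \<Longrightarrow> f x \<noteq> (0::real)"
  shows "smooth_on U (\<lambda>x. inverse (f x))"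
  using assms by (intro smooth_on_compose[OF assms(1) _ _ smooth_on_inverse_real assms(2)]) auto

lemma smooth_on_divide:
  assumes "open U" "smooth_on U f" "smooth_on U g" "\<And>x. x \<in> U \<Longrightarrow> g x \<noteq> (0::real)"
  shows "smooth_on U (\<lambda>x. f x / g x)"
  unfolding divide_inverse by (intro smooth_on_mult smooth_on_inverse assms)

text \<open>The derivative contains the norm only through its reciprocal, and is therefore as
  regular as the norm is already known to be.\<close>

lemma smooth_on_norm_aux: "smooth_on (- {0}) (norm :: 'a::euclidean_space \<Rightarrow> real)"
proof (rule smooth_onI)
  fix k
  have o: "open (- {0::'a})" by auto
  show "Ck_on k (norm :: 'a \<Rightarrow> real) (- {0})"
  proof (induction k)
    case 0
    then show ?case by (auto intro!: continuous_intros)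
  next
    case (Suc k)
    show ?case
    proof (rule Ck_on_Suc_derivI[OF o])
      show "x \<in> - {0} \<Longrightarrow> (norm has_derivative (\<lambda>v. v \<bullet> sgn x)) (at x)" for x :: 'a
        using has_derivative_norm[of x] by simp
      fix v :: 'a
      have 1: "Ck_on k (\<lambda>x::'a. inverse (norm x)) (- {0})"
        by (rule Ck_on_compose[OF o _ _ smooth_onD[OF smooth_on_inverse_real] Suc]) auto
      have "Ck_on k (\<lambda>x::'a. (v \<bullet> x) * inverse (norm x)) (- {0})"
        by (intro Ck_on_bilinear[OF bounded_bilinear_mult o] 1
            Ck_on_bounded_linear[OF o] bounded_linear_inner_right)
      then show "Ck_on k (\<lambda>x::'a. v \<bullet> sgn x) (- {0})"
        by (simp add: sgn_div_norm mult.commute)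
    qed
  qed
qed

lemma smooth_on_norm:
  fixes f :: "_ \<Rightarrow> 'b::euclidean_space"
  assumes "open U" "smooth_on U f" "\<And>x. x \<in> U \<Longrightarrow> f x \<noteq> 0"
  shows "smooth_on U (\<lambda>x. norm (f x))"
  using assms by (intro smooth_on_compose[OF assms(1) _ _ smooth_on_norm_aux assms(2)]) auto

text \<open>Proved together because each is, up to sign, the derivative of the other.\<close>

lemma smooth_on_sin_cos: "smooth_on UNIV (sin :: real \<Rightarrow> real)" "smooth_on UNIV (cos :: real \<Rightarrow> real)"
proof -
  have "Ck_on k (sin :: real \<Rightarrow> real) UNIV \<and> Ck_on k (cos :: real \<Rightarrow> real) UNIV" for k
  proof (induction k)
    case 0
    then show ?case by (auto intro!: continuous_intros)
  next
    case (Suc k)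
    have "Ck_on k (\<lambda>x::real. cos x * v) UNIV" "Ck_on k (\<lambda>x::real. (-1 * sin x) * v) UNIV" for v
      by (intro Ck_on_bilinear[OF bounded_bilinear_mult] Ck_on_const; use Suc in simp)+
    then show ?case
      by (auto simp del: Ck_on.simps intro!: Ck_on_Suc_derivI[where f = sin and f' = "\<lambda>x v. cos x * v"]
          Ck_on_Suc_derivI[where f = cos and f' = "\<lambda>x v. (-1 * sin x) * v"] derivative_eq_intros)
  qed
  then show "smooth_on UNIV (sin :: real \<Rightarrow> real)" "smooth_on UNIV (cos :: real \<Rightarrow> real)"
    by (auto simp: smooth_on_def)
qed


section \<open>Spheres as submanifolds\<close>

text \<open>Orthogonal projection along \<open>y\<close>, without normalising \<open>y\<close>:
  smooth off the origin and unchanged when \<open>y\<close> is scaled. It serves for the tangent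
  spaces of the source sphere and, with a value of the map in place of \<open>y\<close>, for those
  of the target sphere.\<close>

definition tproj :: "'a::euclidean_space \<Rightarrow> 'a \<Rightarrow> 'a" where
  "tproj y v = v - ((v \<bullet> y) / (y \<bullet> y)) *\<^sub>R y"

text \<open>Radial retraction onto the sphere. A function composed with it lives on an open set and
  is homogeneous of degree 0, so calculus on the sphere becomes calculus in the ambient
  space.\<close>

definition retr :: "real \<Rightarrow> 'a::euclidean_space \<Rightarrow> 'a" where
  "retr R y = (R / norm y) *\<^sub>R y"

lemma linear_tproj: "linear (tproj y)"
  by (rule linearI) (auto simp: tproj_def inner_add_left algebra_simps add_divide_distrib)

lemma tproj_inner [simp]: "y \<noteq> 0 \<Longrightarrow> tproj y v \<bullet> y = 0" "y \<noteq> 0 \<Longrightarrow> y \<bullet> tproj y v = 0"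
  by (auto simp: tproj_def inner_diff_left inner_diff_right inner_commute)

lemma tproj_id: "v \<bullet> y = 0 \<Longrightarrow> tproj y v = v"
  by (simp add: tproj_def)

lemma tproj_idem [simp]: "y \<noteq> 0 \<Longrightarrow> tproj y (tproj y v) = tproj y v"
  by (simp add: tproj_id)

lemma tproj_sym: "tproj y v \<bullet> w = v \<bullet> tproj y w"
  by (simp add: tproj_def inner_diff_left inner_diff_right inner_commute)

lemma tproj_self [simp]: "y \<noteq> 0 \<Longrightarrow> tproj y y = 0"
  by (simp add: tproj_def)

lemma tproj_inner_tangent: "w \<bullet> y = 0 \<Longrightarrow> tproj y v \<bullet> w = v \<bullet> w" "w \<bullet> y = 0 \<Longrightarrow> w \<bullet> tproj y v = w \<bullet> v"
  by (metis tproj_sym tproj_id) (metis tproj_sym tproj_id)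

lemma tproj_scale: "c \<noteq> 0 \<Longrightarrow> tproj (c *\<^sub>R y) v = tproj y v"
  by (simp add: tproj_def)

lemma retr_in [simp]: "R > 0 \<Longrightarrow> y \<noteq> 0 \<Longrightarrow> norm (retr R y) = R"
  by (simp add: retr_def)

lemma retr_id: "R > 0 \<Longrightarrow> norm x = R \<Longrightarrow> retr R x = x"
  by (auto simp: retr_def)

lemma retr_scale: "c > 0 \<Longrightarrow> retr R (c *\<^sub>R y) = retr R y"
  by (simp add: retr_def)

lemma retr_nz [simp]: "R > 0 \<Longrightarrow> y \<noteq> 0 \<Longrightarrow> retr R y \<noteq> 0"
  by (simp add: retr_def)

lemma tproj_retr [simp]: "R > 0 \<Longrightarrow> y \<noteq> 0 \<Longrightarrow> tproj (retr R y) = tproj y"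
  by (rule ext) (simp add: retr_def tproj_scale)

lemma smooth_on_tproj:
  assumes "open U" "smooth_on U p" "smooth_on U v" "\<And>x. x \<in> U \<Longrightarrow> p x \<noteq> 0"
  shows "smooth_on U (\<lambda>x. tproj (p x) (v x))"
  unfolding tproj_def
  by (intro smooth_on_diff smooth_on_scaleR smooth_on_divide smooth_on_inner assms) (use assms in auto)

lemma smooth_on_retr:
  assumes "open U" "smooth_on U f" "\<And>x. x \<in> U \<Longrightarrow> f x \<noteq> 0"
  shows "smooth_on U (\<lambda>x. retr R (f x))"
  unfolding retr_def
  by (intro smooth_on_scaleR smooth_on_divide smooth_on_norm assms smooth_on_const) (use assms in auto)

lemma curve_nz:
  assumes "x \<noteq> 0" "u \<bullet> x = 0" shows "x + s *\<^sub>R u \<noteq> 0"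
proof
  assume "x + s *\<^sub>R u = 0"
  then have "(x + s *\<^sub>R u) \<bullet> x = 0" by simp
  then show False using assms by (simp add: inner_add_left)
qed

lemma retr_has_derivative:
  assumes "R > 0" "norm x = R"
  shows "(retr R has_derivative tproj x) (at x)"
proof -
  have x: "x \<noteq> 0" using assms by auto
  have "((\<lambda>y. (R / norm y) *\<^sub>R y) has_derivative (\<lambda>v. (R / norm x) *\<^sub>R v +
      ((- (inverse (norm x) * (v \<bullet> sgn x) * inverse (norm x))) * R) *\<^sub>R x)) (at x)"
    unfolding divide_inverse mult.commute[of R]
    using x by (auto intro!: derivative_eq_intros has_derivative_norm)
  moreover have "(R / norm x) *\<^sub>R v + ((- (inverse (norm x) * (v \<bullet> sgn x) * inverse (norm x))) * R) *\<^sub>R x = tproj x v" for v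
    using assms by (simp add: tproj_def sgn_div_norm dot_square_norm power2_eq_square divide_inverse mult_ac)
  ultimately show ?thesis by (simp add: retr_def[abs_def])
qed

text \<open>The retracted straight line is the standard curve in the sphere with velocity
  \<open>u\<close>. It supplies the tangent vectors and, with radius 1, the velocity of the final
  test variation.\<close>

lemma curve_derivative:
  assumes "R > 0" "norm x = R" "u \<bullet> x = 0"
  shows "((\<lambda>s. retr R (x + s *\<^sub>R u)) has_vector_derivative u) (at 0)"
proof -
  have "((\<lambda>s. x + s *\<^sub>R u) has_derivative (\<lambda>s. s *\<^sub>R u)) (at 0)"
    by (auto intro!: derivative_eq_intros)
  moreover have "(retr R has_derivative tproj x) (at (x + 0 *\<^sub>R u))"
    using retr_has_derivative[OF assms(1,2)] by simp
  ultimately have "((\<lambda>s. retr R (x + s *\<^sub>R u)) has_derivative (\<lambda>s. tproj x (s *\<^sub>R u))) (at 0)"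
    by (rule has_derivative_compose)
  then show ?thesis
    using assms(3) by (simp add: has_vector_derivative_def tproj_id)
qed

lemma smooth_map_on_open: "open U \<Longrightarrow> smooth_on U f \<Longrightarrow> smooth_map_on U f"
  unfolding smooth_map_on_def smooth_on_def by blast

lemma tangent_space_sphere:
  assumes "R > 0" "x \<in> sphere 0 R"
  shows "tangent_space (sphere 0 R) x = {v. v \<bullet> x = 0}"
proof (intro equalityI subsetI)
  fix v assume "v \<in> tangent_space (sphere 0 R) x"
  then obtain e c where e: "e > 0" "smooth_map {-e<..<e} (sphere 0 R) c" "c 0 = x"
    "(c has_vector_derivative v) (at 0)" unfolding tangent_space_def by blast
  \<comment> \<open>Differentiate \<open>c s \<bullet> c s\<close>, which is constant because the
    curve stays on the sphere.\<close>
  have "((\<lambda>s. c s \<bullet> c s) has_derivative (\<lambda>s. c 0 \<bullet> (s *\<^sub>R v) + (s *\<^sub>R v) \<bullet> c 0)) (at 0)"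
    using e(4) by (intro has_derivative_inner) (auto simp: has_vector_derivative_def)
  moreover have "((\<lambda>s. c s \<bullet> c s) has_derivative (\<lambda>s. 0)) (at 0)"
  proof (rule has_derivative_transform_within_open[OF _ open_greaterThanLessThan[of "-e" e]])
    show "((\<lambda>s. R\<^sup>2) has_derivative (\<lambda>s. 0)) (at (0::real))" by simp
    show "0 \<in> {-e<..<e}" using e by simp
    fix s assume "s \<in> {-e<..<e}"
    then have "norm (c s) = R" using e(2) by (auto simp: smooth_map_def image_subset_iff)
    then show "R\<^sup>2 = c s \<bullet> c s" by (simp add: dot_square_norm)
  qed
  ultimately have "(\<lambda>s. c 0 \<bullet> (s *\<^sub>R v) + (s *\<^sub>R v) \<bullet> c 0) = (\<lambda>s::real. 0)"
    by (rule has_derivative_unique)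
  from fun_cong[OF this, of 1] show "v \<in> {v. v \<bullet> x = 0}"
    using e(3) by (simp add: inner_commute)
next
  fix v assume v: "v \<in> {v. v \<bullet> x = 0}"
  have x: "norm x = R" "x \<noteq> 0" using assms by auto
  have "smooth_on {-1<..<1} (\<lambda>s::real. retr R (x + s *\<^sub>R v))"
    using curve_nz[OF x(2)] v
    by (intro smooth_on_retr smooth_on_add smooth_on_scaleR smooth_on_ident smooth_on_const) auto
  then have "smooth_map {-1<..<1} (sphere 0 R) (\<lambda>s::real. retr R (x + s *\<^sub>R v))"
    using curve_nz[OF x(2)] v assms(1) unfolding smooth_map_def
    by (auto intro!: smooth_map_on_open)
  then show "v \<in> tangent_space (sphere 0 R) x"
    unfolding tangent_space_def using curve_derivative[OF assms(1) x(1), of v] v assms(1) retr_id[OF assms(1) x(1)]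
    by (intro CollectI exI[of _ 1] conjI exI[of _ "\<lambda>s::real. retr R (x + s *\<^sub>R v)"]) auto
qed

lemma orth_proj_hyperplane:
  assumes "x \<noteq> 0"
  shows "orth_proj {v. v \<bullet> x = 0} v = tproj x v"
  unfolding orth_proj_def
proof (rule the_equality)
  show "tproj x v \<in> {v. v \<bullet> x = 0} \<and> (\<forall>u\<in>{v. v \<bullet> x = 0}. (v - tproj x v) \<bullet> u = 0)"
    using assms by (auto simp: inner_diff_left tproj_inner_tangent)
next
  fix w assume w: "w \<in> {v. v \<bullet> x = 0} \<and> (\<forall>u\<in>{v. v \<bullet> x = 0}. (v - w) \<bullet> u = 0)"
  have t: "tproj x v - w \<in> {v. v \<bullet> x = 0}" using w assms by (simp add: inner_diff_left)
  have "(v - w) \<bullet> (tproj x v - w) = 0" using w t by blast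
  moreover have "(v - tproj x v) \<bullet> (tproj x v - w) = 0"
    using t by (simp add: inner_diff_left tproj_inner_tangent)
  ultimately have "(tproj x v - w) \<bullet> (tproj x v - w) = 0"
    by (simp add: algebra_simps)
  then show "w = tproj x v" by simp
qed

lemma orth_proj_sphere:
  "R > 0 \<Longrightarrow> x \<in> sphere 0 R \<Longrightarrow> orth_proj (tangent_space (sphere 0 R) x) v = tproj x v"
  by (subst tangent_space_sphere) (auto intro!: orth_proj_hyperplane)

lemma open_prod_compl0 [simp]: "open I \<Longrightarrow> open (I \<times> (- {0 :: 'a::euclidean_space}))"
  by (simp add: open_Times open_Compl)

text \<open>Smoothness on \<open>I \<times> sphere 0 R\<close> only provides local extensions. After
  composition with the retraction, which lands on the sphere, they all agree with one function on an
  open set.\<close>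

lemma smooth_map_on_variation:
  fixes f :: "real \<times> 'a::euclidean_space \<Rightarrow> 'b::euclidean_space"
  assumes "R > 0" "open I" "smooth_map_on (I \<times> sphere 0 R) f"
  shows "smooth_on (I \<times> (- {0})) (\<lambda>p. f (fst p, retr R (snd p)))"
proof (rule smooth_on_local)
  show o: "open (I \<times> (- {0 :: 'a}))" using assms by simp
  fix p :: "real \<times> 'a" assume p: "p \<in> I \<times> (- {0})"
  let ?h = "\<lambda>p::real \<times> 'a. (fst p, retr R (snd p))"
  have sm: "smooth_on (I \<times> (- {0})) ?h"
    using o by (intro smooth_on_Pair smooth_on_retr smooth_on_fst smooth_on_snd) auto
  have "?h p \<in> I \<times> sphere 0 R" using p assms by auto
  then obtain U g where U: "open U" "?h p \<in> U" "\<forall>k. Ck_on k g U" "\<forall>y\<in>(I \<times> sphere 0 R) \<inter> U. f y = g y"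
    using assms(3) unfolding smooth_map_on_def by blast
  let ?V = "(I \<times> (- {0})) \<inter> ?h -` U"
  have oV: "open ?V"
    using continuous_open_preimage[OF smooth_on_continuous[OF sm] o U(1)] by simp
  have "smooth_on ?V (\<lambda>p. g (?h p))"
    by (rule smooth_on_compose[OF oV U(1)])
       (use U(3) smooth_on_subset[OF sm, of ?V] in \<open>auto simp: smooth_on_def\<close>)
  moreover have "\<forall>y\<in>(I \<times> (- {0})) \<inter> ?V. f (?h y) = g (?h y)"
    using U(4) assms(1) by auto
  ultimately show "\<exists>V g. open V \<and> p \<in> V \<and> smooth_on V g \<and> (\<forall>y\<in>I \<times> (- {0}) \<inter> V. f (?h y) = g y)"
    using oV p U(2) by (intro exI[of _ ?V] exI[of _ "\<lambda>p. g (?h p)"]) auto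
qed

lemma smooth_on_slice:
  fixes f :: "real \<times> 'a::euclidean_space \<Rightarrow> 'b::real_normed_vector"
  assumes "smooth_on (I \<times> V) f" "open I" "open V" "t \<in> I"
  shows "smooth_on V (\<lambda>y. f (t, y))"
  by (rule smooth_on_compose[OF assms(3) _ _ assms(1), where f = "\<lambda>y. (t, y)"])
     (use assms in \<open>auto intro!: smooth_on_Pair smooth_on_ident open_Times\<close>)

lemma smooth_on_snd_compose:
  fixes f :: "'a::euclidean_space \<Rightarrow> 'b::real_normed_vector" and I :: "real set"
  assumes "smooth_on V f" "open I" "open V"
  shows "smooth_on (I \<times> V) (\<lambda>p. f (snd p))"
  by (rule smooth_on_compose[OF _ assms(3) _ assms(1)])
     (use assms in \<open>auto intro!: smooth_on_snd open_Times\<close>)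

lemma smooth_map_on_sphere:
  fixes f :: "'a::euclidean_space \<Rightarrow> 'b::euclidean_space"
  assumes "R > 0"
  shows "smooth_map_on (sphere 0 R) f \<longleftrightarrow> smooth_on (- {0}) (\<lambda>y. f (retr R y))"
proof
  assume f: "smooth_map_on (sphere 0 R) f"
  \<comment> \<open>A dummy time variable reduces this direction to the previous result about
    \<open>I \<times> sphere 0 R\<close>.\<close>
  have "smooth_map_on (UNIV \<times> sphere 0 R) (\<lambda>p::real \<times> 'a. f (snd p))"
    unfolding smooth_map_on_def
  proof (intro ballI)
    fix p :: "real \<times> 'a" assume "p \<in> UNIV \<times> sphere 0 R"
    then have "snd p \<in> sphere 0 R" by auto
    then obtain U g where U: "open U" "snd p \<in> U" "smooth_on U g" "\<forall>y\<in>sphere 0 R \<inter> U. f y = g y"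
      using f unfolding smooth_map_on_def smooth_on_def by meson
    have "smooth_on (UNIV \<times> U) (\<lambda>p::real \<times> 'a. g (snd p))"
      by (rule smooth_on_snd_compose) (use U in auto)
    then show "\<exists>U g. open U \<and> p \<in> U \<and> (\<forall>k. Ck_on k g U) \<and> (\<forall>y\<in>UNIV \<times> sphere 0 R \<inter> U. f (snd y) = g y)"
      using U by (intro exI[of _ "UNIV \<times> U"] exI[of _ "\<lambda>p. g (snd p)"])
        (auto simp: smooth_on_def open_Times mem_Times_iff)
  qed
  from smooth_map_on_variation[OF assms _ this] 
  have "smooth_on (UNIV \<times> (- {0})) (\<lambda>p::real \<times> 'a. f (retr R (snd p)))" by simp
  from smooth_on_slice[OF this, of 0] show "smooth_on (- {0}) (\<lambda>y. f (retr R y))" by auto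
next
  assume *: "smooth_on (- {0}) (\<lambda>y. f (retr R y))"
  show "smooth_map_on (sphere 0 R) f"
    unfolding smooth_map_on_def
    using * assms
    by (intro ballI exI[of _ "- {0}"] exI[of _ "\<lambda>y. f (retr R y)"]) (auto simp: smooth_on_def retr_id)
qed

text \<open>A derivative within the sphere is determined only on tangent directions. There it is
  compared with \<open>D\<close> along the retracted line through \<open>x\<close>.\<close>

lemma differential_sphere:
  fixes f :: "'a::euclidean_space \<Rightarrow> 'b::euclidean_space"
  assumes "R > 0" "norm x = R" "u \<bullet> x = 0" "((\<lambda>y. f (retr R y)) has_derivative D) (at x)"
  shows "differential (sphere 0 R) f x u = D u"
proof -
  have "(f has_derivative D) (at x within sphere 0 R)"
    by (rule has_derivative_transform[OF _ _ has_derivative_at_withinI[OF assms(4)]])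
       (use assms in \<open>auto simp: retr_id\<close>)
  then have "(f has_derivative frechet_derivative f (at x within sphere 0 R)) (at x within sphere 0 R)"
    (is "(f has_derivative ?F) _")
    using frechet_derivative_works differentiable_def by blast
  moreover define c where "c = (\<lambda>s. retr R (x + s *\<^sub>R u))"
  have c: "(c has_derivative (\<lambda>s. s *\<^sub>R u)) (at 0)" "c 0 = x" "c ` UNIV \<subseteq> sphere 0 R"
    using curve_derivative[OF assms(1-3)] curve_nz[of x u] assms
    by (auto simp: c_def has_vector_derivative_def retr_id)
  ultimately have "(f has_derivative ?F) (at (c 0) within c ` UNIV)"
    by (metis has_derivative_subset)
  from has_derivative_in_compose[OF c(1) this]
  have 1: "((\<lambda>s. f (c s)) has_derivative (\<lambda>s. ?F (s *\<^sub>R u))) (at 0)" by simp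
  have "((\<lambda>y. f (retr R y)) has_derivative D) (at (c 0))" using assms c by simp
  from has_derivative_compose[OF c(1) this]
  have "((\<lambda>s. f (retr R (c s))) has_derivative (\<lambda>s. D (s *\<^sub>R u))) (at 0)" .
  moreover have "retr R (c s) = c s" for s
    using c(3) assms(1) by (intro retr_id) (auto simp: image_subset_iff)
  ultimately have "((\<lambda>s. f (c s)) has_derivative (\<lambda>s. D (s *\<^sub>R u))) (at 0)" by simp
  from fun_cong[OF has_derivative_unique[OF 1 this], of 1] show ?thesis
    by (simp add: differential_def)
qed


section \<open>Alternating functions on lists\<close>

text \<open>Lists of all lengths are treated at once, so that one function carries all degrees of a
  form. The condition speaks of adjacent equal entries; \<open>alternating_eq0\<close> extends it to
  arbitrary positions.\<close>

definition alternating :: "('a::real_vector list \<Rightarrow> 'b::real_vector) \<Rightarrow> bool" where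
  "alternating g \<longleftrightarrow>
     (\<forall>us ws. linear (\<lambda>v. g (us @ v # ws))) \<and> (\<forall>us v ws. g (us @ v # v # ws) = 0)"

lemma alternating_linear: "alternating g \<Longrightarrow> linear (\<lambda>v. g (us @ v # ws))"
  and alternating_adj: "alternating g \<Longrightarrow> g (us @ v # v # ws) = 0"
  by (auto simp: alternating_def)

lemma alternating_linear1: "alternating g \<Longrightarrow> linear (\<lambda>v. g (v # ws))"
  using alternating_linear[of g "[]"] by simp

lemma alternating_Cons: "alternating g \<Longrightarrow> alternating (\<lambda>vs. g (v # vs))"
  using alternating_linear[of g "v # _"] alternating_adj[of g "v # _"]
  by (simp add: alternating_def[of "\<lambda>vs. g (v # vs)"])

text \<open>Polarisation: expand the value at the repeated entry \<open>v + w\<close>.\<close>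

lemma alternating_swap:
  assumes "alternating g" shows "g (us @ v # w # ws) = - g (us @ w # v # ws)"
proof -
  have l1: "g (us @ (a + b) # ws') = g (us @ a # ws') + g (us @ b # ws')" for a b ws'
    using linear_add[OF alternating_linear[OF assms]] .
  have l2: "g (us @ c # (a + b) # ws) = g (us @ c # a # ws) + g (us @ c # b # ws)" for a b c
    using linear_add[OF alternating_linear[OF assms, of "us @ [c]" ws], of a b] by simp
  have "0 = g (us @ (v + w) # (v + w) # ws)" using alternating_adj[OF assms] by simp
  also have "\<dots> = g (us @ v # w # ws) + g (us @ w # v # ws)"
    unfolding l1 l2 by (simp add: alternating_adj[OF assms])
  finally show ?thesis unfolding eq_neg_iff_add_eq_0 by (rule sym)
qed

lemma alternating_swap2: "alternating g \<Longrightarrow> g (v # w # ws) = - g (w # v # ws)"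
  by (metis alternating_swap append_Nil)

lemma alternating_eq0: "alternating g \<Longrightarrow> g (us @ v # zs @ v # ws) = 0"
proof (induction zs arbitrary: us)
  case Nil then show ?case by (simp add: alternating_adj)
next
  case (Cons z zs)
  have "g (us @ v # (z # zs) @ v # ws) = - g ((us @ [z]) @ v # zs @ v # ws)"
    using alternating_swap[OF Cons.prems, of us v z "zs @ v # ws"] by simp
  then show ?case using Cons.IH[OF Cons.prems, of "us @ [z]"] by simp
qed

lemma alternating_map:
  assumes "alternating g" "linear L"
  shows "alternating (\<lambda>vs. g (map L vs))"
proof -
  have "linear (\<lambda>v. g (map L us @ L v # map L ws))" for us ws
    using linear_compose[OF assms(2) alternating_linear[OF assms(1)]] by (simp add: o_def)
  then show ?thesis by (simp add: alternating_def alternating_adj[OF assms(1)])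
qed

lemma alternating_post:
  assumes "alternating g" "linear T"
  shows "alternating (\<lambda>vs. T (g vs))"
proof -
  have "linear (\<lambda>v. T (g (us @ v # ws)))" for us ws
    using linear_compose[OF alternating_linear[OF assms(1)] assms(2)] by (simp add: o_def)
  then show ?thesis by (simp add: alternating_def alternating_adj[OF assms(1)] linear_0[OF assms(2)])
qed

lemma alternating_add:
  "alternating f \<Longrightarrow> alternating g \<Longrightarrow> alternating (\<lambda>vs. f vs + g vs)"
  by (simp add: alternating_def linear_compose_add)

lemma alternating_scaleR: "alternating f \<Longrightarrow> alternating (\<lambda>vs. c *\<^sub>R f vs)"
  by (rule alternating_post) (auto simp: linear_iff algebra_simps)

lemma alternating_sum:
  "(\<And>i. i \<in> I \<Longrightarrow> alternating (f i)) \<Longrightarrow> alternating (\<lambda>vs. \<Sum>i\<in>I. f i vs)"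
  by (simp add: alternating_def linear_compose_sum)

text \<open>The alternating sum in the definition of \<open>ext_d\<close>, in a recursive form
  suited to induction on the argument list; \<open>alt_sum_eq\<close> recovers the indexed
  form.\<close>

primrec alt_sum :: "'a list \<Rightarrow> ('a \<Rightarrow> 'a list \<Rightarrow> 'b::real_vector) \<Rightarrow> 'b" where
  "alt_sum [] A = 0"
| "alt_sum (v # vs) A = A v vs - alt_sum vs (\<lambda>u ws. A u (v # ws))"

lemma alt_sum_eq:
  "alt_sum vs A = (\<Sum>i<length vs. (-1) ^ i *\<^sub>R A (vs ! i) (take i vs @ drop (Suc i) vs))"
proof (induction vs arbitrary: A)
  case (Cons v vs)
  show ?case
    by (simp add: Cons.IH sum.lessThan_Suc_shift sum_negf del: sum.lessThan_Suc)
qed simp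

lemma linear_alt_sum:
  "(\<And>u ws. linear (\<lambda>x. A x u ws)) \<Longrightarrow> linear (\<lambda>x. alt_sum vs (A x))"
proof (induction vs arbitrary: A)
  case Nil then show ?case by (simp add: linear_iff)
next
  case (Cons v vs)
  then show ?case by (simp add: linear_compose_sub)
qed

lemma alt_sum_0: "alt_sum vs (\<lambda>u ws. 0) = 0"
  by (induction vs) auto

text \<open>For an adjacent pair \<open>v, v\<close>, the two terms that remove one copy of
  \<open>v\<close> cancel, and every other term keeps both copies and vanishes.\<close>

lemma alternating_alt_sum:
  assumes "\<And>u. alternating (A u)" "\<And>vs. linear (\<lambda>u. A u vs)"
  shows "alternating (\<lambda>vs. alt_sum vs A)"
  unfolding alternating_def
proof (intro conjI allI)
  fix us ws
  show "linear (\<lambda>v. alt_sum (us @ v # ws) A)"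
    using assms
  proof (induction us arbitrary: A)
    case Nil
    have "linear (\<lambda>v. alt_sum ws (\<lambda>u ws. A u (v # ws)))"
      using alternating_linear1[OF Nil(1)] by (rule linear_alt_sum)
    then show ?case using Nil(2) by (simp add: linear_compose_sub)
  next
    case (Cons w us)
    have "linear (\<lambda>v. alt_sum (us @ v # ws) (\<lambda>u ws. A u (w # ws)))"
      using Cons.prems by (intro Cons.IH alternating_Cons) auto
    then show ?case using alternating_linear[OF Cons.prems(1)]
      by (simp add: linear_compose_sub)
  qed
next
  fix us v ws
  show "alt_sum (us @ v # v # ws) A = 0"
    using assms
  proof (induction us arbitrary: A)
    case Nil
    have "A u (v # v # ws') = 0" for u ws' using alternating_adj[OF Nil(1), of _ "[]"] by simp
    then show ?case by (simp add: alt_sum_0)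
  next
    case (Cons w us)
    have "alt_sum (us @ v # v # ws) (\<lambda>u ws. A u (w # ws)) = 0"
      using Cons.prems by (intro Cons.IH alternating_Cons) auto
    then show ?case using alternating_adj[OF Cons.prems(1)] by simp
  qed
qed

text \<open>
  The sum over all tuples counts each increasing one \<open>n!\<close> times, but it is visibly independent of
  the choice of an orthonormal basis.
\<close>

primrec tuple_inner :: "'a set \<Rightarrow> nat \<Rightarrow> ('a list \<Rightarrow> 'b::real_inner) \<Rightarrow> ('a list \<Rightarrow> 'b) \<Rightarrow> real" where
  "tuple_inner B 0 f g = f [] \<bullet> g []"
| "tuple_inner B (Suc n) f g = (\<Sum>b\<in>B. tuple_inner B n (\<lambda>vs. f (b # vs)) (\<lambda>vs. g (b # vs)))"

lemma tuple_inner_sym: "tuple_inner B n f g = tuple_inner B n g f"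
proof (induction n arbitrary: f g)
  case (Suc n)
  show ?case unfolding tuple_inner.simps by (intro sum.cong refl Suc.IH)
qed (simp add: inner_commute)

lemma tuple_inner_nonneg: "tuple_inner B n f f \<ge> 0"
  by (induction n arbitrary: f) (auto intro: sum_nonneg)

lemma linear_tuple_inner_left:
  "(\<And>vs. linear (\<lambda>x. F x vs)) \<Longrightarrow> linear (\<lambda>x. tuple_inner B n (F x) g)"
proof (induction n arbitrary: F g)
  case 0
  then show ?case by (simp add: linear_iff inner_add_left)
next
  case (Suc n)
  then show ?case by (simp add: linear_compose_sum)
qed

lemma linear_tuple_inner_right:
  "(\<And>vs. linear (\<lambda>x. F x vs)) \<Longrightarrow> linear (\<lambda>x. tuple_inner B n g (F x))"
  using linear_tuple_inner_left[of F B n g] by (simp add: tuple_inner_sym)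

lemma tuple_inner_add_left: "tuple_inner B n (\<lambda>vs. f vs + f' vs) g = tuple_inner B n f g + tuple_inner B n f' g"
  by (induction n arbitrary: f f' g) (auto simp: inner_add_left sum.distrib)

lemma tuple_inner_diff_left: "tuple_inner B n (\<lambda>vs. f vs - f' vs) g = tuple_inner B n f g - tuple_inner B n f' g"
  by (induction n arbitrary: f f' g) (auto simp: inner_diff_left sum_subtractf)

lemma tuple_inner_minus_left: "tuple_inner B n (\<lambda>vs. - f vs) g = - tuple_inner B n f g"
  by (induction n arbitrary: f g) (auto simp: sum_negf)

lemma tuple_inner_scaleR_left: "tuple_inner B n (\<lambda>vs. c *\<^sub>R f vs) g = c * tuple_inner B n f g"
  by (induction n arbitrary: f g) (auto simp: sum_distrib_left)

lemma tuple_inner_diff_right: "tuple_inner B n f (\<lambda>vs. g vs - g' vs) = tuple_inner B n f g - tuple_inner B n f g'"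
  by (simp add: tuple_inner_sym[of B n f] tuple_inner_diff_left)

lemma tuple_inner_minus_right: "tuple_inner B n f (\<lambda>vs. - g vs) = - tuple_inner B n f g"
  by (simp add: tuple_inner_sym[of B n f] tuple_inner_minus_left)

lemma tuple_inner_scaleR_right: "tuple_inner B n f (\<lambda>vs. c *\<^sub>R g vs) = c * tuple_inner B n f g"
  by (simp add: tuple_inner_sym[of B n f] tuple_inner_scaleR_left)

lemma tuple_inner_zero_left [simp]: "tuple_inner B n (\<lambda>vs. 0) g = 0"
  using tuple_inner_scaleR_left[of B n 0 "\<lambda>_. 0" g] by simp

lemma tuple_inner_zero_right [simp]: "tuple_inner B n g (\<lambda>vs. 0) = 0"
  by (subst tuple_inner_sym) simp

lemma tuple_inner_sum_left: "tuple_inner B n (\<lambda>vs. \<Sum>i\<in>I. f i vs) g = (\<Sum>i\<in>I. tuple_inner B n (f i) g)"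
  by (induction I rule: infinite_finite_induct) (auto simp: tuple_inner_add_left)

lemma tuple_inner_sum_right: "tuple_inner B n g (\<lambda>vs. \<Sum>i\<in>I. f i vs) = (\<Sum>i\<in>I. tuple_inner B n g (f i))"
  using tuple_inner_sum_left[of B n f I g] by (simp add: tuple_inner_sym)

lemma tuple_inner_cong_inner:
  "(\<And>vs. f vs \<bullet> g vs = f' vs \<bullet> g' vs) \<Longrightarrow> tuple_inner B n f g = tuple_inner B n f' g'"
proof (induction n arbitrary: f g f' g')
  case (Suc n)
  show ?case unfolding tuple_inner.simps by (intro sum.cong refl Suc.IH Suc.prems)
qed simp

text \<open>By antisymmetry of \<open>g\<close>, each of the \<open>Suc n\<close> places from which
  \<open>alt_sum\<close> takes the distinguished argument contributes the same amount. The factor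
  turns \<open>1 / fact (Suc n)\<close> into \<open>1 / fact n\<close> in the adjointness
  proof.\<close>

lemma tuple_inner_alt_sum:
  assumes "alternating g"
  shows "tuple_inner B (Suc n) (\<lambda>vs. alt_sum vs A) g = real (Suc n) * (\<Sum>a\<in>B. tuple_inner B n (A a) (\<lambda>vs. g (a # vs)))"
  using assms
proof (induction n arbitrary: A g)
  case 0
  then show ?case by simp
next
  case (Suc n)
  have sw: "g (v # a # vs) = - g (a # v # vs)" for v a vs
    by (rule alternating_swap2[OF Suc.prems])
  have "tuple_inner B (Suc (Suc n)) (\<lambda>vs. alt_sum vs A) g
      = (\<Sum>v\<in>B. tuple_inner B (Suc n) (A v) (\<lambda>vs. g (v # vs))) -
        (\<Sum>v\<in>B. tuple_inner B (Suc n) (\<lambda>vs. alt_sum vs (\<lambda>u ws. A u (v # ws))) (\<lambda>vs. g (v # vs)))"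
    by (subst tuple_inner.simps(2)) (simp only: alt_sum.simps tuple_inner_diff_left sum_subtractf)
  also have "(\<Sum>v\<in>B. tuple_inner B (Suc n) (\<lambda>vs. alt_sum vs (\<lambda>u ws. A u (v # ws))) (\<lambda>vs. g (v # vs)))
      = (\<Sum>v\<in>B. real (Suc n) * (\<Sum>a\<in>B. tuple_inner B n (\<lambda>vs. A a (v # vs)) (\<lambda>vs. g (v # a # vs))))"
    by (intro sum.cong refl Suc.IH alternating_Cons Suc.prems)
  also have "\<dots> = - real (Suc n) * (\<Sum>v\<in>B. \<Sum>a\<in>B. tuple_inner B n (\<lambda>vs. A a (v # vs)) (\<lambda>vs. g (a # v # vs)))"
    by (subst sw) (simp only: tuple_inner_minus_right sum_negf sum_distrib_left mult_minus_right mult_minus_left)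
  also have "(\<Sum>v\<in>B. \<Sum>a\<in>B. tuple_inner B n (\<lambda>vs. A a (v # vs)) (\<lambda>vs. g (a # v # vs)))
      = (\<Sum>a\<in>B. tuple_inner B (Suc n) (A a) (\<lambda>vs. g (a # vs)))"
    by (subst sum.swap) simp
  finally show ?case by (simp add: algebra_simps)
qed

text \<open>A tuple on which \<open>f\<close> does not vanish contains \<open>e\<close> at most
  once. Moving it to the front changes the signs of \<open>f\<close> and \<open>g\<close> alike, so
  the \<open>n\<close> possible positions contribute equally. For \<open>n = 0\<close> the truncated
  \<open>n - 1\<close> comes with the factor 0.\<close>

lemma tuple_inner_insert:
  assumes "finite B" "e \<notin> B" "alternating f" "alternating g"
  shows "tuple_inner (insert e B) n f g =
    tuple_inner B n f g + real n * tuple_inner B (n - 1) (\<lambda>vs. f (e # vs)) (\<lambda>vs. g (e # vs))"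
  using assms(3,4)
proof (induction n arbitrary: f g)
  case 0
  then show ?case by simp
next
  case (Suc n)
  note a = Suc.prems
  have z: "f (e # e # vs) = 0" for vs using alternating_adj[OF a(1), of "[]"] by simp
  have sw: "f (b # e # vs) = - f (e # b # vs)" "g (b # e # vs) = - g (e # b # vs)" for b vs
    by (rule alternating_swap2[OF a(1)], rule alternating_swap2[OF a(2)])
  have IH: "tuple_inner (insert e B) n (\<lambda>vs. f (b # vs)) (\<lambda>vs. g (b # vs)) =
     tuple_inner B n (\<lambda>vs. f (b # vs)) (\<lambda>vs. g (b # vs)) +
     real n * tuple_inner B (n - 1) (\<lambda>vs. f (b # e # vs)) (\<lambda>vs. g (b # e # vs))" for b
    using Suc.IH[OF alternating_Cons[OF a(1)] alternating_Cons[OF a(2)]] .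
  have s: "real n * (\<Sum>b\<in>B. tuple_inner B (n - 1) (\<lambda>vs. f (b # e # vs)) (\<lambda>vs. g (b # e # vs)))
     = real n * tuple_inner B n (\<lambda>vs. f (e # vs)) (\<lambda>vs. g (e # vs))"
    by (cases n) (simp_all add: sw tuple_inner_minus_left tuple_inner_minus_right)
  show ?case
    using assms(1,2) s
    by (simp add: IH sum.distrib z flip: sum_distrib_left) (simp add: algebra_simps)
qed

text \<open>The sum over sublists that defines \<open>form_inner\<close>: a sublist either omits the
  head or contains it.\<close>

primrec ip_list :: "'a list \<Rightarrow> ('a list \<Rightarrow> 'b::real_inner) \<Rightarrow> ('a list \<Rightarrow> 'b) \<Rightarrow> real" where
  "ip_list [] f g = f [] \<bullet> g []"
| "ip_list (e # es) f g = ip_list es f g + ip_list es (\<lambda>vs. f (e # vs)) (\<lambda>vs. g (e # vs))"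

lemma ip_list_eq: "(\<Sum>I\<in>Pow {..<length es}. f (nths es I) \<bullet> g (nths es I)) = ip_list es f g"
proof (induction es arbitrary: f g)
  case (Cons e es)
  have lt: "{..<length (e # es)} = insert 0 (Suc ` {..<length es})"
    by (simp add: lessThan_Suc_eq_insert_0)
  have inj: "inj_on (\<lambda>I. Suc ` I) X" for X by (simp add: inj_on_def inj_image_eq_iff)
  have inj2: "inj_on (insert 0) (Pow (Suc ` {..<length es}))"
    unfolding inj_on_def by (auto simp: insert_ident image_iff)
  have n1: "nths (e # es) (Suc ` I) = nths es I" "nths (e # es) (insert 0 (Suc ` I)) = e # nths es I" for I
    by (auto simp: nths_Cons inj_image_mem_iff)
  have P: "Pow (Suc ` {..<length es}) = (\<lambda>I. Suc ` I) ` Pow {..<length es}"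
    by (simp add: image_Pow_surj)
  have "(\<Sum>I\<in>Pow {..<length (e # es)}. f (nths (e # es) I) \<bullet> g (nths (e # es) I)) =
    (\<Sum>I\<in>Pow (Suc ` {..<length es}). f (nths (e # es) I) \<bullet> g (nths (e # es) I)) +
    (\<Sum>I\<in>insert 0 ` Pow (Suc ` {..<length es}). f (nths (e # es) I) \<bullet> g (nths (e # es) I))"
    unfolding lt Pow_insert by (rule sum.union_disjoint) auto
  also have "\<dots> = ip_list (e # es) f g"
    by (subst sum.reindex[OF inj2], unfold P, subst (1 2) sum.reindex[OF inj])
       (simp add: n1 o_def Cons.IH[of f g] Cons.IH[of "\<lambda>vs. f (e # vs)" "\<lambda>vs. g (e # vs)"])
  finally show ?case .
qed simp

text \<open>Each increasing tuple of length \<open>k\<close> is counted \<open>fact k\<close> times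
  among all tuples. The bound \<open>K\<close> may exceed the length because the two recursive calls
  need different bounds.\<close>

lemma ip_list_tuple_inner:
  assumes "alternating f" "alternating g" "distinct es" "length es \<le> K"
  shows "ip_list es f g = (\<Sum>k\<le>K. tuple_inner (set es) k f g / fact k)"
  using assms
proof (induction es arbitrary: f g K)
  case Nil
  have "tuple_inner {} k f g = (if k = 0 then f [] \<bullet> g [] else 0)" for k by (cases k) auto
  then show ?case by (simp add: if_distrib[of "\<lambda>x. x / _"] cong: if_cong)
next
  case (Cons e es)
  then obtain K' where K: "K = Suc K'" by (cases K) auto
  have "(\<Sum>k\<le>K. tuple_inner (set (e # es)) k f g / fact k) =
     (\<Sum>k\<le>K. tuple_inner (set es) k f g / fact k) +
     (\<Sum>k\<le>K. real k * tuple_inner (set es) (k - 1) (\<lambda>vs. f (e # vs)) (\<lambda>vs. g (e # vs)) / fact k)"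
    using Cons.prems by (simp add: tuple_inner_insert add_divide_distrib sum.distrib)
  also have "(\<Sum>k\<le>K. real k * tuple_inner (set es) (k - 1) (\<lambda>vs. f (e # vs)) (\<lambda>vs. g (e # vs)) / fact k)
     = (\<Sum>k\<le>K'. tuple_inner (set es) k (\<lambda>vs. f (e # vs)) (\<lambda>vs. g (e # vs)) / fact k)"
    unfolding K by (subst sum.atMost_Suc_shift) (simp del: of_nat_Suc add: fact_Suc)
  also have "\<dots> = ip_list es (\<lambda>vs. f (e # vs)) (\<lambda>vs. g (e # vs))"
    using Cons.prems K by (intro Cons.IH[symmetric] alternating_Cons) auto
  also have "(\<Sum>k\<le>K. tuple_inner (set es) k f g / fact k) = ip_list es f g"
    using Cons.prems by (intro Cons.IH[symmetric]) auto
  finally show ?case by simp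
qed

text \<open>Invariance of the trace: after expansion of \<open>L\<close> in \<open>Basis\<close>,
  Parseval's identity for \<open>B\<close> turns the coefficients into Kronecker symbols.\<close>

lemma trace_onb:
  fixes L :: "'a::euclidean_space \<Rightarrow> 'a \<Rightarrow> real"
  assumes "finite B" "pairwise orthogonal B" "\<And>b. b \<in> B \<Longrightarrow> norm b = 1" "span B = UNIV"
    and "\<And>v. linear (L v)" "\<And>w. linear (\<lambda>v. L v w)"
  shows "(\<Sum>b\<in>B. L b b) = (\<Sum>b\<in>Basis. L b b)"
proof -
  have pars: "(\<Sum>b\<in>B. (b \<bullet> i) * (b \<bullet> j)) = i \<bullet> j" for i j
  proof -
    have "i = (\<Sum>b\<in>B. (b \<bullet> i) *\<^sub>R b)"
      using orthonormal_basis_expand[OF assms(2,3) _ assms(1), of i] assms(4) by (simp add: inner_commute)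
    then have "i \<bullet> j = (\<Sum>b\<in>B. (b \<bullet> i) *\<^sub>R b) \<bullet> j" by simp
    then show ?thesis by (simp add: inner_sum_left)
  qed
  have ex: "L v w = (\<Sum>i\<in>Basis. \<Sum>j\<in>Basis. (v \<bullet> i) * (w \<bullet> j) * L i j)" for v w
  proof -
    have "L v w = L (\<Sum>i\<in>Basis. (v \<bullet> i) *\<^sub>R i) w" by (simp add: euclidean_representation)
    also have "\<dots> = (\<Sum>i\<in>Basis. (v \<bullet> i) * L i w)"
      by (simp add: linear_sum[OF assms(6)] linear_cmul[OF assms(6)])
    also have "\<dots> = (\<Sum>i\<in>Basis. (v \<bullet> i) * L i (\<Sum>j\<in>Basis. (w \<bullet> j) *\<^sub>R j))"
      by (simp add: euclidean_representation)
    also have "\<dots> = (\<Sum>i\<in>Basis. \<Sum>j\<in>Basis. (v \<bullet> i) * (w \<bullet> j) * L i j)"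
      by (simp add: linear_sum[OF assms(5)] linear_cmul[OF assms(5)] sum_distrib_left mult.assoc)
    finally show ?thesis .
  qed
  have "(\<Sum>b\<in>B. L b b) = (\<Sum>b\<in>B. \<Sum>i\<in>Basis. \<Sum>j\<in>Basis. (b \<bullet> i) * (b \<bullet> j) * L i j)"
    by (rule sum.cong[OF refl ex])
  also have "\<dots> = (\<Sum>i\<in>Basis. \<Sum>j\<in>Basis. \<Sum>b\<in>B. (b \<bullet> i) * (b \<bullet> j) * L i j)"
    by (subst sum.swap, rule sum.cong[OF refl], rule sum.swap)
  also have "\<dots> = (\<Sum>i\<in>Basis. \<Sum>j\<in>Basis. (i \<bullet> j) * L i j)"
    by (simp only: pars flip: sum_distrib_right)
  also have "\<dots> = (\<Sum>i\<in>Basis. L i i)"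
    by (simp add: inner_Basis if_distrib[of "\<lambda>x. x * _"] cong: if_cong)
  finally show ?thesis .
qed

text \<open>The basis is changed in one argument at a time, the sum over the first entry being a
  trace.\<close>

lemma tuple_inner_onb:
  fixes f g :: "'a::euclidean_space list \<Rightarrow> 'b::real_inner"
  assumes "finite B" "pairwise orthogonal B" "\<And>b. b \<in> B \<Longrightarrow> norm b = 1" "span B = UNIV"
    and "alternating f" "alternating g"
  shows "tuple_inner B n f g = tuple_inner Basis n f g"
  using assms(5,6)
proof (induction n arbitrary: f g)
  case (Suc n)
  have "tuple_inner B (Suc n) f g = (\<Sum>b\<in>B. tuple_inner Basis n (\<lambda>vs. f (b # vs)) (\<lambda>vs. g (b # vs)))"
    using Suc.prems by (simp add: Suc.IH alternating_Cons)
  also have "\<dots> = (\<Sum>b\<in>Basis. tuple_inner Basis n (\<lambda>vs. f (b # vs)) (\<lambda>vs. g (b # vs)))"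
    using Suc.prems
    by (intro trace_onb[OF assms(1-4), where L = "\<lambda>v w. tuple_inner Basis n (\<lambda>vs. f (v # vs)) (\<lambda>vs. g (w # vs))"]
         linear_tuple_inner_left linear_tuple_inner_right alternating_linear1)
  finally show ?case by simp
qed simp

lemma tuple_inner_definite:
  assumes "alternating f" "tuple_inner Basis n f f = 0" "length vs = n"
  shows "f (vs :: 'a::euclidean_space list) = 0"
  using assms
proof (induction n arbitrary: f vs)
  case (Suc n)
  then obtain v ws where vs: "vs = v # ws" "length ws = n" by (cases vs) auto
  have "tuple_inner Basis n (\<lambda>vs. f (b # vs)) (\<lambda>vs. f (b # vs)) = 0" if "b \<in> Basis" for b
    using Suc.prems(2) that by (simp add: sum_nonneg_eq_0_iff tuple_inner_nonneg)
  then have z: "f (b # ws) = 0" if "b \<in> Basis" for b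
    using Suc.IH[OF alternating_Cons[OF Suc.prems(1)] _ vs(2)] that by blast
  have "f (v # ws) = f ((\<Sum>b\<in>Basis. (v \<bullet> b) *\<^sub>R b) # ws)" by (simp add: euclidean_representation)
  also have "\<dots> = 0"
    using z by (simp add: linear_sum[OF alternating_linear1[OF Suc.prems(1)]]
        linear_cmul[OF alternating_linear1[OF Suc.prems(1)]])
  finally show ?case using vs by simp
qed simp

text \<open>Both sums contract \<open>L\<close> with the matrix of \<open>P\<close>, which is
  symmetric.\<close>

lemma sum_basis_sym:
  fixes L :: "'a::euclidean_space \<Rightarrow> 'a \<Rightarrow> real"
  assumes "\<And>v. linear (L v)" "\<And>w. linear (\<lambda>v. L v w)"
    and "\<And>v w. P v \<bullet> w = v \<bullet> P w"
  shows "(\<Sum>b\<in>Basis. L b (P b)) = (\<Sum>b\<in>Basis. L (P b) b)"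
proof -
  have "(\<Sum>b\<in>Basis. L b (P b)) = (\<Sum>b\<in>Basis. L b (\<Sum>c\<in>Basis. (P b \<bullet> c) *\<^sub>R c))"
    by (simp add: euclidean_representation)
  also have "\<dots> = (\<Sum>b\<in>Basis. \<Sum>c\<in>Basis. (P b \<bullet> c) * L b c)"
    by (simp add: linear_sum[OF assms(1)] linear_cmul[OF assms(1)])
  also have "\<dots> = (\<Sum>c\<in>Basis. \<Sum>b\<in>Basis. (P c \<bullet> b) * L b c)"
    by (subst sum.swap) (metis (no_types, lifting) assms(3) inner_commute sum.cong)
  also have "\<dots> = (\<Sum>c\<in>Basis. L (\<Sum>b\<in>Basis. (P c \<bullet> b) *\<^sub>R b) c)"
    by (simp add: linear_sum[OF assms(2)] linear_cmul[OF assms(2)])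
  finally show ?thesis by (simp add: euclidean_representation)
qed

text \<open>Moves a symmetric map, in practice the tangential projection, from the arguments of one
  form to those of the other.\<close>

lemma tuple_inner_map_sym:
  fixes f g :: "'a::euclidean_space list \<Rightarrow> 'b::real_inner"
  assumes "linear P" "\<And>v w. P v \<bullet> w = v \<bullet> P w" "alternating f" "alternating g"
  shows "tuple_inner Basis n f (\<lambda>vs. g (map P vs)) = tuple_inner Basis n (\<lambda>vs. f (map P vs)) g"
  using assms(3,4)
proof (induction n arbitrary: f g)
  case (Suc n)
  have "tuple_inner Basis (Suc n) f (\<lambda>vs. g (map P vs)) =
      (\<Sum>b\<in>Basis. tuple_inner Basis n (\<lambda>vs. f (b # map P vs)) (\<lambda>vs. g (P b # vs)))"
    using Suc.prems
    by (simp add: Suc.IH[OF alternating_Cons[OF Suc.prems(1)] alternating_Cons[OF Suc.prems(2)]])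
  also have "\<dots> = (\<Sum>b\<in>Basis. tuple_inner Basis n (\<lambda>vs. f (P b # map P vs)) (\<lambda>vs. g (b # vs)))"
    using Suc.prems
    by (intro sum_basis_sym[where L = "\<lambda>v w. tuple_inner Basis n (\<lambda>vs. f (v # map P vs)) (\<lambda>vs. g (w # vs))"]
         linear_tuple_inner_left linear_tuple_inner_right alternating_linear1 assms(2))
  finally show ?case by simp
qed simp

lemma tuple_inner_has_derivative:
  assumes "\<And>vs. ((\<lambda>p. F p vs) has_derivative (\<lambda>h. F' h vs)) (at p)"
    and "\<And>vs. ((\<lambda>p. G p vs) has_derivative (\<lambda>h. G' h vs)) (at p)"
  shows "((\<lambda>p. tuple_inner B n (F p) (G p)) has_derivative
     (\<lambda>h. tuple_inner B n (F' h) (G p) + tuple_inner B n (F p) (G' h))) (at p)"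
  using assms
proof (induction n arbitrary: F F' G G')
  case 0
  have "((\<lambda>p. F p [] \<bullet> G p []) has_derivative (\<lambda>h. F p [] \<bullet> G' h [] + F' h [] \<bullet> G p [])) (at p)"
    using 0 by (intro has_derivative_inner)
  then show ?case by (simp add: add.commute)
next
  case (Suc n)
  show ?case
    unfolding tuple_inner.simps sum.distrib[symmetric]
    by (intro has_derivative_sum Suc.IH Suc.prems)
qed

lemma smooth_on_tuple_inner:
  assumes "open U" "\<And>vs. smooth_on U (\<lambda>p. F p vs)" "\<And>vs. smooth_on U (\<lambda>p. G p vs)"
  shows "smooth_on U (\<lambda>p. tuple_inner B n (F p) (G p))"
  using assms(2,3)
  by (induction n arbitrary: F G) (auto intro!: smooth_on_sum smooth_on_inner assms(1))

lemma alternating_expand1: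
  assumes "alternating g"
  shows "g (v # ws) = (\<Sum>b\<in>Basis. (v \<bullet> b) *\<^sub>R g ((b::'a::euclidean_space) # ws))"
proof -
  have "g (v # ws) = g ((\<Sum>b\<in>Basis. (v \<bullet> b) *\<^sub>R b) # ws)" by (simp add: euclidean_representation)
  then show ?thesis
    by (simp only: linear_sum[OF alternating_linear1[OF assms]] linear_cmul[OF alternating_linear1[OF assms]])
qed

text \<open>Forms are known to be smooth on fixed arguments; expansion in \<open>Basis\<close>
  extends this to arguments that vary with the point.\<close>

lemma smooth_on_alternating:
  fixes w :: "'p::real_normed_vector \<Rightarrow> 'c \<Rightarrow> 'a::euclidean_space"
  assumes "open U" "\<And>p. p \<in> U \<Longrightarrow> alternating (g p)" "\<And>vs. smooth_on U (\<lambda>p. g p vs)"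
    and "\<And>a. a \<in> set as \<Longrightarrow> smooth_on U (\<lambda>p. w p a)"
  shows "smooth_on U (\<lambda>p. g p (map (w p) as))"
  using assms(2-)
proof (induction as arbitrary: g)
  case (Cons a as)
  have "smooth_on U (\<lambda>p. \<Sum>b\<in>Basis. (w p a \<bullet> b) *\<^sub>R g p (b # map (w p) as))"
    using Cons.prems
    by (intro smooth_on_sum smooth_on_scaleR smooth_on_inner smooth_on_const assms(1)
        Cons.IH[where g = "\<lambda>p vs. g p (_ # vs)"] alternating_Cons) auto
  then show ?case
    by (rule smooth_on_cong[OF assms(1)]) (simp add: alternating_expand1[OF Cons.prems(1), of _ "w _ a"])
qed simp


section \<open>Integration over spheres\<close>

lemma nn_integral_lborel_translate:
  fixes f :: "'a::euclidean_space \<Rightarrow> ennreal"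
  assumes [measurable]: "f \<in> borel_measurable borel"
  shows "(\<integral>\<^sup>+z. f (c + z) \<partial>lborel) = (\<integral>\<^sup>+z. f z \<partial>lborel)"
proof -
  have "(\<integral>\<^sup>+z. f z \<partial>lborel) = (\<integral>\<^sup>+z. f z \<partial>distr lborel borel ((+) c))"
    by (simp only: lborel_distr_plus)
  also have "\<dots> = (\<integral>\<^sup>+z. f (c + z) \<partial>lborel)" by (rule nn_integral_distr) auto
  finally show ?thesis by simp
qed

text \<open>
  The argument is uniqueness of Haar measure, with the invariant ball as the test function that
  fixes the normalisation.
\<close>

lemma lborel_distr_orthogonal:
  fixes U :: "'a::euclidean_space \<Rightarrow> 'a"
  assumes U: "orthogonal_transformation U"
  shows "distr lborel borel U = lborel"
proof (rule measure_eqI)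
  have [measurable]: "U \<in> borel_measurable borel"
    using orthogonal_transformation_linear[OF U]
    by (intro borel_measurable_continuous_onI linear_continuous_on) (simp add: linear_conv_bounded_linear)
  obtain V where V: "\<And>x. U (V x) = x"
    using orthogonal_transformation_surj[OF U] by (metis surj_f_inv_f)
  have Uadd: "U (x + y) = U x + U y" for x y
    using linear_add[OF orthogonal_transformation_linear[OF U]] .
  fix A :: "'a set" assume "A \<in> sets (distr lborel borel U)"
  then have A[measurable]: "A \<in> sets borel" by simp
  define f :: "'a \<Rightarrow> ennreal" where "f = indicator (ball 0 1)"
  define g :: "'a \<Rightarrow> ennreal" where "g = indicator A"
  have [measurable]: "f \<in> borel_measurable borel" "g \<in> borel_measurable borel"
    unfolding f_def g_def by (intro borel_measurable_indicator; simp)+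
  have "(\<integral>\<^sup>+z. g (U z) \<partial>lborel) = nn_integral (distr lborel borel U) g"
    by (rule nn_integral_distr[symmetric]) measurable
  then have gU: "(\<integral>\<^sup>+z. g (U z) \<partial>lborel) = emeasure (distr lborel borel U) A"
    by (simp add: g_def)
  have t1: "(\<integral>\<^sup>+z. g (x + U z) \<partial>lborel) = (\<integral>\<^sup>+z. g (U z) \<partial>lborel)" for x
    using nn_integral_lborel_translate[of "\<lambda>z. g (U z)" "V x"] by (simp add: Uadd V)
  have t2: "(\<integral>\<^sup>+z. f (x - U z) \<partial>lborel) = (\<integral>\<^sup>+z. f z \<partial>lborel)" for x
  proof -
    have "(\<integral>\<^sup>+z. f (x - U z) \<partial>lborel) = (\<integral>\<^sup>+z. f (x - U (V x + z)) \<partial>lborel)"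
      by (rule nn_integral_lborel_translate[symmetric]) measurable
    also have "\<dots> = (\<integral>\<^sup>+z. f z \<partial>lborel)"
      using U by (intro nn_integral_cong)
        (simp add: Uadd V f_def indicator_def orthogonal_transformation)
    finally show ?thesis .
  qed
  have "(\<integral>\<^sup>+x. f x \<partial>lborel) * (\<integral>\<^sup>+z. g (U z) \<partial>lborel) = (\<integral>\<^sup>+x. f x * (\<integral>\<^sup>+z. g (x + U z) \<partial>lborel) \<partial>lborel)"
    by (simp add: t1 nn_integral_multc)
  also have "\<dots> = (\<integral>\<^sup>+x. (\<integral>\<^sup>+z. f x * g (x + U z) \<partial>lborel) \<partial>lborel)"
    by (simp add: nn_integral_cmult)
  also have "\<dots> = (\<integral>\<^sup>+z. (\<integral>\<^sup>+x. f x * g (x + U z) \<partial>lborel) \<partial>lborel)"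
    by (rule lborel_pair.Fubini'[symmetric]) measurable
  also have "\<dots> = (\<integral>\<^sup>+z. (\<integral>\<^sup>+x. f (x - U z) * g x \<partial>lborel) \<partial>lborel)"
  proof (rule nn_integral_cong)
    fix z :: 'a
    show "(\<integral>\<^sup>+x. f x * g (x + U z) \<partial>lborel) = (\<integral>\<^sup>+x. f (x - U z) * g x \<partial>lborel)"
      using nn_integral_lborel_translate[of "\<lambda>x. f (x - U z) * g x" "U z"] by (simp add: add.commute)
  qed
  also have "\<dots> = (\<integral>\<^sup>+x. (\<integral>\<^sup>+z. f (x - U z) * g x \<partial>lborel) \<partial>lborel)"
    by (rule lborel_pair.Fubini') measurable
  also have "\<dots> = (\<integral>\<^sup>+x. (\<integral>\<^sup>+z. f (x - U z) \<partial>lborel) * g x \<partial>lborel)"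
    by (simp add: nn_integral_multc)
  also have "\<dots> = (\<integral>\<^sup>+x. f x \<partial>lborel) * (\<integral>\<^sup>+x. g x \<partial>lborel)"
    by (simp add: t2 nn_integral_cmult)
  finally have "(\<integral>\<^sup>+x. f x \<partial>lborel) * emeasure (distr lborel borel U) A =
      (\<integral>\<^sup>+x. f x \<partial>lborel) * (\<integral>\<^sup>+x. g x \<partial>lborel)"
    unfolding gU .
  then have "emeasure lborel (ball (0::'a) 1) * emeasure (distr lborel borel U) A =
      emeasure lborel (ball (0::'a) 1) * emeasure lborel A"
    by (simp add: f_def g_def)
  moreover have "emeasure lborel (ball (0::'a) 1) \<noteq> \<infinity>"
    using emeasure_lborel_ball_finite[of "0::'a" 1] by simp
  moreover have "emeasure lborel (ball (0::'a) 1) \<noteq> 0"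
  proof
    assume "emeasure lborel (ball (0::'a) 1) = 0"
    then have "ball (0::'a) 1 \<in> null_sets lebesgue"
      by (intro null_sets_completionI) (simp add: null_sets_def)
    then show False using open_not_negligible[of "ball (0::'a) 1"] by (simp add: negligible_iff_null_sets)
  qed
  ultimately show "emeasure (distr lborel borel U) A = emeasure lborel A"
    by (simp add: ennreal_mult_cancel_left)
qed simp

section \<open>The surface measure and integrals over a sphere\<close>

lemma retr_measurable [measurable]: "retr R \<in> borel_measurable borel"
  unfolding retr_def[abs_def] by measurable

lemma sets_sphere_measure [simp, measurable_cong]: "sets (sphere_measure R) = sets borel"
  by (simp add: sphere_measure_def)

lemma space_sphere_measure [simp]: "space (sphere_measure R) = UNIV"
  by (simp add: sphere_measure_def space_scale_measure)

lemma emeasure_sphere_measure: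
  assumes "A \<in> sets borel"
  shows "emeasure (sphere_measure R :: 'a::euclidean_space measure) A =
    ennreal (real DIM('a) / R) * emeasure lborel {x \<in> ball 0 R. retr R x \<in> A}"
proof -
  have "emeasure (distr (restrict_space lborel (ball 0 R)) borel (retr R)) A =
      emeasure (restrict_space lborel (ball (0::'a) R)) (retr R -` A \<inter> space (restrict_space lborel (ball 0 R)))"
    using assms by (intro emeasure_distr measurable_restrict_space1) auto
  also have "\<dots> = emeasure lborel {x \<in> ball (0::'a) R. retr R x \<in> A}"
    using assms by (subst emeasure_restrict_space)
      (auto simp: space_restrict_space intro!: arg_cong[where f = "emeasure lborel"])
  finally show ?thesis
    by (simp add: sphere_measure_def retr_def[abs_def])
qed

lemma finite_measure_sphere: "finite_measure (sphere_measure R :: 'a::euclidean_space measure)"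
proof (rule finite_measureI)
  show "emeasure (sphere_measure R :: 'a measure) (space (sphere_measure R)) \<noteq> \<infinity>"
    using emeasure_lborel_ball_finite[of "0::'a" R]
    by (auto simp: emeasure_sphere_measure ennreal_mult_eq_top_iff ball_def)
qed

text \<open>An orthogonal map preserves the ball and commutes with the retraction, so the cones
  inherit the invariance of Lebesgue measure.\<close>

lemma sphere_measure_orthogonal:
  fixes U :: "'a::euclidean_space \<Rightarrow> 'a"
  assumes U: "orthogonal_transformation U"
  shows "distr (sphere_measure R) borel U = sphere_measure R"
proof (rule measure_eqI)
  have [measurable]: "U \<in> borel_measurable borel"
    using orthogonal_transformation_linear[OF U]
    by (intro borel_measurable_continuous_onI linear_continuous_on) (simp add: linear_conv_bounded_linear)
  have U1: "retr R (U x) = U (retr R x)" "norm (U x) = norm x" for x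
    using U by (auto simp: retr_def orthogonal_transformation linear_cmul)
  fix A :: "'a set" assume "A \<in> sets (distr (sphere_measure R) borel U)"
  then have A[measurable]: "A \<in> sets borel" by simp
  have V: "U -` A \<in> sets borel" using measurable_sets[of U borel borel A] by simp
  let ?B = "{x \<in> ball 0 R. retr R x \<in> A}"
  have "{x \<in> ball (0::'a) R. retr R x \<in> U -` A} = U -` ?B"
    by (auto simp: U1)
  moreover have "emeasure lborel (U -` ?B) = emeasure (distr lborel borel U) ?B"
    by (subst emeasure_distr) auto
  ultimately show "emeasure (distr (sphere_measure R) borel U) A = emeasure (sphere_measure R) A"
    by (simp add: emeasure_distr emeasure_sphere_measure V lborel_distr_orthogonal[OF U])
qed simp

text \<open>Restricting the domain makes the integral depend on values on the sphere only, although
  \<open>sphere_measure\<close> is a measure on the whole space.\<close>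

definition sphere_int :: "real \<Rightarrow> ('a::euclidean_space \<Rightarrow> real) \<Rightarrow> real" where
  "sphere_int R f = (LINT x:sphere 0 R|sphere_measure R. f x)"

lemma sphere_int_cong: "(\<And>x. norm x = R \<Longrightarrow> f x = g x) \<Longrightarrow> sphere_int R f = sphere_int R g"
  unfolding sphere_int_def by (rule set_lebesgue_integral_cong) auto

lemma sphere_int_eq_integral:
  "(\<And>x. norm x \<noteq> R \<Longrightarrow> f x = 0) \<Longrightarrow> (\<integral>x. f x \<partial>sphere_measure R) = sphere_int R f"
  unfolding sphere_int_def set_lebesgue_integral_def
  by (intro Bochner_Integration.integral_cong) (auto simp: indicator_def)

lemma sphere_borel_measurable_borel:
  fixes f :: "'a::euclidean_space \<Rightarrow> real"
  assumes "continuous_on (sphere 0 R) f"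
  shows "(\<lambda>x. indicator (sphere 0 R) x *\<^sub>R f x) \<in> borel_measurable borel"
  by (rule borel_measurable_continuous_on_indicator[OF _ assms]) simp

lemma sphere_borel_measurable:
  fixes f :: "'a::euclidean_space \<Rightarrow> real"
  assumes "continuous_on (sphere 0 R) f"
  shows "(\<lambda>x. indicator (sphere 0 R) x *\<^sub>R f x) \<in> borel_measurable (sphere_measure R)"
  unfolding measurable_cong_sets[OF sets_sphere_measure refl]
  by (rule sphere_borel_measurable_borel[OF assms])

lemma sphere_int_integrable:
  fixes f :: "'a::euclidean_space \<Rightarrow> real"
  assumes "continuous_on (sphere 0 R) f"
  shows "set_integrable (sphere_measure R) (sphere 0 R) f"
proof -
  interpret finite_measure "sphere_measure R :: 'a measure" by (rule finite_measure_sphere)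
  obtain B where "\<forall>y\<in>f ` sphere 0 R. norm y \<le> B"
    using compact_imp_bounded[OF compact_continuous_image[OF assms compact_sphere]]
    unfolding bounded_iff by blast
  then have "norm (indicator (sphere 0 R) x *\<^sub>R f x) \<le> max B 0" for x
    by (cases "x \<in> sphere 0 R") (auto simp: le_max_iff_disj)
  then show ?thesis unfolding set_integrable_def
    using sphere_borel_measurable[OF assms] by (intro integrable_const_bound[of _ "max B 0"]) auto
qed

lemma sphere_int_add:
  "continuous_on (sphere 0 R) f \<Longrightarrow> continuous_on (sphere 0 R) g \<Longrightarrow>
    sphere_int R (\<lambda>x. f x + g x) = sphere_int R f + sphere_int R g"
  unfolding sphere_int_def using sphere_int_integrable by (intro set_integral_add) auto

lemma sphere_int_diff:
  "continuous_on (sphere 0 R) f \<Longrightarrow> continuous_on (sphere 0 R) g \<Longrightarrow>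
    sphere_int R (\<lambda>x. f x - g x) = sphere_int R f - sphere_int R g"
  unfolding sphere_int_def using sphere_int_integrable by (intro set_integral_diff) auto

lemma sphere_int_cmult: "sphere_int R (\<lambda>x. c * f x) = c * sphere_int R f"
  by (simp add: sphere_int_def)

lemma sphere_int_zero [simp]: "sphere_int R (\<lambda>x. 0) = 0"
  by (simp add: sphere_int_def set_lebesgue_integral_def)

lemma sphere_int_sum:
  "(\<And>i. i \<in> I \<Longrightarrow> continuous_on (sphere 0 R) (f i)) \<Longrightarrow>
    sphere_int R (\<lambda>x. \<Sum>i\<in>I. f i x) = (\<Sum>i\<in>I. sphere_int R (f i))"
  by (induction I rule: infinite_finite_induct) (auto simp: sphere_int_add continuous_on_sum)

lemma sphere_int_orthogonal:
  fixes f :: "'a::euclidean_space \<Rightarrow> real" and U :: "'a \<Rightarrow> 'a"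
  assumes U: "orthogonal_transformation U" and f: "continuous_on (sphere 0 R) f"
  shows "sphere_int R (\<lambda>x. f (U x)) = sphere_int R f"
proof -
  have [measurable]: "U \<in> borel_measurable borel"
    using orthogonal_transformation_linear[OF U]
    by (intro borel_measurable_continuous_onI linear_continuous_on) (simp add: linear_conv_bounded_linear)
  let ?g = "\<lambda>x. indicator (sphere 0 R) x *\<^sub>R f x"
  have m[measurable]: "?g \<in> borel_measurable borel"
    by (rule sphere_borel_measurable_borel[OF f])
  have "sphere_int R f = (\<integral>x. ?g x \<partial>distr (sphere_measure R) borel U)"
    by (simp add: sphere_int_def set_lebesgue_integral_def sphere_measure_orthogonal[OF U])
  also have "\<dots> = (\<integral>x. ?g (U x) \<partial>sphere_measure R)"
    by (rule integral_distr[OF _ m]) measurable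
  also have "\<dots> = sphere_int R (\<lambda>x. f (U x))"
    unfolding sphere_int_def set_lebesgue_integral_def
    using U by (intro Bochner_Integration.integral_cong) (auto simp: indicator_def orthogonal_transformation)
  finally show ?thesis by simp
qed

text \<open>A positive value would persist by continuity on an open cone of positive volume, which
  contradicts vanishing almost everywhere.\<close>

lemma sphere_int_eq_0:
  fixes f :: "'a::euclidean_space \<Rightarrow> real"
  assumes "R > 0" "continuous_on (sphere 0 R) f" "\<And>x. norm x = R \<Longrightarrow> f x \<ge> 0" "sphere_int R f = 0" "norm x = R"
  shows "f x = 0"
proof (rule ccontr)
  assume "f x \<noteq> 0"
  then have fx: "f x > 0" using assms by (metis less_eq_real_def)
  let ?g = "\<lambda>x. indicator (sphere 0 R) x *\<^sub>R f x"
  have m[measurable]: "?g \<in> borel_measurable borel"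
    by (rule sphere_borel_measurable_borel[OF assms(2)])
  have "AE x in sphere_measure R. ?g x = 0"
    using assms(3,4) sphere_int_integrable[OF assms(2)]
    unfolding sphere_int_def set_lebesgue_integral_def set_integrable_def
    by (subst integral_nonneg_eq_0_iff_AE[symmetric]) (auto simp: indicator_def)
  moreover have W: "{x. ?g x \<noteq> 0} \<in> sets borel" by measurable
  ultimately have "emeasure (sphere_measure R) {x. ?g x \<noteq> 0} = 0"
    using AE_iff_measurable[of "{x. ?g x \<noteq> 0}" "sphere_measure R" "\<lambda>x. ?g x = 0"]
    by (simp del: scaleR_eq_0_iff)
  moreover note W
  moreover have "ennreal (real DIM('a) / R) \<noteq> 0" using assms(1) by simp
  ultimately have z: "emeasure lborel {x \<in> ball (0::'a) R. ?g (retr R x) \<noteq> 0} = 0"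
    by (subst (asm) emeasure_sphere_measure) auto
  let ?W = "{y \<in> ball (0::'a) R - {0}. f (retr R y) > 0}"
  have c: "continuous_on (ball 0 R - {0}) (\<lambda>y. f (retr R y))"
    using assms(1) unfolding retr_def
    by (intro continuous_on_compose2[OF assms(2)] continuous_intros) (auto split: if_splits)
  have o: "open ?W"
  proof -
    have "?W = (ball 0 R - {0}) \<inter> (\<lambda>y. f (retr R y)) -` {0<..}" by auto
    moreover have "open (ball (0::'a) R - {0})" by (intro open_Diff) auto
    ultimately show ?thesis using continuous_open_preimage[OF c, of "{0<..}"] by simp
  qed
  have "?W \<subseteq> {x \<in> ball (0::'a) R. ?g (retr R x) \<noteq> 0}"
    using assms(1) by (auto simp: indicator_def split: if_splits)
  moreover have "{x \<in> ball (0::'a) R. ?g (retr R x) \<noteq> 0} \<in> sets lborel" by measurable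
  ultimately have "emeasure lborel ?W = 0"
    using z emeasure_mono[of ?W "{x \<in> ball (0::'a) R. ?g (retr R x) \<noteq> 0}" lborel] by (simp only: le_zero_eq)
  then have "?W \<in> null_sets lebesgue"
    using o by (intro null_sets_completionI) (simp add: null_sets_def)
  \<comment> \<open>The half point lies in the ball and retracts to \<open>x\<close>, so the open
    cone is not empty.\<close>
  moreover have "(1/2) *\<^sub>R x \<in> ?W"
    using assms fx retr_scale[of "1/2" R x] by (auto simp: retr_id)
  ultimately show False using open_not_negligible[OF o] unfolding negligible_iff_null_sets by blast
qed

section \<open>Differentiation under the integral sign\<close>

lemma sphere_nz: "R > 0 \<Longrightarrow> sphere 0 R \<subseteq> - {0}"
  by auto

lemma smooth_on_sphere_cont: "R > 0 \<Longrightarrow> smooth_on (- {0}) f \<Longrightarrow> continuous_on (sphere 0 R) f"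
  using continuous_on_subset[OF smooth_on_continuous sphere_nz] .

lemma has_derivative_slice_fst:
  assumes "(F has_derivative D) (at (s::real, x))"
  shows "((\<lambda>s. F (s, x)) has_vector_derivative D (1, 0)) (at s)"
proof -
  have "((\<lambda>s. (s, x)) has_derivative (\<lambda>h. (h, 0))) (at s)"
    by (rule has_derivative_Pair[OF has_derivative_ident has_derivative_const])
  from has_derivative_compose[OF this assms]
  have "((\<lambda>s. F (s, x)) has_derivative (\<lambda>h. D (h, 0))) (at s)" .
  moreover have "D (h, 0) = h *\<^sub>R D (1, 0)" for h
    using linear_cmul[OF has_derivative_linear[OF assms], of h "(1, 0)"] by simp
  ultimately show ?thesis
    unfolding has_vector_derivative_def by (rule has_derivative_eq_rhs[OF _ ext])
qed

lemma has_derivative_slice_snd: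
  assumes "(F has_derivative D) (at (s::real, x))"
  shows "((\<lambda>x. F (s, x)) has_derivative (\<lambda>v. D (0, v))) (at x)"
proof -
  have "((\<lambda>x. (s, x)) has_derivative (\<lambda>v. (0, v))) (at x)"
    by (rule has_derivative_Pair[OF has_derivative_const has_derivative_ident])
  from has_derivative_compose[OF this assms] show ?thesis .
qed

text \<open>Dominated convergence for the difference quotients: the time derivative is bounded on
  the compact product of a time interval with the sphere, and the mean value inequality carries the
  bound over to the quotients.\<close>

lemma sphere_int_has_derivative:
  fixes F :: "real \<times> 'a::euclidean_space \<Rightarrow> real"
  assumes R: "R > 0" and I: "open I" "t \<in> I" and F: "smooth_on (I \<times> (- {0})) F"
  shows "((\<lambda>t. sphere_int R (\<lambda>x. F (t, x))) has_real_derivative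
     sphere_int R (\<lambda>x. frechet_derivative F (at (t, x)) (1, 0))) (at t)"
proof -
  interpret finite_measure "sphere_measure R :: 'a measure" by (rule finite_measure_sphere)
  let ?D = "\<lambda>p. frechet_derivative F (at p) (1, 0)"
  obtain d where d: "d > 0" "cball t d \<subseteq> I" using I open_contains_cball by blast
  have cF: "continuous_on (I \<times> (- {0})) F" and cD: "continuous_on (I \<times> (- {0})) ?D"
    by (intro smooth_on_continuous smooth_on_frechet_derivative F)+
  have "compact (?D ` (cball t d \<times> sphere 0 R))"
    using d R by (intro compact_continuous_image continuous_on_subset[OF cD] compact_Times) auto
  then have "bounded (?D ` (cball t d \<times> sphere 0 R))" by (rule compact_imp_bounded)
  then obtain B where B0: "\<forall>y\<in>?D ` (cball t d \<times> sphere 0 R). norm y \<le> B"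
    unfolding bounded_iff by auto
  have B: "norm (?D (s, x)) \<le> B" if "s \<in> cball t d" "norm x = R" for s x
    using B0 that by auto
  have der: "((\<lambda>s. F (s, x)) has_real_derivative ?D (s, x)) (at s)" if "s \<in> I" "norm x = R" for s x
  proof -
    have "(F has_derivative frechet_derivative F (at (s, x))) (at (s, x))"
      using that R by (intro smooth_on_has_derivative[OF F]) auto
    from has_derivative_slice_fst[OF this] show ?thesis
      by (simp add: has_real_derivative_iff_has_vector_derivative)
  qed
  have cont: "continuous_on (sphere 0 R) (\<lambda>x. F (s, x))" "continuous_on (sphere 0 R) (\<lambda>x. ?D (s, x))"
    if "s \<in> I" for s
    using that R
    by (auto intro!: continuous_on_compose2[OF cF] continuous_on_compose2[OF cD] continuous_intros)
  \<comment> \<open>Inside \<open>ball 0 d\<close> the time \<open>t + h\<close> stays in the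
    compact interval; sequences are used because dominated convergence is a statement about
    them.\<close>
  have "((\<lambda>h. (sphere_int R (\<lambda>x. F (t + h, x)) - sphere_int R (\<lambda>x. F (t, x))) / h) \<longlongrightarrow> sphere_int R (\<lambda>x. ?D (t, x)))
      (at 0 within ball 0 d)"
    unfolding tendsto_at_iff_sequentially
  proof (intro allI impI)
    fix X :: "nat \<Rightarrow> real" assume X: "\<forall>i. X i \<in> ball 0 d - {0}" "X \<longlonglongrightarrow> 0"
    have XI: "t + X i \<in> I" "t + X i \<in> cball t d" for i
      using X(1) d(2) by (auto simp: subset_iff dist_real_def less_imp_le)
    let ?s = "\<lambda>i x. indicator (sphere 0 R) x *\<^sub>R ((F (t + X i, x) - F (t, x)) / X i)"
    have c: "continuous_on (sphere 0 R) (\<lambda>x. (F (t + X i, x) - F (t, x)) / X i)" for i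
      using X(1) by (intro continuous_intros cont XI I) auto
    have lim: "(\<lambda>i. \<integral>x. ?s i x \<partial>sphere_measure R) \<longlonglongrightarrow>
        (\<integral>x. indicator (sphere 0 R) x *\<^sub>R ?D (t, x) \<partial>sphere_measure R)"
    proof (rule integral_dominated_convergence[where w = "\<lambda>_. max B 0"])
      show "(\<lambda>x. indicator (sphere 0 R) x *\<^sub>R ?D (t, x)) \<in> borel_measurable (sphere_measure R)"
        by (intro sphere_borel_measurable cont I)
      show "?s i \<in> borel_measurable (sphere_measure R)" for i
        by (rule sphere_borel_measurable[OF c])
      show "integrable (sphere_measure R) (\<lambda>_::'a. max B 0)" by simp
      show "AE x in sphere_measure R. (\<lambda>i. ?s i x) \<longlonglongrightarrow> indicator (sphere 0 R) x *\<^sub>R ?D (t, x)"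
      proof (rule AE_I2)
        fix x :: 'a
        show "(\<lambda>i. ?s i x) \<longlonglongrightarrow> indicator (sphere 0 R) x *\<^sub>R ?D (t, x)"
        proof (cases "norm x = R")
          case True
          have "((\<lambda>h. (F (t + h, x) - F (t, x)) / h) \<longlongrightarrow> ?D (t, x)) (at 0)"
            using der[OF I(2) True] by (simp add: DERIV_def)
          then have "((\<lambda>h. (F (t + h, x) - F (t, x)) / h) \<circ> X) \<longlonglongrightarrow> ?D (t, x)"
            using X unfolding tendsto_at_iff_sequentially by auto
          then show ?thesis using True by (simp add: o_def)
        qed (simp add: indicator_def)
      qed
      show "AE x in sphere_measure R. norm (?s i x) \<le> max B 0" for i
      proof (rule AE_I2)
        fix x :: 'a
        show "norm (?s i x) \<le> max B 0"
        proof (cases "norm x = R")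
          case True
          have "norm (F (t + X i, x) - F (t, x)) \<le> B * norm (t + X i - t)"
          proof (rule field_differentiable_bound[of "cball t d"])
            show "\<And>s. s \<in> cball t d \<Longrightarrow> ((\<lambda>s. F (s, x)) has_field_derivative ?D (s, x)) (at s within cball t d)"
              using der[OF _ True] d(2) by (blast intro: has_field_derivative_at_within)
          qed (use B True XI d in auto)
          then show ?thesis using True X(1)[rule_format, of i]
            by (simp add: indicator_def divide_le_eq le_max_iff_disj)
        qed (simp add: indicator_def)
      qed
    qed
    have e: "(\<integral>x. ?s i x \<partial>sphere_measure R) = (sphere_int R (\<lambda>x. F (t + X i, x)) - sphere_int R (\<lambda>x. F (t, x))) / X i" for i
    proof -
      have "(\<integral>x. ?s i x \<partial>sphere_measure R) = sphere_int R (\<lambda>x. (F (t + X i, x) - F (t, x)) / X i)"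
        by (simp only: sphere_int_def set_lebesgue_integral_def)
      also have "\<dots> = sphere_int R (\<lambda>x. (1 / X i) * (F (t + X i, x) - F (t, x)))" by simp
      finally have "(\<integral>x. ?s i x \<partial>sphere_measure R) = sphere_int R (\<lambda>x. (1 / X i) * (F (t + X i, x) - F (t, x)))" .
      then show ?thesis by (simp only: sphere_int_cmult sphere_int_diff[OF cont(1)[OF XI(1)] cont(1)[OF I(2)]]) simp
    qed
    have "(\<integral>x. indicator (sphere 0 R) x *\<^sub>R ?D (t, x) \<partial>sphere_measure R) = sphere_int R (\<lambda>x. ?D (t, x))"
      by (simp only: sphere_int_def set_lebesgue_integral_def)
    with lim show "((\<lambda>h. (sphere_int R (\<lambda>x. F (t + h, x)) - sphere_int R (\<lambda>x. F (t, x))) / h) \<circ> X) \<longlonglongrightarrow> sphere_int R (\<lambda>x. ?D (t, x))"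
      by (simp only: o_def e)
  qed
  then show ?thesis using d(1) by (simp add: DERIV_def at_within_open[of 0 "ball 0 d"])
qed

section \<open>Infinitesimal rotations and the divergence theorem on a sphere\<close>

definition rot :: "'a::euclidean_space \<Rightarrow> 'a \<Rightarrow> real \<Rightarrow> 'a \<Rightarrow> 'a" where
  "rot a b s x = x + ((cos s - 1) * (x \<bullet> a) - sin s * (x \<bullet> b)) *\<^sub>R a
                   + ((cos s - 1) * (x \<bullet> b) + sin s * (x \<bullet> a)) *\<^sub>R b"

text \<open>Only the coordinates along \<open>a\<close> and \<open>b\<close> change, so preservation
  of the norm comes down to the Pythagorean identity for \<open>sin\<close> and
  \<open>cos\<close>.\<close>

lemma orthogonal_rot:
  assumes "a \<in> Basis" "b \<in> Basis" "a \<noteq> b"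
  shows "orthogonal_transformation (rot a b s)"
  unfolding orthogonal_transformation
proof (intro conjI allI)
  show "linear (rot a b s)"
    by (rule linearI) (auto simp: rot_def inner_add_left algebra_simps)
  fix x
  have *: "a \<bullet> a = 1" "b \<bullet> b = 1" "a \<bullet> b = 0" "b \<bullet> a = 0"
    using assms by (auto simp: inner_Basis)
  define p q where "p = x \<bullet> a" and "q = x \<bullet> b"
  have alg: "2 * ((c - 1) * p - u * q) * p + 2 * ((c - 1) * q + u * p) * q +
      ((c - 1) * p - u * q) * ((c - 1) * p - u * q) + ((c - 1) * q + u * p) * ((c - 1) * q + u * p)
      = (p * p + q * q) * (c\<^sup>2 + u\<^sup>2 - 1)" for c u :: real
    by (simp add: power2_eq_square algebra_simps)
  define A B where "A = (cos s - 1) * p - sin s * q" and "B = (cos s - 1) * q + sin s * p"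
  have "rot a b s x = x + A *\<^sub>R a + B *\<^sub>R b"
    by (simp add: rot_def A_def B_def p_def q_def)
  then have "rot a b s x \<bullet> rot a b s x = x \<bullet> x + (2 * A * p + 2 * B * q + A * A + B * B)"
    by (simp add: inner_add_left inner_add_right * inner_commute[of a x] inner_commute[of b x]
        algebra_simps flip: p_def q_def)
  also have "2 * A * p + 2 * B * q + A * A + B * B = (p * p + q * q) * ((cos s)\<^sup>2 + (sin s)\<^sup>2 - 1)"
    unfolding A_def B_def by (rule alg)
  finally have "rot a b s x \<bullet> rot a b s x = x \<bullet> x" by simp
  then show "norm (rot a b s x) = norm x" by (simp add: norm_eq)
qed

text \<open>The integral of \<open>h\<close> composed with \<open>rot a b s\<close> does not depend
  on \<open>s\<close>, and the integrand here is the derivative of that composition at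
  \<open>s = 0\<close>.\<close>

lemma sphere_int_rotation:
  fixes h :: "'a::euclidean_space \<Rightarrow> real"
  assumes R: "R > 0" and h: "smooth_on (- {0}) h" and ab: "a \<in> Basis" "b \<in> Basis"
  shows "sphere_int R (\<lambda>x. (x \<bullet> a) * frechet_derivative h (at x) b - (x \<bullet> b) * frechet_derivative h (at x) a) = 0"
proof (cases "a = b")
  case False
  let ?r = "\<lambda>p. rot a b (fst p) (snd p)"
  have o: "open (UNIV \<times> (- {0::'a}) :: (real \<times> 'a) set)" by simp
  have ns: "norm (rot a b s x) = norm x" for s x
    using orthogonal_rot[OF ab False, of s] by (simp add: orthogonal_transformation)
  have nz: "rot a b s x = 0 \<longleftrightarrow> x = 0" for s x
    using ns by (metis norm_eq_zero)
  have sr: "smooth_on (UNIV \<times> (- {0})) ?r"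
    unfolding rot_def using o
    by (intro smooth_on_add smooth_on_scaleR smooth_on_diff smooth_on_mult smooth_on_inner smooth_on_const
        smooth_on_fst smooth_on_snd smooth_on_compose[OF o open_UNIV _ smooth_on_sin_cos(1)]
        smooth_on_compose[OF o open_UNIV _ smooth_on_sin_cos(2)]) auto
  have sm: "smooth_on (UNIV \<times> (- {0})) (\<lambda>p. h (?r p))"
    by (rule smooth_on_compose[OF o _ _ h sr]) (use nz in auto)
  have "((\<lambda>s. sphere_int R (\<lambda>x. h (?r (s, x)))) has_real_derivative
     sphere_int R (\<lambda>x. frechet_derivative (\<lambda>p. h (?r p)) (at (0, x)) (1, 0))) (at 0)"
    using sphere_int_has_derivative[OF R open_UNIV UNIV_I sm, of 0] by simp
  moreover have "(\<lambda>s. sphere_int R (\<lambda>x. h (?r (s, x)))) = (\<lambda>s. sphere_int R h)"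
    using sphere_int_orthogonal[OF orthogonal_rot[OF ab False] smooth_on_sphere_cont[OF R h]] by simp
  ultimately have "((\<lambda>s. sphere_int R h) has_real_derivative
     sphere_int R (\<lambda>x. frechet_derivative (\<lambda>p. h (?r p)) (at (0, x)) (1, 0))) (at (0::real))" by simp
  then have "sphere_int R (\<lambda>x. frechet_derivative (\<lambda>p. h (?r p)) (at (0, x)) (1, 0)) = 0"
    using DERIV_unique DERIV_const by blast
  moreover have "frechet_derivative (\<lambda>p. h (?r p)) (at (0, x)) (1, 0) =
     (x \<bullet> a) * frechet_derivative h (at x) b - (x \<bullet> b) * frechet_derivative h (at x) a" if "norm x = R" for x
  proof -
    have x: "x \<noteq> 0" using that R by auto
    have h1: "(h has_derivative frechet_derivative h (at x)) (at x)"
      using x by (intro smooth_on_has_derivative[OF h]) simp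
    note l = has_derivative_linear[OF h1]
    have "(?r has_derivative (\<lambda>p. snd p + (fst p * (x \<bullet> a)) *\<^sub>R b - (fst p * (x \<bullet> b)) *\<^sub>R a)) (at (0, x))"
      unfolding rot_def
      by (auto intro!: derivative_eq_intros simp: algebra_simps)
    moreover have "(h has_derivative frechet_derivative h (at x)) (at (?r (0, x)))"
      using h1 by (simp add: rot_def)
    ultimately have "((\<lambda>p. h (?r p)) has_derivative (\<lambda>p. frechet_derivative h (at x)
        (snd p + (fst p * (x \<bullet> a)) *\<^sub>R b - (fst p * (x \<bullet> b)) *\<^sub>R a))) (at (0, x))"
      using has_derivative_compose by blast
    from frechet_derivative_at[OF this, symmetric] show ?thesis
      by (simp add: linear_diff[OF l] linear_cmul[OF l])
  qed
  ultimately show ?thesis using sphere_int_cong by (metis (no_types, lifting))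
qed simp

text \<open>Euler's relation for degree 0: the function is constant along the ray through
  \<open>x\<close>.\<close>

lemma homogeneous_radial_derivative:
  fixes f :: "'a::euclidean_space \<Rightarrow> 'b::real_normed_vector"
  assumes "x \<noteq> 0" "(f has_derivative D) (at x)" "\<And>c y. c > 0 \<Longrightarrow> y \<noteq> 0 \<Longrightarrow> f (c *\<^sub>R y) = f y"
  shows "D x = 0"
proof -
  have "((\<lambda>s::real. s *\<^sub>R x) has_derivative (\<lambda>s. s *\<^sub>R x)) (at 1)"
    by (auto intro!: derivative_eq_intros)
  moreover have "(f has_derivative D) (at (1 *\<^sub>R x))" using assms by simp
  ultimately have "((\<lambda>s. f (s *\<^sub>R x)) has_derivative (\<lambda>s. D (s *\<^sub>R x))) (at 1)"
    by (rule has_derivative_compose)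
  moreover have "((\<lambda>s. f (s *\<^sub>R x)) has_derivative (\<lambda>s. 0)) (at 1)"
    by (rule has_derivative_transform_within_open[of "\<lambda>_. f x" _ _ _ "{0<..}"])
       (use assms(1,3) in auto)
  ultimately have "(\<lambda>s. D (s *\<^sub>R x)) = (\<lambda>s. 0)" by (rule has_derivative_unique)
  from fun_cong[OF this, of 1] show ?thesis by simp
qed

text \<open>Sum over \<open>a\<close> the rotation identity for the functions
  \<open>(x \<bullet> a) * f x\<close>. The squares of the coordinates add up to
  \<open>R\<^sup>2\<close>, and the radial derivative of \<open>f\<close> vanishes. The coefficient
  of \<open>(x \<bullet> b) * f x\<close> is 1 from differentiating the coordinates along
  \<open>b\<close>, less \<open>DIM('a)\<close> from differentiating each coordinate along its own
  axis.\<close>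

lemma sphere_int_partial:
  fixes f :: "'a::euclidean_space \<Rightarrow> real"
  assumes R: "R > 0" and f: "smooth_on (- {0}) f"
    and hom: "\<And>c y. c > 0 \<Longrightarrow> y \<noteq> 0 \<Longrightarrow> f (c *\<^sub>R y) = f y" and b: "b \<in> Basis"
  shows "R\<^sup>2 * sphere_int R (\<lambda>x. frechet_derivative f (at x) b) = (real DIM('a) - 1) * sphere_int R (\<lambda>x. (x \<bullet> b) * f x)"
proof -
  let ?D = "\<lambda>v x. frechet_derivative f (at x) v"
  let ?h = "\<lambda>a x. (x \<bullet> a) * f x"
  have o: "open (- {0::'a})" by auto
  have sh: "smooth_on (- {0}) (?h a)" for a
    by (intro smooth_on_mult smooth_on_inner smooth_on_ident smooth_on_const f o)
  have Dh: "frechet_derivative (?h a) (at x) v = (x \<bullet> a) * ?D v x + (v \<bullet> a) * f x" if "x \<noteq> 0" for a x v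
  proof -
    have "(f has_derivative (\<lambda>v. ?D v x)) (at x)"
      using that by (intro smooth_on_has_derivative[OF f]) simp
    then have "(?h a has_derivative (\<lambda>v. (x \<bullet> a) * ?D v x + (v \<bullet> a) * f x)) (at x)"
      by (auto intro!: derivative_eq_intros)
    from frechet_derivative_at[OF this, symmetric] show ?thesis by simp
  qed
  let ?g = "\<lambda>a x. (x \<bullet> a) * frechet_derivative (?h a) (at x) b - (x \<bullet> b) * frechet_derivative (?h a) (at x) a"
  have cg: "continuous_on (sphere 0 R) (?g a)" for a
    by (intro smooth_on_sphere_cont[OF R] smooth_on_diff smooth_on_mult smooth_on_inner smooth_on_ident
        smooth_on_const smooth_on_frechet_derivative sh o)
  have "(\<Sum>a\<in>Basis. ?g a x) = R\<^sup>2 * ?D b x - (real DIM('a) - 1) * ((x \<bullet> b) * f x)" if "norm x = R" for x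
  proof -
    have x: "x \<noteq> 0" using that R by auto
    have fd: "(f has_derivative (\<lambda>v. ?D v x)) (at x)"
      using x by (intro smooth_on_has_derivative[OF f]) simp
    note l = has_derivative_linear[OF fd]
    have "0 = ?D x x" using homogeneous_radial_derivative[OF x fd hom] by simp
    also have "\<dots> = ?D (\<Sum>a\<in>Basis. (x \<bullet> a) *\<^sub>R a) x" by (simp add: euclidean_representation)
    also have "\<dots> = (\<Sum>a\<in>Basis. (x \<bullet> a) * ?D a x)"
      by (simp add: linear_sum[OF l] linear_cmul[OF l])
    finally have e0: "(\<Sum>a\<in>Basis. (x \<bullet> a) * ?D a x) = 0" by simp
    have e1: "(\<Sum>a\<in>Basis. (x \<bullet> a) * (x \<bullet> a)) = R\<^sup>2"
      using that by (metis euclidean_inner dot_square_norm)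
    have e2: "(\<Sum>a\<in>Basis. (x \<bullet> a) * (b \<bullet> a)) = x \<bullet> b"
      by (metis euclidean_inner)
    have "(\<Sum>a\<in>Basis. ?g a x) = (\<Sum>a\<in>Basis. (x \<bullet> a) * (x \<bullet> a)) * ?D b x + (\<Sum>a\<in>Basis. (x \<bullet> a) * (b \<bullet> a)) * f x
       - (x \<bullet> b) * (\<Sum>a\<in>Basis. (x \<bullet> a) * ?D a x) - (\<Sum>a\<in>(Basis::'a set). (x \<bullet> b) * f x)"
      unfolding sum_distrib_left sum_distrib_right sum.distrib[symmetric] sum_subtractf[symmetric]
      by (intro sum.cong refl, simp only: Dh[OF x]) (simp add: inner_same_Basis algebra_simps)
    also have "\<dots> = R\<^sup>2 * ?D b x - (real DIM('a) - 1) * ((x \<bullet> b) * f x)"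
      by (simp only: e0 e1 e2 sum_constant) (simp add: algebra_simps)
    finally show ?thesis .
  qed
  then have "sphere_int R (\<lambda>x. \<Sum>a\<in>Basis. ?g a x) = sphere_int R (\<lambda>x. R\<^sup>2 * ?D b x - (real DIM('a) - 1) * ((x \<bullet> b) * f x))"
    by (rule sphere_int_cong)
  moreover have "sphere_int R (\<lambda>x. \<Sum>a\<in>Basis. ?g a x) = 0"
    by (subst sphere_int_sum[OF cg]) (simp add: sphere_int_rotation[OF R sh _ b])
  moreover have "sphere_int R (\<lambda>x. R\<^sup>2 * ?D b x - (real DIM('a) - 1) * ((x \<bullet> b) * f x))
     = R\<^sup>2 * sphere_int R (?D b) - (real DIM('a) - 1) * sphere_int R (\<lambda>x. (x \<bullet> b) * f x)"
    by (subst sphere_int_diff)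
       (auto intro!: smooth_on_sphere_cont[OF R] smooth_on_mult smooth_on_const smooth_on_frechet_derivative f o
         smooth_on_inner smooth_on_ident simp: sphere_int_cmult)
  ultimately show ?thesis by simp
qed

text \<open>For components of degree 0, \<open>sphere_int_partial\<close> turns the integral of the
  ambient divergence into a multiple of the integral of the radial component, which vanishes for a
  tangent field.\<close>

lemma sphere_int_divergence:
  fixes X :: "'a::euclidean_space \<Rightarrow> 'a \<Rightarrow> real"
  assumes R: "R > 0" and X: "\<And>b. b \<in> Basis \<Longrightarrow> smooth_on (- {0}) (X b)"
    and hom: "\<And>b c y. b \<in> Basis \<Longrightarrow> c > 0 \<Longrightarrow> y \<noteq> 0 \<Longrightarrow> X b (c *\<^sub>R y) = X b y"
    and tan: "\<And>x. norm x = R \<Longrightarrow> (\<Sum>b\<in>Basis. (x \<bullet> b) * X b x) = 0"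
  shows "sphere_int R (\<lambda>x. \<Sum>b\<in>Basis. frechet_derivative (X b) (at x) b) = 0"
proof -
  have o: "open (- {0::'a})" by auto
  have "R\<^sup>2 * sphere_int R (\<lambda>x. \<Sum>b\<in>Basis. frechet_derivative (X b) (at x) b) =
     (\<Sum>b\<in>Basis. R\<^sup>2 * sphere_int R (\<lambda>x. frechet_derivative (X b) (at x) b))"
    by (subst sphere_int_sum) (auto intro!: smooth_on_sphere_cont[OF R] smooth_on_frechet_derivative X simp: sum_distrib_left)
  also have "\<dots> = (\<Sum>b\<in>Basis. (real DIM('a) - 1) * sphere_int R (\<lambda>x. (x \<bullet> b) * X b x))"
    by (intro sum.cong refl sphere_int_partial R X hom)
  also have "\<dots> = (real DIM('a) - 1) * sphere_int R (\<lambda>x. \<Sum>b\<in>Basis. (x \<bullet> b) * X b x)"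
    by (subst sphere_int_sum) (auto intro!: smooth_on_sphere_cont[OF R] smooth_on_mult smooth_on_inner
        smooth_on_ident smooth_on_const X o simp: sum_distrib_left)
  also have "sphere_int R (\<lambda>x. \<Sum>b\<in>Basis. (x \<bullet> b) * X b x) = sphere_int R (\<lambda>x::'a. 0)"
    by (rule sphere_int_cong[OF tan])
  finally show ?thesis using R by simp
qed


section \<open>Forms along a map\<close>

text \<open>
  The extension of a form to the complement of the origin that is homogeneous of degree 0 and
  projects the arguments to the tangent spaces.  Its partial derivatives replace covariant
  derivatives, since the Christoffel terms vanish on tangent vectors.
\<close>

definition hat :: "real \<Rightarrow> ('a::euclidean_space \<Rightarrow> 'a list \<Rightarrow> 'b) \<Rightarrow> 'a \<Rightarrow> 'a list \<Rightarrow> 'b" where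
  "hat R \<omega> y vs = \<omega> (retr R y) (map (tproj y) vs)"

definition tangent_at :: "real \<Rightarrow> 'a::euclidean_space \<Rightarrow> 'a list \<Rightarrow> bool" where
  "tangent_at R x vs \<longleftrightarrow> norm x = R \<and> (\<forall>v\<in>set vs. v \<bullet> x = 0)"

text \<open>Everything in \<open>forms\<close> except smoothness, which is kept apart because
  families in \<open>t\<close> need it jointly in time and space.\<close>

definition pw_form :: "real \<Rightarrow> ('a::euclidean_space \<Rightarrow> 'b::euclidean_space) \<Rightarrow> ('a \<Rightarrow> 'a list \<Rightarrow> 'b) \<Rightarrow> bool" where
  "pw_form R \<phi> \<omega> \<longleftrightarrow> (\<forall>x vs. \<not> tangent_at R x vs \<longrightarrow> \<omega> x vs = 0) \<and>
     (\<forall>x. norm x = R \<longrightarrow> alternating (hat R \<omega> x) \<and> (\<forall>vs. hat R \<omega> x vs \<bullet> \<phi> x = 0))"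

definition is_form :: "real \<Rightarrow> ('a::euclidean_space \<Rightarrow> 'b::euclidean_space) \<Rightarrow> ('a \<Rightarrow> 'a list \<Rightarrow> 'b) \<Rightarrow> bool" where
  "is_form R \<phi> \<omega> \<longleftrightarrow> pw_form R \<phi> \<omega> \<and> (\<forall>vs. smooth_on (- {0}) (\<lambda>y. hat R \<omega> y vs))"

lemma hat_retr [simp]: "R > 0 \<Longrightarrow> y \<noteq> 0 \<Longrightarrow> hat R \<omega> (retr R y) = hat R \<omega> y"
  by (rule ext) (simp add: hat_def retr_id)

lemma hat_scale: "c > 0 \<Longrightarrow> hat R \<omega> (c *\<^sub>R y) vs = hat R \<omega> y vs"
proof -
  assume "c > 0"
  then have "tproj (c *\<^sub>R y) = tproj y" by (auto simp: tproj_scale)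
  then show ?thesis using \<open>c > 0\<close> by (simp add: hat_def retr_scale)
qed

lemma hat_tangent: "R > 0 \<Longrightarrow> tangent_at R x vs \<Longrightarrow> hat R \<omega> x vs = \<omega> x vs"
proof -
  assume R: "R > 0" and t: "tangent_at R x vs"
  have "map (tproj x) vs = vs"
    using t by (intro map_idI) (auto simp: tangent_at_def tproj_id)
  then show ?thesis using R t by (simp add: hat_def tangent_at_def retr_id)
qed

lemma hat_proj: "y \<noteq> 0 \<Longrightarrow> hat R \<omega> y (map (tproj y) vs) = hat R \<omega> y vs"
  by (simp add: hat_def o_def)

lemma hat_normal: "R > 0 \<Longrightarrow> norm x = R \<Longrightarrow> alternating (hat R \<omega> x) \<Longrightarrow> hat R \<omega> x (us @ x # ws) = 0"
proof -
  assume R: "R > 0" "norm x = R" and a: "alternating (hat R \<omega> x)"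
  have x: "x \<noteq> 0" using R by auto
  have "hat R \<omega> x (us @ x # ws) = hat R \<omega> x (map (tproj x) (us @ x # ws))"
    using hat_proj[OF x] by metis
  also have "\<dots> = hat R \<omega> x (map (tproj x) us @ 0 # map (tproj x) ws)" using x by simp
  also have "\<dots> = 0" using linear_0[OF alternating_linear[OF a]] .
  finally show ?thesis .
qed

lemma pw_form_alternating:
  "R > 0 \<Longrightarrow> pw_form R \<phi> \<omega> \<Longrightarrow> y \<noteq> 0 \<Longrightarrow> alternating (hat R \<omega> y)"
  unfolding pw_form_def using hat_retr retr_in by metis

lemma pw_form_inner: "pw_form R \<phi> \<omega> \<Longrightarrow> norm x = R \<Longrightarrow> hat R \<omega> x vs \<bullet> \<phi> x = 0"
  by (simp add: pw_form_def)

lemma is_form_smooth: "is_form R \<phi> \<omega> \<Longrightarrow> smooth_on (- {0}) (\<lambda>y. hat R \<omega> y vs)"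
  and is_form_pw: "is_form R \<phi> \<omega> \<Longrightarrow> pw_form R \<phi> \<omega>"
  by (auto simp: is_form_def)

lemma tangent_at_iff:
  assumes "R > 0"
  shows "x \<in> sphere 0 R \<and> set vs \<subseteq> tangent_space (sphere 0 R) x \<longleftrightarrow> tangent_at R x vs"
proof (cases "x \<in> sphere 0 R")
  case True
  then show ?thesis unfolding tangent_space_sphere[OF assms True] by (auto simp: tangent_at_def)
qed (auto simp: tangent_at_def)

text \<open>The projected constant fields \<open>\<lambda>y. tproj y v\<close> are smooth vector
  fields; testing the smoothness condition of \<open>forms\<close> on them gives smoothness of
  \<open>hat\<close>.\<close>

lemma forms_imp_is_form:
  fixes \<phi> :: "'a::euclidean_space \<Rightarrow> 'b::euclidean_space"
  assumes R: "R > 0" and \<phi>: "\<And>x. norm x = R \<Longrightarrow> norm (\<phi> x) = 1"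
    and f: "\<omega> \<in> forms (sphere 0 R) (sphere 0 1) \<phi>"
  shows "is_form R \<phi> \<omega>"
proof -
  have f1: "\<not> tangent_at R x vs \<Longrightarrow> \<omega> x vs = 0" for x vs
    using f unfolding forms_def tangent_at_iff[OF R] by blast
  have f2: "\<omega> x vs \<in> tangent_space (sphere 0 1) (\<phi> x)"
      "i < length vs \<Longrightarrow> u \<bullet> x = 0 \<Longrightarrow> w \<bullet> x = 0 \<Longrightarrow>
         \<omega> x (vs[i := a *\<^sub>R u + b *\<^sub>R w]) = a *\<^sub>R \<omega> x (vs[i := u]) + b *\<^sub>R \<omega> x (vs[i := w])"
      "i < j \<Longrightarrow> j < length vs \<Longrightarrow> vs ! i = vs ! j \<Longrightarrow> \<omega> x vs = 0"
    if "tangent_at R x vs" for x vs i j u w a b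
  proof -
    have x: "x \<in> sphere 0 R" and s: "set vs \<subseteq> tangent_space (sphere 0 R) x"
      using that tangent_at_iff[OF R] by blast+
    have T: "u \<bullet> x = 0 \<Longrightarrow> u \<in> tangent_space (sphere 0 R) x" for u
      using tangent_space_sphere[OF R x] by simp
    note F = f[unfolded forms_def mem_Collect_eq, THEN conjunct2, THEN conjunct1, THEN bspec, OF x,
        THEN spec, THEN mp, OF s]
    show "\<omega> x vs \<in> tangent_space (sphere 0 1) (\<phi> x)" using F by (rule conjunct1)
    show "i < length vs \<Longrightarrow> u \<bullet> x = 0 \<Longrightarrow> w \<bullet> x = 0 \<Longrightarrow>
         \<omega> x (vs[i := a *\<^sub>R u + b *\<^sub>R w]) = a *\<^sub>R \<omega> x (vs[i := u]) + b *\<^sub>R \<omega> x (vs[i := w])"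
      by (rule F[THEN conjunct2, THEN conjunct1, rule_format]) (use T in auto)
    show "i < j \<Longrightarrow> j < length vs \<Longrightarrow> vs ! i = vs ! j \<Longrightarrow> \<omega> x vs = 0"
      by (rule F[THEN conjunct2, THEN conjunct2, rule_format, of i j]) blast
  qed
  have f3: "smooth_map_on (sphere 0 R) (\<lambda>x. \<omega> x (map (\<lambda>X. X x) Xs))"
    if "\<forall>X\<in>set Xs. smooth_vector_field (sphere 0 R) X" for Xs
    using f that unfolding forms_def by blast
  have tan: "tangent_at R x (map (tproj x) vs)" if "norm x = R" for x vs
    using that R by (auto simp: tangent_at_def intro!: tproj_inner)
  have hx: "hat R \<omega> x vs = \<omega> x (map (tproj x) vs)" if "norm x = R" for x vs
    using that R by (simp add: hat_def retr_id)
  have "alternating (hat R \<omega> x)" if x: "norm x = R" for x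
  proof -
    have x0: "x \<noteq> 0" using x R by auto
    have L: "hat R \<omega> x (us @ (a *\<^sub>R v + b *\<^sub>R w) # ws) = a *\<^sub>R hat R \<omega> x (us @ v # ws) + b *\<^sub>R hat R \<omega> x (us @ w # ws)"
      for us ws v w a b
    proof -
      let ?l = "map (tproj x) (us @ v # ws)"
      have "\<omega> x (?l[length us := a *\<^sub>R tproj x v + b *\<^sub>R tproj x w]) =
          a *\<^sub>R \<omega> x (?l[length us := tproj x v]) + b *\<^sub>R \<omega> x (?l[length us := tproj x w])"
        using x0 by (intro f2(2) tan x) auto
      moreover have "?l[length us := z] = map (tproj x) us @ z # map (tproj x) ws" for z
        by (simp add: list_update_append)
      ultimately show ?thesis
        by (simp add: hx[OF x] linear_add[OF linear_tproj] linear_cmul[OF linear_tproj])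
    qed
    have "linear (\<lambda>v. hat R \<omega> x (us @ v # ws))" for us ws
      using L[of us 1 _ 1 _ ws] L[of us _ _ 0 0 ws] by (intro linearI) simp_all
    moreover have "hat R \<omega> x (us @ v # v # ws) = 0" for us v ws
      unfolding hx[OF x]
      by (rule f2(3)[OF tan[OF x], of "length us" "Suc (length us)"]) (simp_all add: nth_append)
    ultimately show ?thesis by (simp add: alternating_def)
  qed
  moreover have "hat R \<omega> x vs \<bullet> \<phi> x = 0" if x: "norm x = R" for x vs
    using f2(1)[OF tan[OF x]] tangent_space_sphere[of 1 "\<phi> x"] \<phi>[OF x] by (simp add: hx[OF x])
  moreover have "smooth_on (- {0}) (\<lambda>y. hat R \<omega> y vs)" for vs
  proof -
    let ?Xs = "map (\<lambda>v y. tproj y v) vs"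
    have "\<forall>X\<in>set ?Xs. smooth_vector_field (sphere 0 R) X"
    proof
      fix X assume "X \<in> set ?Xs"
      then obtain v where X: "X = (\<lambda>y. tproj y v)" by auto
      have "smooth_on (- {0}) (\<lambda>y::'a. tproj (retr R y) v)"
        using R by (intro smooth_on_tproj smooth_on_retr smooth_on_ident smooth_on_const) auto
      then show "smooth_vector_field (sphere 0 R) X"
        using R by (auto simp: smooth_vector_field_def X smooth_map_on_sphere tangent_space_sphere intro!: tproj_inner)
    qed
    from f3[OF this] have "smooth_on (- {0}) (\<lambda>y. \<omega> (retr R y) (map (\<lambda>X. X (retr R y)) ?Xs))"
      unfolding smooth_map_on_sphere[OF R] .
    then show ?thesis
    proof (rule smooth_on_cong[rotated])
      fix y :: 'a assume "y \<in> - {0}"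
      then show "\<omega> (retr R y) (map (\<lambda>X. X (retr R y)) ?Xs) = hat R \<omega> y vs"
        using R by (simp add: hat_def o_def)
    qed auto
  qed
  ultimately show ?thesis using f1 by (simp add: is_form_def pw_form_def)
qed

text \<open>Arbitrary smooth vector fields are handled by expansion in \<open>Basis\<close>, and
  equal arguments in arbitrary positions by splitting the list at both of them.\<close>

lemma is_form_imp_forms:
  fixes \<phi> :: "'a::euclidean_space \<Rightarrow> 'b::euclidean_space"
  assumes R: "R > 0" and \<phi>: "\<And>x. norm x = R \<Longrightarrow> norm (\<phi> x) = 1" and f: "is_form R \<phi> \<omega>"
  shows "\<omega> \<in> forms (sphere 0 R) (sphere 0 1) \<phi>"
  unfolding forms_def
proof (intro CollectI conjI allI impI ballI)
  note pw = is_form_pw[OF f]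
  show "\<omega> x vs = 0" if "\<not> (x \<in> sphere 0 R \<and> set vs \<subseteq> tangent_space (sphere 0 R) x)" for x vs
    using that pw unfolding tangent_at_iff[OF R] pw_form_def by blast
next
  note pw = is_form_pw[OF f]
  fix x :: 'a and vs assume x: "x \<in> sphere 0 R" and s: "set vs \<subseteq> tangent_space (sphere 0 R) x"
  then have t: "tangent_at R x vs" using tangent_at_iff[OF R] by blast
  have nx: "norm x = R" using x by simp
  have a: "alternating (hat R \<omega> x)" using pw nx by (simp add: pw_form_def)
  have h: "\<omega> x ws = hat R \<omega> x ws" if "tangent_at R x ws" for ws by (rule hat_tangent[OF R that, symmetric])
  show "\<omega> x vs \<in> tangent_space (sphere 0 1) (\<phi> x)"
    using h[OF t] pw_form_inner[OF pw nx] \<phi>[OF nx] by (simp add: tangent_space_sphere)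
  fix i
  {
    fix p q :: real and u w
    assume i: "i < length vs" and "u \<in> tangent_space (sphere 0 R) x" "w \<in> tangent_space (sphere 0 R) x"
    then have uw: "u \<bullet> x = 0" "w \<bullet> x = 0" using tangent_space_sphere[OF R x] by auto
    have tl: "tangent_at R x (take i vs @ z # drop (Suc i) vs)" if "z \<bullet> x = 0" for z
      using t that by (auto simp: tangent_at_def dest: in_set_takeD in_set_dropD)
    have e: "(p *\<^sub>R u + q *\<^sub>R w) \<bullet> x = 0" using uw by (simp add: inner_add_left)
    show "\<omega> x (vs[i := p *\<^sub>R u + q *\<^sub>R w]) = p *\<^sub>R \<omega> x (vs[i := u]) + q *\<^sub>R \<omega> x (vs[i := w])"
      unfolding upd_conv_take_nth_drop[OF i] h[OF tl[OF uw(1)]] h[OF tl[OF uw(2)]] h[OF tl[OF e]]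
      by (simp only: linear_add[OF alternating_linear[OF a]] linear_cmul[OF alternating_linear[OF a]])
  }
  fix j assume ij: "i < j \<and> j < length vs \<and> vs ! i = vs ! j"
  have "vs = take j vs @ vs ! j # drop (Suc j) vs" using ij by (simp add: id_take_nth_drop)
  also have "take j vs = take i (take j vs) @ take j vs ! i # drop (Suc i) (take j vs)"
    using ij by (intro id_take_nth_drop) auto
  finally have "vs = take i (take j vs) @ vs ! j # drop (Suc i) (take j vs) @ vs ! j # drop (Suc j) vs"
    using ij by simp
  then have "hat R \<omega> x vs = 0" using alternating_eq0[OF a] by metis
  then show "\<omega> x vs = 0" using h[OF t] by simp
next
  note pw = is_form_pw[OF f]
  fix Xs :: "('a \<Rightarrow> 'a) list" assume Xs: "\<forall>X\<in>set Xs. smooth_vector_field (sphere 0 R) X"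
  have "smooth_on (- {0}) (\<lambda>y. X (retr R y))" if "X \<in> set Xs" for X
    by (rule smooth_map_on_sphere[OF R, of X, THEN iffD1])
       (use Xs that in \<open>simp add: smooth_vector_field_def\<close>)
  then have "smooth_on (- {0}) (\<lambda>y. hat R \<omega> y (map (\<lambda>X. X (retr R y)) Xs))"
    by (intro smooth_on_alternating[where w = "\<lambda>y X. X (retr R y)" and g = "hat R \<omega>"]
        pw_form_alternating[OF R pw] is_form_smooth[OF f]) auto
  then have "smooth_on (- {0}) (\<lambda>y. \<omega> (retr R y) (map (\<lambda>X. X (retr R y)) Xs))"
  proof (rule smooth_on_cong[rotated])
    fix y :: 'a assume y: "y \<in> - {0}"
    have "tproj y (X (retr R y)) = X (retr R y)" if "X \<in> set Xs" for X
    proof -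
      have "X (retr R y) \<in> tangent_space (sphere 0 R) (retr R y)"
        using Xs that y R by (auto simp: smooth_vector_field_def)
      then have "X (retr R y) \<bullet> retr R y = 0"
        using tangent_space_sphere[OF R, of "retr R y"] y R by auto
      then have "tproj (retr R y) (X (retr R y)) = X (retr R y)" by (rule tproj_id)
      then show ?thesis using y R by simp
    qed
    then have "map (tproj y) (map (\<lambda>X. X (retr R y)) Xs) = map (\<lambda>X. X (retr R y)) Xs" by simp
    then show "hat R \<omega> y (map (\<lambda>X. X (retr R y)) Xs) = \<omega> (retr R y) (map (\<lambda>X. X (retr R y)) Xs)"
      by (simp only: hat_def)
  qed auto
  then show "smooth_map_on (sphere 0 R) (\<lambda>x. \<omega> x (map (\<lambda>X. X x) Xs))"
    unfolding smooth_map_on_sphere[OF R] .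
qed

lemma forms_iff:
  fixes \<phi> :: "'a::euclidean_space \<Rightarrow> 'b::euclidean_space"
  assumes "R > 0" "\<And>x. norm x = R \<Longrightarrow> norm (\<phi> x) = 1"
  shows "\<omega> \<in> forms (sphere 0 R) (sphere 0 1) \<phi> \<longleftrightarrow> is_form R \<phi> \<omega>"
  using forms_imp_is_form[OF assms(1), of \<phi> \<omega>] is_form_imp_forms[OF assms(1), of \<phi> \<omega>] assms(2) by blast

text \<open>The covariant derivative as an ordinary derivative: values are projected to the tangent
  space of the target, and the corrections for the arguments vanish by
  \<open>levi_civita_sphere\<close>.\<close>

definition cov :: "real \<Rightarrow> ('a::euclidean_space \<Rightarrow> 'b::euclidean_space) \<Rightarrow> ('a \<Rightarrow> 'a list \<Rightarrow> 'b) \<Rightarrow> 'a \<Rightarrow> 'a \<Rightarrow> 'a list \<Rightarrow> 'b" where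
  "cov R \<phi> \<omega> x u vs = tproj (\<phi> x) (frechet_derivative (\<lambda>y. hat R \<omega> y vs) (at x) u)"

definition extdiff :: "real \<Rightarrow> ('a::euclidean_space \<Rightarrow> 'b::euclidean_space) \<Rightarrow> ('a \<Rightarrow> 'a list \<Rightarrow> 'b) \<Rightarrow> 'a \<Rightarrow> 'a list \<Rightarrow> 'b" where
  "extdiff R \<phi> \<omega> x vs = (if tangent_at R x vs then alt_sum vs (cov R \<phi> \<omega> x) else 0)"

text \<open>
  The trace runs over a basis of the ambient space: the normal direction contributes nothing,
  because \<open>hat\<close> is constant in it.
\<close>

definition codiff :: "real \<Rightarrow> ('a::euclidean_space \<Rightarrow> 'b::euclidean_space) \<Rightarrow> ('a \<Rightarrow> 'a list \<Rightarrow> 'b) \<Rightarrow> 'a \<Rightarrow> 'a list \<Rightarrow> 'b" where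
  "codiff R \<phi> \<omega> x vs = (if tangent_at R x vs then - (\<Sum>b\<in>Basis. cov R \<phi> \<omega> x b (b # vs)) else 0)"

lemma pullback_connection_sphere:
  fixes \<phi> \<sigma> :: "'a::euclidean_space \<Rightarrow> 'b::euclidean_space"
  assumes "R > 0" "r > 0" "norm x = R" "norm (\<phi> x) = r" "u \<bullet> x = 0"
    and "((\<lambda>y. \<sigma> (retr R y)) has_derivative D) (at x)"
  shows "pullback_connection (sphere 0 R) (sphere 0 r) \<phi> \<sigma> x u = tproj (\<phi> x) (D u)"
  unfolding pullback_connection_def differential_sphere[OF assms(1,3,5,6)]
  using assms(2,4) by (simp add: orth_proj_sphere)

text \<open>For \<open>v\<close> tangent at \<open>x\<close>, the derivative at \<open>x\<close> of
  the projected constant field \<open>tproj y v\<close> is normal to the sphere.\<close>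

lemma levi_civita_sphere:
  fixes x :: "'a::euclidean_space"
  assumes R: "R > 0" and x: "norm x = R" "u \<bullet> x = 0" "v \<bullet> x = 0"
  shows "levi_civita (sphere 0 R) (tangent_extension (sphere 0 R) v) x u = 0"
proof -
  have x0: "x \<noteq> 0" using x R by auto
  have te: "tangent_extension (sphere 0 R) v (retr R y) = tproj y v" if "y \<in> - {0}" for y
    using R that by (simp add: tangent_extension_def orth_proj_sphere)
  have "((\<lambda>y. v - ((v \<bullet> y) / (y \<bullet> y)) *\<^sub>R y) has_derivative (\<lambda>u. - (((v \<bullet> u) / (x \<bullet> x)) *\<^sub>R x))) (at x)"
    using x0 x(3) by (auto intro!: derivative_eq_intros simp: field_simps)
  then have "((\<lambda>y. tproj y v) has_derivative (\<lambda>u. - (((v \<bullet> u) / (x \<bullet> x)) *\<^sub>R x))) (at x)"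
    by (simp add: tproj_def)
  then have "((\<lambda>y. tangent_extension (sphere 0 R) v (retr R y)) has_derivative
      (\<lambda>u. - (((v \<bullet> u) / (x \<bullet> x)) *\<^sub>R x))) (at x)"
    by (rule has_derivative_transform_within_open[of _ _ _ _ "- {0}"]) (use x0 te in auto)
  from pullback_connection_sphere[where \<phi> = "\<lambda>y. y", OF R R x(1) x(1) x(2) this] show ?thesis
    using x0 by (simp add: levi_civita_def linear_neg[OF linear_tproj] linear_cmul[OF linear_tproj])
qed

text \<open>In each Leibniz correction of \<open>cov_deriv_form\<close> an argument is replaced by
  0, so only the differentiated term remains.\<close>

lemma ext_d_eq:
  fixes \<phi> :: "'a::euclidean_space \<Rightarrow> 'b::euclidean_space"
  assumes R: "R > 0" and \<phi>: "\<And>x. norm x = R \<Longrightarrow> norm (\<phi> x) = 1" and f: "is_form R \<phi> \<omega>"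
  shows "ext_d (sphere 0 R) (sphere 0 1) \<phi> \<omega> = extdiff R \<phi> \<omega>"
proof (intro ext)
  fix x vs
  note pw = is_form_pw[OF f]
  have c: "cov_deriv_form (sphere 0 R) (sphere 0 1) \<phi> \<omega> x u ws = cov R \<phi> \<omega> x u ws"
    if t: "tangent_at R x (u # ws)" for u ws
  proof -
    have x: "norm x = R" "u \<bullet> x = 0" and x0: "x \<noteq> 0" and tw: "tangent_at R x ws"
      using t R by (auto simp: tangent_at_def)
    have a: "alternating (hat R \<omega> x)" using pw x by (simp add: pw_form_def)
    have "\<omega> x (ws[i := levi_civita (sphere 0 R) (tangent_extension (sphere 0 R) (ws ! i)) x u]) = 0"
      if i: "i < length ws" for i
    proof -
      have "(ws ! i) \<bullet> x = 0" using tw i by (simp add: tangent_at_def)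
      then have "levi_civita (sphere 0 R) (tangent_extension (sphere 0 R) (ws ! i)) x u = 0"
        by (rule levi_civita_sphere[OF R x])
      moreover have "tangent_at R x (take i ws @ 0 # drop (Suc i) ws)"
        using tw by (auto simp: tangent_at_def dest: in_set_takeD in_set_dropD)
      from hat_tangent[OF R this, of \<omega>] have "\<omega> x (take i ws @ 0 # drop (Suc i) ws) = 0"
        using linear_0[OF alternating_linear[OF a]] by metis
      ultimately show ?thesis by (simp add: upd_conv_take_nth_drop[OF i])
    qed
    moreover have "pullback_connection (sphere 0 R) (sphere 0 1) \<phi>
        (\<lambda>y. \<omega> y (map (\<lambda>v. tangent_extension (sphere 0 R) v y) ws)) x u = cov R \<phi> \<omega> x u ws"
      unfolding cov_def
    proof (rule pullback_connection_sphere[where \<phi> = \<phi> and r = 1, OF R _ x(1) \<phi>[OF x(1)] x(2)])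
      have "((\<lambda>y. hat R \<omega> y ws) has_derivative frechet_derivative (\<lambda>y. hat R \<omega> y ws) (at x)) (at x)"
        using x0 by (intro smooth_on_has_derivative[OF is_form_smooth[OF f]]) simp
      then show "((\<lambda>y. \<omega> (retr R y) (map (\<lambda>v. tangent_extension (sphere 0 R) v (retr R y)) ws))
        has_derivative frechet_derivative (\<lambda>y. hat R \<omega> y ws) (at x)) (at x)"
      proof (rule has_derivative_transform_within_open[of _ _ _ _ "- {0}"])
        fix y :: 'a assume "y \<in> - {0}"
        then have "tangent_extension (sphere 0 R) v (retr R y) = tproj y v" for v
          using R by (simp add: tangent_extension_def orth_proj_sphere)
        then show "hat R \<omega> y ws = \<omega> (retr R y) (map (\<lambda>v. tangent_extension (sphere 0 R) v (retr R y)) ws)"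
          by (simp add: hat_def)
      qed (use x0 in auto)
    qed simp
    ultimately show ?thesis by (simp add: cov_deriv_form_def)
  qed
  show "ext_d (sphere 0 R) (sphere 0 1) \<phi> \<omega> x vs = extdiff R \<phi> \<omega> x vs"
  proof (cases "tangent_at R x vs")
    case True
    have "cov_deriv_form (sphere 0 R) (sphere 0 1) \<phi> \<omega> x (vs ! i) (take i vs @ drop (Suc i) vs) =
      cov R \<phi> \<omega> x (vs ! i) (take i vs @ drop (Suc i) vs)" if "i < length vs" for i
      using True that by (intro c) (auto simp: tangent_at_def dest: in_set_takeD in_set_dropD)
    then show ?thesis
      using True by (simp only: ext_d_def extdiff_def tangent_at_iff[OF R] if_True alt_sum_eq) simp
  next
    case False
    then show ?thesis by (simp only: ext_d_def extdiff_def tangent_at_iff[OF R] if_False)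
  qed
qed

text \<open>Dividing by \<open>fact k\<close> leaves one term for each increasing tuple. Summing
  over the ambient \<open>Basis\<close> is correct for \<open>hat\<close>, which annihilates the
  normal direction; alternating functions vanish in degrees above the dimension.\<close>

definition ip :: "('a::euclidean_space list \<Rightarrow> 'b::real_inner) \<Rightarrow> ('a list \<Rightarrow> 'b) \<Rightarrow> real" where
  "ip f g = (\<Sum>k\<le>DIM('a). tuple_inner Basis k f g / fact k)"

text \<open>Every cut-off gives the same sum over sublists of a basis. This freedom absorbs the
  shift of degree in the adjointness proof.\<close>

lemma ip_eq:
  fixes f g :: "'a::euclidean_space list \<Rightarrow> 'b::real_inner"
  assumes "alternating f" "alternating g" "DIM('a) \<le> K"
  shows "ip f g = (\<Sum>k\<le>K. tuple_inner Basis k f g / fact k)"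
proof -
  obtain es where es: "set es = (Basis :: 'a set)" "distinct es"
    using finite_distinct_list[OF finite_Basis] by blast
  have "length es = DIM('a)" using es distinct_card by metis
  then show ?thesis
    using ip_list_tuple_inner[OF assms(1,2) es(2), of K] ip_list_tuple_inner[OF assms(1,2) es(2), of "DIM('a)"] assms(3)
    by (simp add: ip_def es)
qed

lemma orthonormal_frame_exists:
  fixes x :: "'a::euclidean_space"
  shows "\<exists>es. orthonormal_frame {v. v \<bullet> x = 0} es"
proof -
  have s: "subspace {v. v \<bullet> x = 0}" by (auto simp: subspace_def inner_add_left)
  obtain B where B: "B \<subseteq> {v. v \<bullet> x = 0}" "pairwise orthogonal B" "\<And>b. b \<in> B \<Longrightarrow> norm b = 1"
    "independent B" "span B = {v. v \<bullet> x = 0}"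
    using orthonormal_basis_subspace[OF s] by metis
  have "finite B" using B(4) independent_bound by blast
  then obtain es where "set es = B" "distinct es" using finite_distinct_list by blast
  then show ?thesis using B by (intro exI[of _ es]) (auto simp: orthonormal_frame_def)
qed

text \<open>Adjoin the unit normal to the chosen frame. Tuples containing it contribute nothing, and
  the resulting orthonormal basis of the ambient space can be exchanged for
  \<open>Basis\<close>.\<close>

lemma form_inner_eq:
  fixes \<omega> \<eta> :: "'a::euclidean_space \<Rightarrow> 'a list \<Rightarrow> 'b::euclidean_space"
  assumes R: "R > 0" and x: "norm x = R"
    and a: "alternating (hat R \<omega> x)" "alternating (hat R \<eta> x)"
  shows "form_inner (sphere 0 R) \<omega> \<eta> x = ip (hat R \<omega> x) (hat R \<eta> x)"
proof -
  have x0: "x \<noteq> 0" using x R by auto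
  have T: "tangent_space (sphere 0 R) x = {v. v \<bullet> x = 0}" using R x by (simp add: tangent_space_sphere)
  define es where "es = (SOME es. orthonormal_frame {v. v \<bullet> x = 0} es)"
  have es: "orthonormal_frame {v. v \<bullet> x = 0} es"
    unfolding es_def using orthonormal_frame_exists by (rule someI_ex)
  then have e: "distinct es" "pairwise orthogonal (set es)" "\<And>b. b \<in> set es \<Longrightarrow> norm b = 1"
    "span (set es) = {v. v \<bullet> x = 0}" by (auto simp: orthonormal_frame_def)
  have ex: "b \<bullet> x = 0" if "b \<in> set es" for b using e(4) span_base[OF that] by auto
  define n where "n = (1 / R) *\<^sub>R x"
  have n: "norm n = 1" "n \<bullet> x = R" using x R by (auto simp: n_def dot_square_norm power2_eq_square)
  have nes: "n \<notin> set es" using ex n R by fastforce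
  let ?B = "set (n # es)"
  have po: "pairwise orthogonal ?B"
    using e(2) ex by (auto simp: pairwise_insert orthogonal_def n_def inner_commute)
  have nb: "\<And>b. b \<in> ?B \<Longrightarrow> norm b = 1" using e(3) n by auto
  have sp: "span ?B = UNIV"
  proof -
    have "v \<in> span ?B" for v
    proof -
      have "tproj x v \<in> span ?B"
      proof -
        have "tproj x v \<in> span (set es)" using x0 unfolding e(4) by simp
        moreover have "set es \<subseteq> ?B" by auto
        ultimately show ?thesis using span_mono by blast
      qed
      moreover have "((v \<bullet> x) / (x \<bullet> x) * R) *\<^sub>R n \<in> span ?B" by (intro span_mul span_base) simp
      moreover have "v = tproj x v + ((v \<bullet> x) / (x \<bullet> x) * R) *\<^sub>R n"
        using R by (simp add: tproj_def n_def)
      ultimately show ?thesis by (metis span_add)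
    qed
    then show ?thesis by auto
  qed
  have "independent ?B" using nb by (intro pairwise_orthogonal_independent[OF po]) fastforce
  then have "card ?B \<le> DIM('a)" using independent_bound by blast
  then have len: "length (n # es) \<le> DIM('a)" using nes e(1) by (simp add: distinct_card)
  have tn: "tangent_at R x (nths es I)" for I
    using x ex by (auto simp: tangent_at_def dest: in_set_nthsD)
  have "form_inner (sphere 0 R) \<omega> \<eta> x = (\<Sum>I\<in>Pow {..<length es}. \<omega> x (nths es I) \<bullet> \<eta> x (nths es I))"
    by (simp add: form_inner_def T es_def Let_def)
  also have "\<dots> = (\<Sum>I\<in>Pow {..<length es}. hat R \<omega> x (nths es I) \<bullet> hat R \<eta> x (nths es I))"
    by (simp add: hat_tangent[OF R tn])
  also have "\<dots> = ip_list es (hat R \<omega> x) (hat R \<eta> x)" by (rule ip_list_eq)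
  also have "\<dots> = ip_list (n # es) (hat R \<omega> x) (hat R \<eta> x)"
  proof -
    have "hat R \<omega> x (n # vs) = 0" for vs
      using linear_cmul[OF alternating_linear1[OF a(1)], of "1 / R" x vs] hat_normal[OF R x a(1), of "[]" vs]
      by (simp add: n_def)
    then have "ip_list es (\<lambda>vs. hat R \<omega> x (n # vs)) (\<lambda>vs. hat R \<eta> x (n # vs)) = 0"
      by (simp flip: ip_list_eq)
    then show ?thesis by simp
  qed
  also have "\<dots> = (\<Sum>k\<le>DIM('a). tuple_inner ?B k (hat R \<omega> x) (hat R \<eta> x) / fact k)"
    using nes e(1) len by (intro ip_list_tuple_inner a) auto
  also have "\<dots> = ip (hat R \<omega> x) (hat R \<eta> x)"
    unfolding ip_def using po nb sp by (intro sum.cong refl arg_cong2[where f = "(/)"] tuple_inner_onb a) auto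
  finally show ?thesis .
qed

lemma form_inner_0:
  assumes "R > 0" "\<And>vs. \<omega> x vs = 0"
  shows "form_inner M \<omega> \<eta> x = 0"
  using assms by (simp add: form_inner_def Let_def)


section \<open>The exterior differential and its adjoint\<close>

text \<open>Smoothness is required of the extension of degree 0, jointly in time and space, so that
  time derivatives can be taken at fixed points off the origin.\<close>

definition variation :: "real set \<Rightarrow> real \<Rightarrow> (real \<Rightarrow> 'a::euclidean_space \<Rightarrow> 'b::euclidean_space) \<Rightarrow> bool" where
  "variation I R \<phi> \<longleftrightarrow> R > 0 \<and> open I \<and> (\<forall>t\<in>I. \<forall>x. norm x = R \<longrightarrow> norm (\<phi> t x) = 1) \<and>
     smooth_on (I \<times> (- {0})) (\<lambda>p. \<phi> (fst p) (retr R (snd p)))"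

definition family :: "real set \<Rightarrow> real \<Rightarrow> (real \<Rightarrow> 'a::euclidean_space \<Rightarrow> 'b::euclidean_space) \<Rightarrow>
    (real \<Rightarrow> 'a \<Rightarrow> 'a list \<Rightarrow> 'b) \<Rightarrow> bool" where
  "family I R \<phi> \<omega> \<longleftrightarrow> (\<forall>t\<in>I. pw_form R (\<phi> t) (\<omega> t)) \<and>
     (\<forall>vs. smooth_on (I \<times> (- {0})) (\<lambda>p. hat R (\<omega> (fst p)) (snd p) vs))"

lemma variationD:
  assumes "variation I R \<phi>"
  shows "R > 0" "open I" "t \<in> I \<Longrightarrow> norm x = R \<Longrightarrow> norm (\<phi> t x) = 1"
    "smooth_on (I \<times> (- {0})) (\<lambda>p. \<phi> (fst p) (retr R (snd p)))"
  using assms by (auto simp: variation_def)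

lemma familyD:
  assumes "family I R \<phi> \<omega>"
  shows "t \<in> I \<Longrightarrow> pw_form R (\<phi> t) (\<omega> t)" "smooth_on (I \<times> (- {0})) (\<lambda>p. hat R (\<omega> (fst p)) (snd p) vs)"
  using assms by (auto simp: family_def)

lemma open_compl0: "open (- {0::'a::euclidean_space})"
  by auto

lemma family_is_form:
  assumes "variation I R \<phi>" "family I R \<phi> \<omega>" "t \<in> I"
  shows "is_form R (\<phi> t) (\<omega> t)"
  using smooth_on_slice[OF familyD(2)[OF assms(2)] variationD(2)[OF assms(1)] open_compl0 assms(3)]
    familyD(1)[OF assms(2,3)] by (simp add: is_form_def)

text \<open>Constant families make statements about a single map instances of those about
  variations.\<close>

lemma is_form_family:
  assumes "is_form R \<phi> \<omega>"
  shows "family UNIV R (\<lambda>_. \<phi>) (\<lambda>_. \<omega>)"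
  using smooth_on_snd_compose[OF is_form_smooth[OF assms] open_UNIV open_compl0] is_form_pw[OF assms]
  by (simp add: family_def)

lemma variation_const:
  assumes "variation I R \<phi>" "t \<in> I"
  shows "variation UNIV R (\<lambda>_. \<phi> t)"
proof -
  have "smooth_on (- {0}) (\<lambda>y. \<phi> t (retr R y))"
    using smooth_on_slice[OF variationD(4)[OF assms(1)] variationD(2)[OF assms(1)] open_compl0 assms(2)] by simp
  from smooth_on_snd_compose[OF this open_UNIV open_compl0] show ?thesis
    using assms by (simp add: variation_def)
qed

lemma frechet_derivative_slice_snd:
  fixes F :: "real \<times> 'a::euclidean_space \<Rightarrow> 'b::real_normed_vector"
  assumes "smooth_on (I \<times> (- {0})) F" "t \<in> I" "x \<noteq> 0"
  shows "frechet_derivative (\<lambda>y. F (t, y)) (at x) v = frechet_derivative F (at (t, x)) (0, v)"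
proof -
  have "(F has_derivative frechet_derivative F (at (t, x))) (at (t, x))"
    using assms by (intro smooth_on_has_derivative[OF assms(1)]) auto
  from frechet_derivative_at[OF has_derivative_slice_snd[OF this], symmetric] show ?thesis by simp
qed

text \<open>The identities that define \<open>alternating\<close> survive differentiation, by
  uniqueness of derivatives.\<close>

lemma alternating_frechet_derivative:
  fixes g :: "'a::real_normed_vector \<Rightarrow> 'c::real_normed_vector list \<Rightarrow> 'b::real_normed_vector"
  assumes "open V" "x \<in> V" "\<And>y. y \<in> V \<Longrightarrow> alternating (g y)"
    and d: "\<And>vs. ((\<lambda>y. g y vs) has_derivative D vs) (at x)"
  shows "alternating (\<lambda>vs. D vs u)"
  unfolding alternating_def
proof (intro conjI allI)
  fix us ws
  note l = alternating_linear[OF assms(3)]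
  show "linear (\<lambda>v. D (us @ v # ws) u)"
  proof (rule linearI)
    fix a b :: 'c
    have "((\<lambda>y. g y (us @ a # ws) + g y (us @ b # ws)) has_derivative (\<lambda>u. D (us @ a # ws) u + D (us @ b # ws) u)) (at x)"
      by (intro has_derivative_add d)
    then have "((\<lambda>y. g y (us @ (a + b) # ws)) has_derivative (\<lambda>u. D (us @ a # ws) u + D (us @ b # ws) u)) (at x)"
      by (rule has_derivative_transform_within_open[OF _ assms(1,2)]) (simp only: linear_add[OF l])
    from has_derivative_unique[OF d this] show "D (us @ (a + b) # ws) u = D (us @ a # ws) u + D (us @ b # ws) u"
      by (rule fun_cong)
  next
    fix c :: real and a :: 'c
    have "((\<lambda>y. c *\<^sub>R g y (us @ a # ws)) has_derivative (\<lambda>u. c *\<^sub>R D (us @ a # ws) u)) (at x)"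
      by (intro has_derivative_scaleR_right d)
    then have "((\<lambda>y. g y (us @ (c *\<^sub>R a) # ws)) has_derivative (\<lambda>u. c *\<^sub>R D (us @ a # ws) u)) (at x)"
      by (rule has_derivative_transform_within_open[OF _ assms(1,2)]) (simp only: linear_cmul[OF l])
    from has_derivative_unique[OF d this] show "D (us @ (c *\<^sub>R a) # ws) u = c *\<^sub>R D (us @ a # ws) u"
      by (rule fun_cong)
  qed
next
  fix us v ws
  have "((\<lambda>y. g y (us @ v # v # ws)) has_derivative (\<lambda>u. 0)) (at x)"
    by (rule has_derivative_transform_within_open[OF has_derivative_const[of 0] assms(1,2)])
       (simp only: alternating_adj[OF assms(3)])
  from has_derivative_unique[OF d this] show "D (us @ v # v # ws) u = 0" by (rule fun_cong)
qed

lemma is_form_has_derivative: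
  "is_form R \<phi> \<omega> \<Longrightarrow> x \<noteq> 0 \<Longrightarrow>
    ((\<lambda>y. hat R \<omega> y vs) has_derivative frechet_derivative (\<lambda>y. hat R \<omega> y vs) (at x)) (at x)"
  by (rule smooth_on_has_derivative[OF is_form_smooth]) auto

lemma alternating_cov:
  assumes "R > 0" "is_form R \<phi> \<omega>" "x \<noteq> 0"
  shows "alternating (cov R \<phi> \<omega> x u)"
proof -
  have "alternating (\<lambda>vs. frechet_derivative (\<lambda>y. hat R \<omega> y vs) (at x) u)"
    by (rule alternating_frechet_derivative[OF open_compl0, where g = "hat R \<omega>"
          and D = "\<lambda>vs. frechet_derivative (\<lambda>y. hat R \<omega> y vs) (at x)"])
       (use assms(3) pw_form_alternating[OF assms(1) is_form_pw[OF assms(2)]]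
         is_form_has_derivative[OF assms(2,3)] in auto)
  then show ?thesis unfolding cov_def by (rule alternating_post[OF _ linear_tproj])
qed

lemma linear_cov:
  assumes "is_form R \<phi> \<omega>" "x \<noteq> 0"
  shows "linear (\<lambda>u. cov R \<phi> \<omega> x u vs)"
  unfolding cov_def
  using linear_compose[OF has_derivative_linear[OF is_form_has_derivative[OF assms]] linear_tproj]
  by (simp add: o_def)

lemma cov_radial:
  assumes "is_form R \<phi> \<omega>" "x \<noteq> 0"
  shows "cov R \<phi> \<omega> x x vs = 0"
  using homogeneous_radial_derivative[OF assms(2) is_form_has_derivative[OF assms] hat_scale]
  by (simp add: cov_def linear_0[OF linear_tproj])

text \<open>The directions \<open>u\<close> and \<open>tproj x u\<close> differ by a radial vector,
  along which \<open>hat\<close> is constant.\<close>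

lemma cov_tproj:
  assumes "is_form R \<phi> \<omega>" "x \<noteq> 0"
  shows "cov R \<phi> \<omega> x (tproj x u) vs = cov R \<phi> \<omega> x u vs"
  unfolding tproj_def[of x u]
  by (simp only: linear_diff[OF linear_cov[OF assms]] linear_cmul[OF linear_cov[OF assms]] cov_radial[OF assms])
     simp

lemma tangent_at_tproj: "R > 0 \<Longrightarrow> y \<noteq> 0 \<Longrightarrow> tangent_at R (retr R y) (map (tproj y) vs)"
  using tproj_inner(1)[of "retr R y"] by (auto simp: tangent_at_def)

lemma alt_sum_map: "alt_sum (map P vs) A = alt_sum vs (\<lambda>u ws. A (P u) (map P ws))"
  by (induction vs arbitrary: A) auto

lemma alt_sum_inner0: "(\<And>u ws. A u ws \<bullet> p = 0) \<Longrightarrow> alt_sum vs A \<bullet> p = 0"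
  by (induction vs arbitrary: A) (auto simp: inner_diff_left)

lemma hat_extdiff: "R > 0 \<Longrightarrow> y \<noteq> 0 \<Longrightarrow> hat R (extdiff R \<phi> \<omega>) y vs = alt_sum (map (tproj y) vs) (cov R \<phi> \<omega> (retr R y))"
  by (simp add: hat_def extdiff_def tangent_at_tproj)

lemma hat_codiff: "R > 0 \<Longrightarrow> y \<noteq> 0 \<Longrightarrow>
    hat R (codiff R \<phi> \<omega>) y vs = - (\<Sum>b\<in>Basis. cov R \<phi> \<omega> (retr R y) b (b # map (tproj y) vs))"
  by (simp add: hat_def codiff_def tangent_at_tproj)

lemma alternating_neg: "alternating f \<Longrightarrow> alternating (\<lambda>vs. - f vs)"
  using alternating_scaleR[of f "-1"] by simp

text \<open>The spatial derivative is rewritten as the derivative of the joint function in the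
  direction \<open>(0, u)\<close>, which is smooth in time and space together.\<close>

lemma smooth_on_cov:
  fixes \<phi> :: "real \<Rightarrow> 'a::euclidean_space \<Rightarrow> 'b::euclidean_space"
  assumes v: "variation I R \<phi>" and f: "family I R \<phi> \<omega>"
  shows "smooth_on (I \<times> (- {0})) (\<lambda>p. cov R (\<phi> (fst p)) (\<omega> (fst p)) (retr R (snd p)) u vs)"
proof -
  note R = variationD(1)[OF v] and I = variationD(2)[OF v]
  have o: "open (I \<times> (- {0::'a}))" using I by simp
  let ?H = "\<lambda>p. hat R (\<omega> (fst p)) (snd p) vs"
  have h: "smooth_on (I \<times> (- {0})) ?H" by (rule familyD(2)[OF f])
  have "smooth_on (I \<times> (- {0})) (\<lambda>p. frechet_derivative ?H (at (fst p, retr R (snd p))) (0, u))"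
    using R o by (intro smooth_on_compose[OF o o _ smooth_on_frechet_derivative[OF h], where f = "\<lambda>p. (fst p, retr R (snd p))"]
        smooth_on_Pair smooth_on_retr smooth_on_fst smooth_on_snd) auto
  then have "smooth_on (I \<times> (- {0})) (\<lambda>p. tproj (\<phi> (fst p) (retr R (snd p)))
       (frechet_derivative ?H (at (fst p, retr R (snd p))) (0, u)))"
  proof (intro smooth_on_tproj[OF o variationD(4)[OF v]])
    fix p assume "p \<in> I \<times> (- {0::'a})"
    then have "fst p \<in> I" "snd p \<noteq> 0" by auto
    then have "norm (\<phi> (fst p) (retr R (snd p))) = 1" using R by (intro variationD(3)[OF v]) simp_all
    then show "\<phi> (fst p) (retr R (snd p)) \<noteq> 0" by auto
  qed
  then show ?thesis
  proof (rule smooth_on_cong[OF o])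
    fix p assume "p \<in> I \<times> (- {0::'a})"
    then have "fst p \<in> I" "snd p \<noteq> 0" by auto
    then show "tproj (\<phi> (fst p) (retr R (snd p))) (frechet_derivative ?H (at (fst p, retr R (snd p))) (0, u)) =
        cov R (\<phi> (fst p)) (\<omega> (fst p)) (retr R (snd p)) u vs"
      unfolding cov_def using R frechet_derivative_slice_snd[OF h, of "fst p" "retr R (snd p)" u] by simp
  qed
qed

lemma pw_form_extdiff:
  assumes "R > 0" "\<And>x. norm x = R \<Longrightarrow> norm (\<phi> x) = 1" "is_form R \<phi> \<omega>"
  shows "pw_form R \<phi> (extdiff R \<phi> \<omega>)"
  unfolding pw_form_def
proof (intro conjI allI impI)
  fix x :: 'a assume x: "norm x = R"
  then have x0: "x \<noteq> 0" using assms(1) by auto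
  have e: "hat R (extdiff R \<phi> \<omega>) x = (\<lambda>vs. alt_sum (map (tproj x) vs) (cov R \<phi> \<omega> x))"
    using assms(1) x x0 by (intro ext) (simp add: hat_extdiff retr_id)
  show "alternating (hat R (extdiff R \<phi> \<omega>) x)"
    unfolding e by (intro alternating_map[where g = "\<lambda>vs. alt_sum vs (cov R \<phi> \<omega> x)"] alternating_alt_sum
      alternating_cov linear_cov linear_tproj assms x0)
  have "\<phi> x \<noteq> 0" using assms(2)[OF x] by auto
  then show "hat R (extdiff R \<phi> \<omega>) x vs \<bullet> \<phi> x = 0" for vs
    unfolding e by (intro alt_sum_inner0) (simp add: cov_def)
qed (simp add: extdiff_def)

lemma pw_form_codiff:
  assumes "R > 0" "\<And>x. norm x = R \<Longrightarrow> norm (\<phi> x) = 1" "is_form R \<phi> \<omega>"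
  shows "pw_form R \<phi> (codiff R \<phi> \<omega>)"
  unfolding pw_form_def
proof (intro conjI allI impI)
  fix x :: 'a assume x: "norm x = R"
  then have x0: "x \<noteq> 0" using assms(1) by auto
  have e: "hat R (codiff R \<phi> \<omega>) x = (\<lambda>vs. - (\<Sum>b\<in>Basis. cov R \<phi> \<omega> x b (b # map (tproj x) vs)))"
    using assms(1) x x0 by (intro ext) (simp add: hat_codiff retr_id)
  show "alternating (hat R (codiff R \<phi> \<omega>) x)"
    unfolding e by (intro alternating_neg alternating_sum alternating_map[where g = "\<lambda>vs. cov R \<phi> \<omega> x _ (_ # vs)"]
      alternating_Cons alternating_cov linear_tproj assms x0)
  have "\<phi> x \<noteq> 0" using assms(2)[OF x] by auto
  then show "hat R (codiff R \<phi> \<omega>) x vs \<bullet> \<phi> x = 0" for vs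
    unfolding e by (simp add: inner_sum_left cov_def)
qed (simp add: codiff_def)

lemma family_extdiff:
  fixes \<phi> :: "real \<Rightarrow> 'a::euclidean_space \<Rightarrow> 'b::euclidean_space"
  assumes v: "variation I R \<phi>" and f: "family I R \<phi> \<omega>"
  shows "family I R \<phi> (\<lambda>t. extdiff R (\<phi> t) (\<omega> t))"
  unfolding family_def
proof (intro conjI ballI allI)
  note R = variationD(1)[OF v] and I = variationD(2)[OF v]
  have o: "open (I \<times> (- {0::'a}))" using I by simp
  show "pw_form R (\<phi> t) (extdiff R (\<phi> t) (\<omega> t))" if "t \<in> I" for t
    using that by (intro pw_form_extdiff R variationD(3)[OF v] family_is_form[OF v f])
  fix vs :: "'a list"
  have "smooth_on (I \<times> (- {0})) (\<lambda>p. alt_sum (map (\<lambda>v. tproj (snd p) v) vs) (cov R (\<phi> (fst p)) (\<omega> (fst p)) (retr R (snd p))))"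
  proof (rule smooth_on_alternating[OF o, where w = "\<lambda>p v. tproj (snd p) v"])
    show "alternating (\<lambda>vs. alt_sum vs (cov R (\<phi> (fst p)) (\<omega> (fst p)) (retr R (snd p))))"
      if "p \<in> I \<times> (- {0})" for p
      using that R by (intro alternating_alt_sum alternating_cov linear_cov family_is_form[OF v f]) auto
    show "smooth_on (I \<times> (- {0})) (\<lambda>p. alt_sum vs (cov R (\<phi> (fst p)) (\<omega> (fst p)) (retr R (snd p))))" for vs
      unfolding alt_sum_eq by (intro smooth_on_sum smooth_on_scaleR smooth_on_const smooth_on_cov[OF v f] o)
    show "smooth_on (I \<times> (- {0})) (\<lambda>p. tproj (snd p) v)" for v :: 'a
      by (intro smooth_on_tproj smooth_on_snd smooth_on_const o) auto
  qed
  then show "smooth_on (I \<times> (- {0})) (\<lambda>p. hat R (extdiff R (\<phi> (fst p)) (\<omega> (fst p))) (snd p) vs)"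
    by (rule smooth_on_cong[OF o]) (use R in \<open>simp add: hat_extdiff mem_Times_iff\<close>)
qed

lemma family_codiff:
  fixes \<phi> :: "real \<Rightarrow> 'a::euclidean_space \<Rightarrow> 'b::euclidean_space"
  assumes v: "variation I R \<phi>" and f: "family I R \<phi> \<omega>"
  shows "family I R \<phi> (\<lambda>t. codiff R (\<phi> t) (\<omega> t))"
  unfolding family_def
proof (intro conjI ballI allI)
  note R = variationD(1)[OF v] and I = variationD(2)[OF v]
  have o: "open (I \<times> (- {0::'a}))" using I by simp
  show "pw_form R (\<phi> t) (codiff R (\<phi> t) (\<omega> t))" if "t \<in> I" for t
    using that by (intro pw_form_codiff R variationD(3)[OF v] family_is_form[OF v f])
  fix vs :: "'a list"
  have "smooth_on (I \<times> (- {0})) (\<lambda>p. - (\<Sum>b\<in>Basis. cov R (\<phi> (fst p)) (\<omega> (fst p)) (retr R (snd p)) b (b # map (\<lambda>v. tproj (snd p) v) vs)))"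
  proof (rule smooth_on_alternating[OF o, where w = "\<lambda>p v. tproj (snd p) v"])
    show "alternating (\<lambda>vs. - (\<Sum>b\<in>Basis. cov R (\<phi> (fst p)) (\<omega> (fst p)) (retr R (snd p)) b (b # vs)))"
      if "p \<in> I \<times> (- {0})" for p
      using that R by (intro alternating_neg alternating_sum alternating_Cons alternating_cov family_is_form[OF v f]) auto
    show "smooth_on (I \<times> (- {0})) (\<lambda>p. - (\<Sum>b\<in>Basis. cov R (\<phi> (fst p)) (\<omega> (fst p)) (retr R (snd p)) b (b # vs)))" for vs
      by (intro smooth_on_minus smooth_on_sum smooth_on_cov[OF v f] o)
    show "smooth_on (I \<times> (- {0})) (\<lambda>p. tproj (snd p) v)" for v :: 'a
      by (intro smooth_on_tproj smooth_on_snd smooth_on_const o) auto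
  qed
  then show "smooth_on (I \<times> (- {0})) (\<lambda>p. hat R (codiff R (\<phi> (fst p)) (\<omega> (fst p))) (snd p) vs)"
    by (rule smooth_on_cong[OF o]) (use R in \<open>simp add: hat_codiff mem_Times_iff\<close>)
qed

lemma smooth_on_ip:
  assumes "open U" "\<And>vs. smooth_on U (\<lambda>p. F p vs)" "\<And>vs. smooth_on U (\<lambda>p. G p vs)"
  shows "smooth_on U (\<lambda>p. ip (F p) (G p))"
  unfolding ip_def by (intro smooth_on_sum smooth_on_divide smooth_on_tuple_inner smooth_on_const assms) auto

lemma is_form_extdiff:
  assumes "variation UNIV R (\<lambda>_. \<phi>)" "is_form R \<phi> \<omega>"
  shows "is_form R \<phi> (extdiff R \<phi> \<omega>)"
  using family_is_form[OF assms(1) family_extdiff[OF assms(1) is_form_family[OF assms(2)]], of 0] by simp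

lemma is_form_codiff:
  assumes "variation UNIV R (\<lambda>_. \<phi>)" "is_form R \<phi> \<omega>"
  shows "is_form R \<phi> (codiff R \<phi> \<omega>)"
  using family_is_form[OF assms(1) family_codiff[OF assms(1) is_form_family[OF assms(2)]], of 0] by simp

lemma is_form_add:
  assumes "R > 0" "is_form R \<phi> \<omega>" "is_form R \<phi> \<eta>"
  shows "is_form R \<phi> (\<lambda>x vs. \<omega> x vs + \<eta> x vs)"
proof -
  have h: "hat R (\<lambda>x vs. \<omega> x vs + \<eta> x vs) = (\<lambda>y vs. hat R \<omega> y vs + hat R \<eta> y vs)"
    by (intro ext) (simp add: hat_def)
  show ?thesis
    using assms unfolding is_form_def pw_form_def h
    by (auto intro!: alternating_add smooth_on_add open_compl0 simp: inner_add_left)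
qed

lemma is_form_scaleR:
  assumes "is_form R \<phi> \<omega>"
  shows "is_form R \<phi> (\<lambda>x vs. c *\<^sub>R \<omega> x vs)"
proof -
  have h: "hat R (\<lambda>x vs. c *\<^sub>R \<omega> x vs) = (\<lambda>y vs. c *\<^sub>R hat R \<omega> y vs)"
    by (intro ext) (simp add: hat_def)
  show ?thesis
    using assms unfolding is_form_def pw_form_def h
    by (auto intro!: alternating_scaleR smooth_on_scaleR smooth_on_const open_compl0)
qed

lemma tuple_inner_tproj_left:
  assumes "\<And>vs. g vs \<bullet> p = 0"
  shows "tuple_inner B k (\<lambda>vs. tproj p (f vs)) g = tuple_inner B k f g"
  using assms by (intro tuple_inner_cong_inner) (simp add: tproj_inner_tangent)

text \<open>Pointwise, the difference of the integrands is the divergence of the tangent field with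
  components \<langle>\<sigma>, \<omega>(b, ...)\<rangle>. Its product rule yields d\<sigma> paired
  with \<omega>, and \<sigma> paired with the trace of the derivative of \<omega>.\<close>

lemma extdiff_codiff_adjoint:
  fixes \<phi> :: "'a::euclidean_space \<Rightarrow> 'b::euclidean_space"
  assumes v: "variation UNIV R (\<lambda>_. \<phi>)" and s: "is_form R \<phi> \<sigma>" and w: "is_form R \<phi> \<omega>"
  shows "sphere_int R (\<lambda>x. ip (hat R (extdiff R \<phi> \<sigma>) x) (hat R \<omega> x)) = sphere_int R (\<lambda>x. ip (hat R \<sigma> x) (hat R (codiff R \<phi> \<omega>) x))"
proof -
  note R = variationD(1)[OF v]
  let ?K = "DIM('a)"
  let ?X = "\<lambda>b y. \<Sum>k\<le>?K. tuple_inner Basis k (hat R \<sigma> y) (\<lambda>vs. hat R \<omega> y (b # vs)) / fact k"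
  let ?Ds = "\<lambda>x u vs. frechet_derivative (\<lambda>y. hat R \<sigma> y vs) (at x) u"
  let ?Dw = "\<lambda>x u vs. frechet_derivative (\<lambda>y. hat R \<omega> y vs) (at x) u"
  note es = is_form_extdiff[OF v s] and dw = is_form_codiff[OF v w]
  have div: "frechet_derivative (?X b) (at x) b = (\<Sum>k\<le>?K. (tuple_inner Basis k (?Ds x b) (\<lambda>vs. hat R \<omega> x (b # vs)) +
      tuple_inner Basis k (hat R \<sigma> x) (\<lambda>vs. ?Dw x b (b # vs))) / fact k)" if "x \<noteq> 0" for b x
  proof -
    have "((\<lambda>y. tuple_inner Basis k (hat R \<sigma> y) (\<lambda>vs. hat R \<omega> y (b # vs))) has_derivative
       (\<lambda>u. tuple_inner Basis k (?Ds x u) (\<lambda>vs. hat R \<omega> x (b # vs)) + tuple_inner Basis k (hat R \<sigma> x) (\<lambda>vs. ?Dw x u (b # vs)))) (at x)" for k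
      by (intro tuple_inner_has_derivative[where G = "\<lambda>y vs. hat R \<omega> y (b # vs)"] is_form_has_derivative[OF s that]
          is_form_has_derivative[OF w that])
    then have "(?X b has_derivative (\<lambda>u. \<Sum>k\<le>?K. (tuple_inner Basis k (?Ds x u) (\<lambda>vs. hat R \<omega> x (b # vs)) +
        tuple_inner Basis k (hat R \<sigma> x) (\<lambda>vs. ?Dw x u (b # vs))) / fact k)) (at x)"
      by (intro has_derivative_sum bounded_linear.has_derivative[OF bounded_linear_divide])
    from frechet_derivative_at[OF this, symmetric] show ?thesis by simp
  qed
  have key: "ip (hat R (extdiff R \<phi> \<sigma>) x) (hat R \<omega> x) - ip (hat R \<sigma> x) (hat R (codiff R \<phi> \<omega>) x)
      = (\<Sum>b\<in>Basis. frechet_derivative (?X b) (at x) b)" if x: "norm x = R" for x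
  proof -
    have x0: "x \<noteq> 0" using x R by auto
    have as: "alternating (hat R \<sigma> x)" and aw: "alternating (hat R \<omega> x)"
      using pw_form_alternating[OF R is_form_pw x0] s w by blast+
    have ns: "hat R \<sigma> x vs \<bullet> \<phi> x = 0" and nw: "hat R \<omega> x vs \<bullet> \<phi> x = 0" for vs
      using pw_form_inner[OF is_form_pw x] s w by blast+
    have ae: "alternating (hat R (extdiff R \<phi> \<sigma>) x)"
      using pw_form_alternating[OF R is_form_pw x0] es by blast
    let ?A = "\<lambda>u ws. cov R \<phi> \<sigma> x (tproj x u) (map (tproj x) ws)"
    have e: "hat R (extdiff R \<phi> \<sigma>) x = (\<lambda>vs. alt_sum vs ?A)"
      using R x x0 by (intro ext) (simp add: hat_extdiff retr_id alt_sum_map)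
    have d: "hat R (codiff R \<phi> \<omega>) x = (\<lambda>vs. - (\<Sum>b\<in>Basis. cov R \<phi> \<omega> x b (b # map (tproj x) vs)))"
      using R x x0 by (intro ext) (simp add: hat_codiff retr_id)
    \<comment> \<open>The projections of the arguments pass to \<omega>, where \<open>hat\<close>
      absorbs them; the projection of the value has no effect against \<omega>, which is tangent to
      the target.\<close>
    have t1: "tuple_inner Basis k (?A b) (\<lambda>vs. hat R \<omega> x (b # vs)) = tuple_inner Basis k (?Ds x b) (\<lambda>vs. hat R \<omega> x (b # vs))" for k b
    proof -
      have hh: "hat R \<omega> x (b # map (tproj x) vs) = hat R \<omega> x (b # vs)" for vs
        using hat_proj[OF x0, of R \<omega> "b # map (tproj x) vs"] hat_proj[OF x0, of R \<omega> "b # vs"] x0 by (simp add: o_def)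
      have "tuple_inner Basis k (?A b) (\<lambda>vs. hat R \<omega> x (b # vs)) =
         tuple_inner Basis k (cov R \<phi> \<sigma> x (tproj x b)) (\<lambda>vs. hat R \<omega> x (b # map (tproj x) vs))"
        by (rule tuple_inner_map_sym[OF linear_tproj tproj_sym alternating_cov[OF R s x0] alternating_Cons[OF aw], symmetric])
      also have "\<dots> = tuple_inner Basis k (cov R \<phi> \<sigma> x b) (\<lambda>vs. hat R \<omega> x (b # vs))"
        unfolding hh by (intro tuple_inner_cong_inner) (simp only: cov_tproj[OF s x0])
      also have "\<dots> = tuple_inner Basis k (?Ds x b) (\<lambda>vs. hat R \<omega> x (b # vs))"
        unfolding cov_def by (rule tuple_inner_tproj_left[OF nw])
      finally show ?thesis .
    qed
    have t2: "tuple_inner Basis k (hat R \<sigma> x) (\<lambda>vs. cov R \<phi> \<omega> x b (b # map (tproj x) vs)) =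
        tuple_inner Basis k (hat R \<sigma> x) (\<lambda>vs. ?Dw x b (b # vs))" for k b
    proof -
      have "tuple_inner Basis k (hat R \<sigma> x) (\<lambda>vs. cov R \<phi> \<omega> x b (b # map (tproj x) vs)) =
          tuple_inner Basis k (\<lambda>vs. hat R \<sigma> x (map (tproj x) vs)) (\<lambda>vs. cov R \<phi> \<omega> x b (b # vs))"
        by (rule tuple_inner_map_sym[OF linear_tproj tproj_sym as alternating_Cons[OF alternating_cov[OF R w x0]]])
      also have "\<dots> = tuple_inner Basis k (hat R \<sigma> x) (\<lambda>vs. cov R \<phi> \<omega> x b (b # vs))"
        by (simp add: hat_proj[OF x0])
      also have "\<dots> = tuple_inner Basis k (hat R \<sigma> x) (\<lambda>vs. ?Dw x b (b # vs))"
        unfolding cov_def by (subst (1 2) tuple_inner_sym, rule tuple_inner_tproj_left[OF ns])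
      finally show ?thesis .
    qed
    \<comment> \<open>One degree is added to the cut-off: the degree 0 term of
      \<open>alt_sum\<close> is zero, and the other degrees are shifted down to those up to
      \<open>?K\<close>.\<close>
    have "ip (hat R (extdiff R \<phi> \<sigma>) x) (hat R \<omega> x) = (\<Sum>k\<le>Suc ?K. tuple_inner Basis k (\<lambda>vs. alt_sum vs ?A) (hat R \<omega> x) / fact k)"
      using ip_eq[OF ae aw, of "Suc ?K"] by (simp add: e)
    also have "\<dots> = (\<Sum>k\<le>?K. tuple_inner Basis (Suc k) (\<lambda>vs. alt_sum vs ?A) (hat R \<omega> x) / fact (Suc k))"
      by (subst sum.atMost_Suc_shift) simp
    also have "\<dots> = (\<Sum>k\<le>?K. (\<Sum>b\<in>Basis. tuple_inner Basis k (?Ds x b) (\<lambda>vs. hat R \<omega> x (b # vs))) / fact k)"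
      by (intro sum.cong refl, subst tuple_inner_alt_sum[OF aw]) (simp del: of_nat_Suc add: fact_Suc t1)
    finally have 1: "ip (hat R (extdiff R \<phi> \<sigma>) x) (hat R \<omega> x) =
      (\<Sum>b\<in>Basis. \<Sum>k\<le>?K. tuple_inner Basis k (?Ds x b) (\<lambda>vs. hat R \<omega> x (b # vs)) / fact k)"
      by (subst sum.swap) (simp add: sum_divide_distrib)
    have "ip (hat R \<sigma> x) (hat R (codiff R \<phi> \<omega>) x) =
        - (\<Sum>k\<le>?K. (\<Sum>b\<in>Basis. tuple_inner Basis k (hat R \<sigma> x) (\<lambda>vs. ?Dw x b (b # vs))) / fact k)"
      unfolding d ip_def by (simp only: tuple_inner_minus_right tuple_inner_sum_right t2) (simp add: sum_negf)
    then have 2: "ip (hat R \<sigma> x) (hat R (codiff R \<phi> \<omega>) x) =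
        - (\<Sum>b\<in>Basis. \<Sum>k\<le>?K. tuple_inner Basis k (hat R \<sigma> x) (\<lambda>vs. ?Dw x b (b # vs)) / fact k)"
      by (subst sum.swap) (simp add: sum_divide_distrib)
    show ?thesis
      unfolding 1 2 div[OF x0] by (simp add: sum.distrib add_divide_distrib)
  qed
  have "sphere_int R (\<lambda>x. \<Sum>b\<in>Basis. frechet_derivative (?X b) (at x) b) = 0"
  proof (rule sphere_int_divergence[OF R])
    show "smooth_on (- {0}) (?X b)" for b
      by (intro smooth_on_sum smooth_on_divide smooth_on_const smooth_on_tuple_inner is_form_smooth[OF s] is_form_smooth[OF w] open_compl0) auto
    have "hat R \<sigma> (c *\<^sub>R y) = hat R \<sigma> y" "hat R \<omega> (c *\<^sub>R y) = hat R \<omega> y" if "c > 0" for c y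
      by (rule ext, rule hat_scale[OF that])+
    then show "?X b (c *\<^sub>R y) = ?X b y" if "c > 0" for b c y using that by simp
    fix x :: 'a assume x: "norm x = R"
    then have aw: "alternating (hat R \<omega> x)" using is_form_pw[OF w] by (simp add: pw_form_def)
    \<comment> \<open>Contraction with \<open>x\<close> puts the normal vector into the first slot
      of \<omega>; this makes the field tangent.\<close>
    have ex: "(\<Sum>b\<in>Basis. (x \<bullet> b) *\<^sub>R hat R \<omega> x (b # vs)) = 0" for vs
      using alternating_expand1[OF aw, of x vs] hat_normal[OF R x aw, of "[]" vs] by simp
    have "(\<Sum>b\<in>Basis. (x \<bullet> b) * ?X b x) =
       (\<Sum>k\<le>?K. tuple_inner Basis k (hat R \<sigma> x) (\<lambda>vs. \<Sum>b\<in>Basis. (x \<bullet> b) *\<^sub>R hat R \<omega> x (b # vs)) / fact k)"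
      unfolding tuple_inner_sum_right tuple_inner_scaleR_right sum_distrib_left sum_divide_distrib
      by (subst sum.swap) simp
    then show "(\<Sum>b\<in>Basis. (x \<bullet> b) * ?X b x) = 0" by (simp add: ex)
  qed
  moreover have "sphere_int R (\<lambda>x. ip (hat R (extdiff R \<phi> \<sigma>) x) (hat R \<omega> x) - ip (hat R \<sigma> x) (hat R (codiff R \<phi> \<omega>) x))
      = sphere_int R (\<lambda>x. \<Sum>b\<in>Basis. frechet_derivative (?X b) (at x) b)"
    by (rule sphere_int_cong) (rule key)
  ultimately have "sphere_int R (\<lambda>x. ip (hat R (extdiff R \<phi> \<sigma>) x) (hat R \<omega> x) - ip (hat R \<sigma> x) (hat R (codiff R \<phi> \<omega>) x)) = 0"
    by (rule trans[rotated])
  then show ?thesis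
    by (subst (asm) sphere_int_diff)
       (auto intro!: smooth_on_sphere_cont[OF R] smooth_on_ip open_compl0 is_form_smooth[OF s] is_form_smooth[OF w]
         is_form_smooth[OF es] is_form_smooth[OF dw])
qed

section \<open>Identification of the formal adjoint\<close>

lemma ip_nonneg: "ip f f \<ge> 0"
  by (auto simp: ip_def intro!: sum_nonneg divide_nonneg_pos tuple_inner_nonneg)

lemma ip_definite:
  fixes f :: "'a::euclidean_space list \<Rightarrow> 'b::real_inner"
  assumes "alternating f" "ip f f = 0"
  shows "f vs = 0"
proof -
  \<comment> \<open>The cut-off is raised so that the degree of \<open>vs\<close> is among the
    summands.\<close>
  have "(\<Sum>k\<le>DIM('a) + length vs. tuple_inner Basis k f f / fact k) = 0"
    using assms ip_eq[OF assms(1,1), of "DIM('a) + length vs"] by simp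
  then have "tuple_inner Basis (length vs) f f / fact (length vs) = 0"
    by (subst (asm) sum_nonneg_eq_0_iff) (auto intro: divide_nonneg_pos tuple_inner_nonneg)
  then show ?thesis using tuple_inner_definite[OF assms(1)] by simp
qed

lemma form_inner_integral:
  assumes R: "R > 0" and f: "pw_form R \<phi> \<omega>" "pw_form R \<phi> \<eta>"
  shows "(\<integral>x. form_inner (sphere 0 R) \<omega> \<eta> x \<partial>sphere_measure R) = sphere_int R (\<lambda>x. ip (hat R \<omega> x) (hat R \<eta> x))"
proof -
  have "(\<integral>x. form_inner (sphere 0 R) \<omega> \<eta> x \<partial>sphere_measure R) = sphere_int R (form_inner (sphere 0 R) \<omega> \<eta>)"
    using f R by (intro sphere_int_eq_integral form_inner_0[OF R]) (auto simp: pw_form_def tangent_at_def)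
  also have "\<dots> = sphere_int R (\<lambda>x. ip (hat R \<omega> x) (hat R \<eta> x))"
    using f by (intro sphere_int_cong form_inner_eq[OF R]) (auto simp: pw_form_def)
  finally show ?thesis .
qed

lemma ip_diff_right: "ip f (\<lambda>vs. g vs - h vs) = ip f g - ip f h"
  by (simp add: ip_def tuple_inner_diff_right diff_divide_distrib sum_subtractf)

text \<open>Integration by parts shows that \<open>codiff\<close> satisfies the description. For
  uniqueness, the difference \<delta> from another candidate is itself an admissible test form, so
  its squared norm integrates to zero.\<close>

lemma ext_d_adj_eq:
  fixes \<phi> :: "'a::euclidean_space \<Rightarrow> 'b::euclidean_space"
  assumes v: "variation UNIV R (\<lambda>_. \<phi>)" and w: "is_form R \<phi> \<omega>"
  shows "ext_d_adj (sphere 0 R) (sphere_measure R) (sphere 0 1) \<phi> \<omega> = codiff R \<phi> \<omega>"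
proof -
  note R = variationD(1)[OF v]
  have \<phi>: "\<And>x. norm x = R \<Longrightarrow> norm (\<phi> x) = 1" using variationD(3)[OF v] by blast
  note dw = is_form_codiff[OF v w]
  have F: "\<sigma> \<in> forms (sphere 0 R) (sphere 0 1) \<phi> \<longleftrightarrow> is_form R \<phi> \<sigma>" for \<sigma>
    by (rule forms_iff[OF R \<phi>])
  have L: "(\<integral>x. form_inner (sphere 0 R) (ext_d (sphere 0 R) (sphere 0 1) \<phi> \<sigma>) \<omega> x \<partial>sphere_measure R) =
      sphere_int R (\<lambda>x. ip (hat R \<sigma> x) (hat R (codiff R \<phi> \<omega>) x))" if "is_form R \<phi> \<sigma>" for \<sigma>
  proof -
    have "ext_d (sphere 0 R) (sphere 0 1) \<phi> \<sigma> = extdiff R \<phi> \<sigma>"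
      by (rule ext_d_eq[OF R _ that]) (rule \<phi>)
    then show ?thesis using form_inner_integral[OF R is_form_pw[OF is_form_extdiff[OF v that]] is_form_pw[OF w]]
      extdiff_codiff_adjoint[OF v that w] by simp
  qed
  show ?thesis
    unfolding ext_d_adj_def
  proof (rule the_equality, unfold F)
    show "is_form R \<phi> (codiff R \<phi> \<omega>) \<and> (\<forall>\<sigma>\<in>forms (sphere 0 R) (sphere 0 1) \<phi>.
      (\<integral>x. form_inner (sphere 0 R) (ext_d (sphere 0 R) (sphere 0 1) \<phi> \<sigma>) \<omega> x \<partial>sphere_measure R) =
      (\<integral>x. form_inner (sphere 0 R) \<sigma> (codiff R \<phi> \<omega>) x \<partial>sphere_measure R))"
      using dw L form_inner_integral[OF R is_form_pw is_form_pw[OF dw]] by (simp add: F)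
  next
    fix \<beta> assume b: "is_form R \<phi> \<beta> \<and> (\<forall>\<sigma>\<in>forms (sphere 0 R) (sphere 0 1) \<phi>.
      (\<integral>x. form_inner (sphere 0 R) (ext_d (sphere 0 R) (sphere 0 1) \<phi> \<sigma>) \<omega> x \<partial>sphere_measure R) =
      (\<integral>x. form_inner (sphere 0 R) \<sigma> \<beta> x \<partial>sphere_measure R))"
    then have fb: "is_form R \<phi> \<beta>" by blast
    define \<delta> where "\<delta> = (\<lambda>x vs. \<beta> x vs - codiff R \<phi> \<omega> x vs)"
    have fd: "is_form R \<phi> \<delta>"
      using is_form_add[OF R fb is_form_scaleR[OF dw, of "-1"]] by (simp add: \<delta>_def)
    have hd: "hat R \<delta> x = (\<lambda>vs. hat R \<beta> x vs - hat R (codiff R \<phi> \<omega>) x vs)" for x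
      by (intro ext) (simp add: hat_def \<delta>_def)
    have c: "continuous_on (sphere 0 R) (\<lambda>x. ip (hat R \<eta> x) (hat R \<zeta> x))"
      if "is_form R \<phi> \<eta>" "is_form R \<phi> \<zeta>" for \<eta> \<zeta>
      using that by (intro smooth_on_sphere_cont[OF R] smooth_on_ip open_compl0 is_form_smooth)
    have "sphere_int R (\<lambda>x. ip (hat R \<delta> x) (hat R \<beta> x)) = sphere_int R (\<lambda>x. ip (hat R \<delta> x) (hat R (codiff R \<phi> \<omega>) x))"
      using b fd L[OF fd] form_inner_integral[OF R is_form_pw[OF fd] is_form_pw[OF fb]] by (simp add: F)
    then have "sphere_int R (\<lambda>x. ip (hat R \<delta> x) (hat R \<beta> x) - ip (hat R \<delta> x) (hat R (codiff R \<phi> \<omega>) x)) = 0"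
      by (simp add: sphere_int_diff[OF c[OF fd fb] c[OF fd dw]])
    then have "sphere_int R (\<lambda>x. ip (hat R \<delta> x) (hat R \<delta> x)) = 0"
      by (simp only: ip_diff_right[symmetric] hd[symmetric])
    then have z: "ip (hat R \<delta> x) (hat R \<delta> x) = 0" if "norm x = R" for x
      using sphere_int_eq_0[OF R c[OF fd fd] ip_nonneg _ that] by simp
    show "\<beta> = codiff R \<phi> \<omega>"
    proof (intro ext)
      fix x vs
      show "\<beta> x vs = codiff R \<phi> \<omega> x vs"
      proof (cases "tangent_at R x vs")
        case True
        then have x: "norm x = R" by (simp add: tangent_at_def)
        then have "alternating (hat R \<delta> x)" using is_form_pw[OF fd] by (simp add: pw_form_def)
        then have "hat R \<delta> x vs = 0" using z[OF x] by (rule ip_definite)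
        then show ?thesis using hat_tangent[OF R True, of \<delta>] by (simp add: \<delta>_def)
      next
        case False
        then show ?thesis using is_form_pw[OF fb] is_form_pw[OF dw] by (simp add: pw_form_def)
      qed
    qed
  qed
qed


section \<open>Time derivatives along a variation\<close>

definition dirac :: "real \<Rightarrow> ('a::euclidean_space \<Rightarrow> 'b::euclidean_space) \<Rightarrow> ('a \<Rightarrow> 'a list \<Rightarrow> 'b) \<Rightarrow> 'a \<Rightarrow> 'a list \<Rightarrow> 'b" where
  "dirac R \<phi> \<omega> x vs = codiff R \<phi> \<omega> x vs + extdiff R \<phi> \<omega> x vs"

definition iter_form :: "real \<Rightarrow> ('a::euclidean_space \<Rightarrow> 'b::euclidean_space) \<Rightarrow> nat \<Rightarrow> 'a \<Rightarrow> 'a list \<Rightarrow> 'b" where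
  "iter_form R \<phi> j = (dirac R \<phi> ^^ j) (d_map (sphere 0 R) \<phi>)"

lemma iter_form_Suc: "iter_form R \<phi> (Suc j) = dirac R \<phi> (iter_form R \<phi> j)"
  by (simp add: iter_form_def)

lemma hat_dirac: "hat R (dirac R \<phi> \<omega>) y vs = hat R (codiff R \<phi> \<omega>) y vs + hat R (extdiff R \<phi> \<omega>) y vs"
  by (simp add: hat_def dirac_def)

lemma family_add:
  assumes "open I" "family I R \<phi> \<omega>" "family I R \<phi> \<eta>"
  shows "family I R \<phi> (\<lambda>t x vs. \<omega> t x vs + \<eta> t x vs)"
proof -
  have h: "hat R (\<lambda>x vs. \<omega> t x vs + \<eta> t x vs) = (\<lambda>y vs. hat R (\<omega> t) y vs + hat R (\<eta> t) y vs)" for t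
    by (intro ext) (simp add: hat_def)
  show ?thesis
    using assms unfolding family_def pw_form_def h
    by (auto intro!: alternating_add smooth_on_add simp: inner_add_left)
qed

lemma family_scaleR:
  assumes "open I" "family I R \<phi> \<omega>"
  shows "family I R \<phi> (\<lambda>t x vs. c *\<^sub>R \<omega> t x vs)"
proof -
  have h: "hat R (\<lambda>x vs. c *\<^sub>R \<omega> t x vs) = (\<lambda>y vs. c *\<^sub>R hat R (\<omega> t) y vs)" for t
    by (intro ext) (simp add: hat_def)
  show ?thesis
    using assms unfolding family_def pw_form_def h
    by (auto intro!: alternating_scaleR smooth_on_scaleR)
qed

lemma family_lincomb:
  assumes "open I" "family I R \<phi> \<omega>" "family I R \<phi> \<eta>"
  shows "family I R \<phi> (\<lambda>t x vs. \<omega> t x vs - c *\<^sub>R \<eta> t x vs)"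
  using family_add[OF assms(1,2) family_scaleR[OF assms(1,3), of "-c"]] by simp

lemma family_dirac:
  assumes "variation I R \<phi>" "family I R \<phi> \<omega>"
  shows "family I R \<phi> (\<lambda>t. dirac R (\<phi> t) (\<omega> t))"
  using family_add[OF variationD(2)[OF assms(1)] family_codiff[OF assms] family_extdiff[OF assms]]
  by (simp add: dirac_def[abs_def])

lemma is_form_dirac:
  assumes "variation UNIV R (\<lambda>_. \<phi>)" "is_form R \<phi> \<omega>"
  shows "is_form R \<phi> (dirac R \<phi> \<omega>)"
  using is_form_add[OF variationD(1)[OF assms(1)] is_form_codiff[OF assms] is_form_extdiff[OF assms]]
  by (simp add: dirac_def[abs_def])

lemma variation_deriv:
  assumes v: "variation I R \<phi>" and t: "t \<in> I" and y: "y \<noteq> 0"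
  shows "((\<lambda>p. \<phi> (fst p) (retr R (snd p))) has_derivative
      frechet_derivative (\<lambda>p. \<phi> (fst p) (retr R (snd p))) (at (t, y))) (at (t, y))"
  using t y by (intro smooth_on_has_derivative[OF variationD(4)[OF v]]) auto

lemma variation_radial:
  fixes \<phi> :: "real \<Rightarrow> 'a::euclidean_space \<Rightarrow> 'b::euclidean_space"
  assumes v: "variation I R \<phi>" and t: "t \<in> I" and x: "x \<noteq> 0"
  shows "frechet_derivative (\<lambda>p. \<phi> (fst p) (retr R (snd p))) (at (t, x)) (0, tproj x u) =
    frechet_derivative (\<lambda>p. \<phi> (fst p) (retr R (snd p))) (at (t, x)) (0, u)" (is "?D (0, tproj x u) = _")
proof -
  note d = variation_deriv[OF assms]
  note l = has_derivative_linear[OF d]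
  have "((\<lambda>y. \<phi> t (retr R y)) has_derivative (\<lambda>v. ?D (0, v))) (at x)"
    using has_derivative_slice_snd[OF d] by simp
  from homogeneous_radial_derivative[OF x this] have z: "?D (0, x) = 0" by (simp add: retr_scale)
  have "?D (0, tproj x u) = ?D ((0, u) - ((u \<bullet> x) / (x \<bullet> x)) *\<^sub>R (0, x))" by (simp add: tproj_def)
  also have "\<dots> = ?D (0, u)" unfolding linear_diff[OF l] linear_cmul[OF l] z by simp
  finally show ?thesis .
qed

text \<open>Differentiate the identity \<phi> \<bullet> \<phi> = 1.\<close>

lemma variation_normal:
  fixes \<phi> :: "real \<Rightarrow> 'a::euclidean_space \<Rightarrow> 'b::euclidean_space"
  assumes v: "variation I R \<phi>" and t: "t \<in> I" and x: "norm x = R"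
  shows "frechet_derivative (\<lambda>p. \<phi> (fst p) (retr R (snd p))) (at (t, x)) u \<bullet> \<phi> t x = 0"
proof -
  let ?G = "\<lambda>p. \<phi> (fst p) (retr R (snd p))"
  note R = variationD(1)[OF v]
  have x0: "x \<noteq> 0" using x R by auto
  note d = variation_deriv[OF v t x0]
  have o: "open (I \<times> - {0::'a})" using variationD(2)[OF v] by simp
  have "((\<lambda>p. ?G p \<bullet> ?G p) has_derivative (\<lambda>u. ?G (t, x) \<bullet> frechet_derivative ?G (at (t, x)) u +
      frechet_derivative ?G (at (t, x)) u \<bullet> ?G (t, x))) (at (t, x))"
    by (rule has_derivative_inner[OF d d])
  moreover have "((\<lambda>p. ?G p \<bullet> ?G p) has_derivative (\<lambda>u. 0)) (at (t, x))"
  proof (rule has_derivative_transform_within_open[OF has_derivative_const[of 1] o])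
    show "(t, x) \<in> I \<times> - {0}" using t x0 by auto
    fix p assume "p \<in> I \<times> (- {0::'a})"
    then have "fst p \<in> I" "snd p \<noteq> 0" by auto
    then have "norm (?G p) = 1" using R by (intro variationD(3)[OF v]) simp_all
    then show "1 = ?G p \<bullet> ?G p" by (simp add: dot_square_norm)
  qed
  ultimately have "(\<lambda>u. ?G (t, x) \<bullet> frechet_derivative ?G (at (t, x)) u +
      frechet_derivative ?G (at (t, x)) u \<bullet> ?G (t, x)) = (\<lambda>u. 0)"
    by (rule has_derivative_unique)
  from fun_cong[OF this, of u] show ?thesis using R x by (simp add: inner_commute retr_id)
qed

lemma hat_d_map:
  fixes \<phi> :: "real \<Rightarrow> 'a::euclidean_space \<Rightarrow> 'b::euclidean_space"
  assumes v: "variation I R \<phi>" and t: "t \<in> I" and y: "y \<noteq> 0"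
  shows "hat R (d_map (sphere 0 R) (\<phi> t)) y vs = (if length vs = 1 then
    frechet_derivative (\<lambda>p. \<phi> (fst p) (retr R (snd p))) (at (t, retr R y)) (0, tproj y (vs ! 0)) else 0)"
proof -
  note R = variationD(1)[OF v]
  have r: "retr R y \<in> sphere 0 R" using R y by simp
  have s: "set (map (tproj y) vs) \<subseteq> tangent_space (sphere 0 R) (retr R y)"
    using tangent_at_iff[OF R, of "retr R y" "map (tproj y) vs"] tangent_at_tproj[OF R y] by blast
  have "((\<lambda>z. \<phi> t (retr R z)) has_derivative
      (\<lambda>v. frechet_derivative (\<lambda>p. \<phi> (fst p) (retr R (snd p))) (at (t, retr R y)) (0, v))) (at (retr R y))"
    using has_derivative_slice_snd[OF variation_deriv[OF v t, of "retr R y"]] R y by simp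
  moreover have "tproj y u \<bullet> retr R y = 0" for u using R y tproj_inner(1)[of "retr R y" u] by simp
  ultimately have "differential (sphere 0 R) (\<phi> t) (retr R y) (tproj y u) =
     frechet_derivative (\<lambda>p. \<phi> (fst p) (retr R (snd p))) (at (t, retr R y)) (0, tproj y u)" for u
    using R y by (intro differential_sphere) auto
  then show ?thesis unfolding hat_def d_map_def using r s by simp
qed

lemma hat_d_map_sphere:
  fixes \<phi> :: "real \<Rightarrow> 'a::euclidean_space \<Rightarrow> 'b::euclidean_space"
  assumes v: "variation I R \<phi>" and t: "t \<in> I" and x: "norm x = R"
  shows "hat R (d_map (sphere 0 R) (\<phi> t)) x vs = (if length vs = 1 then
    frechet_derivative (\<lambda>p. \<phi> (fst p) (retr R (snd p))) (at (t, x)) (0, vs ! 0) else 0)"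
proof -
  have R: "R > 0" using variationD(1)[OF v] .
  have x0: "x \<noteq> 0" using R x by auto
  show ?thesis unfolding hat_d_map[OF v t x0] by (simp add: retr_id[OF R x] variation_radial[OF v t x0])
qed

lemma alternating_deg1:
  assumes "linear D" shows "alternating (\<lambda>vs. if length vs = 1 then D (vs ! 0) else 0)"
  unfolding alternating_def
proof (intro conjI allI)
  fix us ws
  show "linear (\<lambda>v. if length (us @ v # ws) = 1 then D ((us @ v # ws) ! 0) else 0)"
  proof (cases "us = [] \<and> ws = []")
    case True
    then show ?thesis using assms by simp
  next
    case False
    then show ?thesis by (auto simp: linear_iff)
  qed
qed auto

lemma family_d_map:
  fixes \<phi> :: "real \<Rightarrow> 'a::euclidean_space \<Rightarrow> 'b::euclidean_space"
  assumes v: "variation I R \<phi>"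
  shows "family I R \<phi> (\<lambda>t. d_map (sphere 0 R) (\<phi> t))"
  unfolding family_def
proof (intro conjI ballI allI)
  note R = variationD(1)[OF v] and I = variationD(2)[OF v]
  have o: "open (I \<times> (- {0::'a}))" using I by simp
  let ?G = "\<lambda>p. \<phi> (fst p) (retr R (snd p))"
  show "pw_form R (\<phi> t) (d_map (sphere 0 R) (\<phi> t))" if t: "t \<in> I" for t
    unfolding pw_form_def
  proof (intro conjI allI impI)
    show "d_map (sphere 0 R) (\<phi> t) x vs = 0" if "\<not> tangent_at R x vs" for x vs
      using that tangent_at_iff[OF R, of x vs] by (auto simp: d_map_def)
    fix x :: 'a assume x: "norm x = R"
    then have x0: "x \<noteq> 0" using R by auto
    have e: "hat R (d_map (sphere 0 R) (\<phi> t)) x =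
       (\<lambda>vs. if length vs = 1 then frechet_derivative ?G (at (t, x)) (0, vs ! 0) else 0)"
      by (rule ext) (rule hat_d_map_sphere[OF v t x])
    have "linear (\<lambda>v::'a. frechet_derivative ?G (at (t, x)) (0, v))"
      using has_derivative_linear[OF has_derivative_slice_snd[OF variation_deriv[OF v t x0]]] .
    then show "alternating (hat R (d_map (sphere 0 R) (\<phi> t)) x)"
      unfolding e by (rule alternating_deg1)
    show "hat R (d_map (sphere 0 R) (\<phi> t)) x vs \<bullet> \<phi> t x = 0" for vs
      unfolding e using variation_normal[OF v t x] by simp
  qed
  fix vs :: "'a list"
  show "smooth_on (I \<times> (- {0})) (\<lambda>p. hat R (d_map (sphere 0 R) (\<phi> (fst p))) (snd p) vs)"
  proof (cases "length vs = 1")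
    case True
    let ?D = "\<lambda>b p. frechet_derivative ?G (at (fst p, retr R (snd p))) (0, b)"
    have s1: "smooth_on (I \<times> (- {0})) (?D b)" for b
      using R by (intro smooth_on_compose[OF o o _ smooth_on_frechet_derivative[OF variationD(4)[OF v]], where f = "\<lambda>p. (fst p, retr R (snd p))"]
          smooth_on_Pair smooth_on_retr smooth_on_fst smooth_on_snd o) auto
    have s2: "smooth_on (I \<times> (- {0})) (\<lambda>p. \<Sum>b\<in>Basis. (tproj (snd p) (vs ! 0) \<bullet> b) *\<^sub>R ?D b p)"
      by (intro smooth_on_sum smooth_on_scaleR smooth_on_inner smooth_on_tproj smooth_on_snd smooth_on_const s1 o) auto
    show ?thesis
    proof (rule smooth_on_cong[OF o s2])
      fix p assume "p \<in> I \<times> (- {0::'a})"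
      then have p: "fst p \<in> I" "snd p \<noteq> 0" by auto
      then have r: "retr R (snd p) \<noteq> 0" using R by simp
      note l = has_derivative_linear[OF has_derivative_slice_snd[OF variation_deriv[OF v p(1) r]]]
      have "frechet_derivative ?G (at (fst p, retr R (snd p))) (0, tproj (snd p) (vs ! 0)) =
        frechet_derivative ?G (at (fst p, retr R (snd p))) (0, \<Sum>b\<in>Basis. (tproj (snd p) (vs ! 0) \<bullet> b) *\<^sub>R b)"
        by (simp only: euclidean_representation)
      also have "\<dots> = (\<Sum>b\<in>Basis. (tproj (snd p) (vs ! 0) \<bullet> b) *\<^sub>R ?D b p)"
        by (simp only: linear_sum[OF l] linear_cmul[OF l])
      finally show "(\<Sum>b\<in>Basis. (tproj (snd p) (vs ! 0) \<bullet> b) *\<^sub>R ?D b p) =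
          hat R (d_map (sphere 0 R) (\<phi> (fst p))) (snd p) vs"
        using hat_d_map[OF v p] True by simp
    qed
  next
    case False
    show ?thesis
      by (rule smooth_on_cong[OF o smooth_on_const[of _ 0]])
         (use hat_d_map[OF v] False in \<open>simp add: mem_Times_iff\<close>)
  qed
qed

lemma family_iter_form:
  assumes v: "variation I R \<phi>"
  shows "family I R \<phi> (\<lambda>t. iter_form R (\<phi> t) j)"
proof (induction j)
  case 0
  then show ?case using family_d_map[OF v] by (simp add: iter_form_def)
next
  case (Suc j)
  then show ?case using family_dirac[OF v Suc] by (simp add: iter_form_Suc)
qed

lemma is_form_iter_form:
  assumes "variation UNIV R (\<lambda>_. \<phi>)" shows "is_form R \<phi> (iter_form R \<phi> j)"
  using family_is_form[OF assms family_iter_form[OF assms], of 0] by simp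

text \<open>The operators are identified on forms only, so it matters that every iterate is a form.
  The index drops by one because \<open>d_map\<close> counts as the first application of
  \<open>d\<^sup>* + d\<close>.\<close>

lemma ES_form_eq:
  fixes \<phi> :: "'a::euclidean_space \<Rightarrow> 'b::euclidean_space"
  assumes v: "variation UNIV R (\<lambda>_. \<phi>)"
  shows "ES_form (Suc n) (sphere 0 R) (sphere_measure R) (sphere 0 1) \<phi> = iter_form R \<phi> n"
proof -
  note R = variationD(1)[OF v]
  have \<phi>: "\<And>x. norm x = R \<Longrightarrow> norm (\<phi> x) = 1" using variationD(3)[OF v] by blast
  let ?D = "\<lambda>\<omega> x vs. ext_d_adj (sphere 0 R) (sphere_measure R) (sphere 0 1) \<phi> \<omega> x vs +
      ext_d (sphere 0 R) (sphere 0 1) \<phi> \<omega> x vs"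
  have D: "?D \<omega> = dirac R \<phi> \<omega>" if w: "is_form R \<phi> \<omega>" for \<omega>
  proof -
    have "ext_d (sphere 0 R) (sphere 0 1) \<phi> \<omega> = extdiff R \<phi> \<omega>"
      by (rule ext_d_eq[OF R _ w]) (rule \<phi>)
    then show ?thesis using ext_d_adj_eq[OF v w] by (intro ext) (simp add: dirac_def)
  qed
  have "(?D ^^ n) (d_map (sphere 0 R) \<phi>) = iter_form R \<phi> n"
  proof (induction n)
    case 0
    then show ?case by (simp add: iter_form_def)
  next
    case (Suc n)
    show ?case using D[OF is_form_iter_form[OF v, of n]] by (simp add: Suc iter_form_Suc)
  qed
  then show ?thesis by (simp add: ES_form_def)
qed

lemma ES_energy_eq:
  fixes \<phi> :: "'a::euclidean_space \<Rightarrow> 'b::euclidean_space"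
  assumes v: "variation UNIV R (\<lambda>_. \<phi>)"
  shows "ES_energy (Suc n) (sphere 0 R) (sphere_measure R) (sphere 0 1) \<phi> =
    1/2 * sphere_int R (\<lambda>x. ip (hat R (iter_form R \<phi> n) x) (hat R (iter_form R \<phi> n) x))"
  unfolding ES_energy_def ES_form_eq[OF v]
  using form_inner_integral[OF variationD(1)[OF v] is_form_pw[OF is_form_iter_form[OF v]]
      is_form_pw[OF is_form_iter_form[OF v]], of n n] by simp

section \<open>Self-adjointness and its derivative in time\<close>

lemma ip_sym: "ip f g = ip g f"
  by (simp add: ip_def tuple_inner_sym[of _ _ f g])

lemma ip_add_left: "ip (\<lambda>vs. f vs + f' vs) g = ip f g + ip f' g"
  by (simp add: ip_def tuple_inner_add_left add_divide_distrib sum.distrib)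

lemma ip_add_right: "ip g (\<lambda>vs. f vs + f' vs) = ip g f + ip g f'"
  by (simp add: ip_sym[of g] ip_add_left)

lemma ip_scaleR_left: "ip (\<lambda>vs. c *\<^sub>R f vs) g = c * ip f g"
  by (simp add: ip_def tuple_inner_scaleR_left sum_distrib_left)

lemma ip_scaleR_right: "ip g (\<lambda>vs. c *\<^sub>R f vs) = c * ip g f"
  by (simp add: ip_sym[of g] ip_scaleR_left)

lemma ip_zero [simp]: "ip (\<lambda>vs. 0) g = 0" "ip g (\<lambda>vs. 0) = 0"
  by (simp_all add: ip_def)

lemma continuous_on_ip_forms:
  assumes "R > 0" "is_form R \<phi> \<omega>" "is_form R \<psi> \<eta>"
  shows "continuous_on (sphere 0 R) (\<lambda>x. ip (hat R \<omega> x) (hat R \<eta> x))"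
  using assms by (intro smooth_on_sphere_cont smooth_on_ip open_compl0 is_form_smooth)

text \<open>The two halves of \<open>dirac\<close> exchange roles: the same adjunction is used
  twice, the second time with the forms swapped.\<close>

lemma dirac_self_adjoint:
  assumes v: "variation UNIV R (\<lambda>_. \<phi>)" and s: "is_form R \<phi> \<sigma>" and w: "is_form R \<phi> \<omega>"
  shows "sphere_int R (\<lambda>x. ip (hat R (dirac R \<phi> \<sigma>) x) (hat R \<omega> x)) =
    sphere_int R (\<lambda>x. ip (hat R \<sigma> x) (hat R (dirac R \<phi> \<omega>) x))"
proof -
  note R = variationD(1)[OF v]
  have h: "hat R (dirac R \<phi> \<omega>) x = (\<lambda>vs. hat R (codiff R \<phi> \<omega>) x vs + hat R (extdiff R \<phi> \<omega>) x vs)" for \<omega> x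
    by (rule ext) (rule hat_dirac)
  note c = continuous_on_ip_forms[OF R]
  note d = is_form_codiff[OF v] and e = is_form_extdiff[OF v]
  have "sphere_int R (\<lambda>x. ip (hat R (codiff R \<phi> \<sigma>) x) (hat R \<omega> x)) = sphere_int R (\<lambda>x. ip (hat R \<sigma> x) (hat R (extdiff R \<phi> \<omega>) x))"
    using extdiff_codiff_adjoint[OF v w s] by (simp add: ip_sym[of "hat R \<omega> _"] ip_sym[of "hat R (extdiff R \<phi> \<omega>) _"])
  then show ?thesis
    using extdiff_codiff_adjoint[OF v s w]
    by (simp add: h ip_add_left ip_add_right sphere_int_add[OF c[OF d[OF s] w] c[OF e[OF s] w]]
        sphere_int_add[OF c[OF s d[OF w]] c[OF s e[OF w]]])
qed

text \<open>Unlike \<open>family\<close>, this does not tie the values to the tangent spaces along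
  \<phi>_t, and so admits the family that is constantly one form along \<phi>_0.\<close>

definition smooth_family :: "real set \<Rightarrow> real \<Rightarrow> (real \<Rightarrow> 'a::euclidean_space \<Rightarrow> 'a list \<Rightarrow> 'b::euclidean_space) \<Rightarrow> bool" where
  "smooth_family I R \<omega> \<longleftrightarrow> (\<forall>vs. smooth_on (I \<times> (- {0})) (\<lambda>p. hat R (\<omega> (fst p)) (snd p) vs))"

text \<open>The ordinary derivative of the values. For a form along \<phi>_t it differs from the
  covariant derivative in time by a component along \<phi>_0, which disappears in pairings with
  forms along \<phi>_0.\<close>

definition time_deriv :: "real \<Rightarrow> (real \<Rightarrow> 'a::euclidean_space \<Rightarrow> 'a list \<Rightarrow> 'b::euclidean_space) \<Rightarrow> 'a \<Rightarrow> 'a list \<Rightarrow> 'b" where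
  "time_deriv R \<omega> x vs = frechet_derivative (\<lambda>p. hat R (\<omega> (fst p)) (snd p) vs) (at (0, x)) (1, 0)"

text \<open>The pairing \<open>A(j,l)\<close> of the overview, for arbitrary families.\<close>

definition time_pairing :: "real \<Rightarrow> (real \<Rightarrow> 'a::euclidean_space \<Rightarrow> 'a list \<Rightarrow> 'b::euclidean_space) \<Rightarrow>
    (real \<Rightarrow> 'a \<Rightarrow> 'a list \<Rightarrow> 'b) \<Rightarrow> real" where
  "time_pairing R \<alpha> \<beta> = sphere_int R (\<lambda>x. ip (time_deriv R \<alpha> x) (hat R (\<beta> 0) x))"

lemma family_smooth_family: "family I R \<phi> \<omega> \<Longrightarrow> smooth_family I R \<omega>"
  by (simp add: family_def smooth_family_def)

lemma smooth_familyD: "smooth_family I R \<omega> \<Longrightarrow> smooth_on (I \<times> (- {0})) (\<lambda>p. hat R (\<omega> (fst p)) (snd p) vs)"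
  by (simp add: smooth_family_def)

lemma smooth_family_deriv:
  assumes "smooth_family I R \<omega>" "t \<in> I" "x \<noteq> 0"
  shows "((\<lambda>p. hat R (\<omega> (fst p)) (snd p) vs) has_derivative
    frechet_derivative (\<lambda>p. hat R (\<omega> (fst p)) (snd p) vs) (at (t, x))) (at (t, x))"
  using assms(2,3) by (intro smooth_on_has_derivative[OF smooth_familyD[OF assms(1)]]) auto

lemma time_deriv_vector_derivative:
  assumes "smooth_family I R \<omega>" "0 \<in> I" "x \<noteq> 0"
  shows "((\<lambda>t. hat R (\<omega> t) x vs) has_vector_derivative time_deriv R \<omega> x vs) (at 0)"
  using has_derivative_slice_fst[OF smooth_family_deriv[OF assms]] by (simp add: time_deriv_def)

lemma time_deriv_eqI:
  assumes "smooth_family I R \<omega>" "0 \<in> I" "x \<noteq> 0" "((\<lambda>t. hat R (\<omega> t) x vs) has_vector_derivative D) (at 0)"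
  shows "time_deriv R \<omega> x vs = D"
  using vector_derivative_unique_at[OF time_deriv_vector_derivative[OF assms(1-3)] assms(4)] .

lemma continuous_on_time_pairing:
  assumes R: "R > 0" and I: "open I" "0 \<in> I" and a: "smooth_family I R \<alpha>" and b: "smooth_family I R \<beta>"
  shows "continuous_on (sphere 0 R) (\<lambda>x. ip (time_deriv R \<alpha> x) (hat R (\<beta> 0) x))"
proof -
  have "smooth_on (- {0}) (\<lambda>x. time_deriv R \<alpha> x vs)" "smooth_on (- {0}) (\<lambda>x. hat R (\<beta> 0) x vs)" for vs
    using smooth_on_slice[OF smooth_on_frechet_derivative[OF smooth_familyD[OF a]] I(1) open_compl0 I(2)]
      smooth_on_slice[OF smooth_familyD[OF b] I(1) open_compl0 I(2)] by (auto simp: time_deriv_def)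
  then show ?thesis by (intro smooth_on_sphere_cont[OF R] smooth_on_ip open_compl0)
qed

lemma pairing_derivative:
  fixes \<alpha> \<beta> :: "real \<Rightarrow> 'a::euclidean_space \<Rightarrow> 'a list \<Rightarrow> 'b::euclidean_space"
  assumes R: "R > 0" and I: "open I" "0 \<in> I" and a: "smooth_family I R \<alpha>" and b: "smooth_family I R \<beta>"
  shows "((\<lambda>t. sphere_int R (\<lambda>x. ip (hat R (\<alpha> t) x) (hat R (\<beta> t) x))) has_real_derivative
    time_pairing R \<alpha> \<beta> + time_pairing R \<beta> \<alpha>) (at 0)"
proof -
  let ?F = "\<lambda>p. ip (hat R (\<alpha> (fst p)) (snd p)) (hat R (\<beta> (fst p)) (snd p))"
  have o: "open (I \<times> (- {0::'a}))" using I by simp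
  have sF: "smooth_on (I \<times> (- {0})) ?F"
    by (intro smooth_on_ip smooth_familyD[OF a] smooth_familyD[OF b] o)
  have "frechet_derivative ?F (at (0, x)) (1, 0) =
      ip (time_deriv R \<alpha> x) (hat R (\<beta> 0) x) + ip (time_deriv R \<beta> x) (hat R (\<alpha> 0) x)" if "norm x = R" for x
  proof -
    have x0: "x \<noteq> 0" using that R by auto
    let ?A = "\<lambda>h vs. frechet_derivative (\<lambda>p. hat R (\<alpha> (fst p)) (snd p) vs) (at (0, x)) h"
    let ?B = "\<lambda>h vs. frechet_derivative (\<lambda>p. hat R (\<beta> (fst p)) (snd p) vs) (at (0, x)) h"
    have td: "((\<lambda>p. tuple_inner Basis k (hat R (\<alpha> (fst p)) (snd p)) (hat R (\<beta> (fst p)) (snd p))) has_derivative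
       (\<lambda>h. tuple_inner Basis k (?A h) (hat R (\<beta> (fst (0, x))) (snd (0, x))) +
        tuple_inner Basis k (hat R (\<alpha> (fst (0, x))) (snd (0, x))) (?B h))) (at (0, x))" for k
      using tuple_inner_has_derivative[where F = "\<lambda>p. hat R (\<alpha> (fst p)) (snd p)" and G = "\<lambda>p. hat R (\<beta> (fst p)) (snd p)",
            OF smooth_family_deriv[OF a I(2) x0] smooth_family_deriv[OF b I(2) x0], of Basis k] by simp
    have "(?F has_derivative (\<lambda>h. \<Sum>k\<le>DIM('a). (tuple_inner Basis k (?A h) (hat R (\<beta> (fst (0, x))) (snd (0, x))) +
        tuple_inner Basis k (hat R (\<alpha> (fst (0, x))) (snd (0, x))) (?B h)) / fact k)) (at (0, x))"
      unfolding ip_def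
      by (intro has_derivative_sum bounded_linear.has_derivative[OF bounded_linear_divide] td)
    from frechet_derivative_at[OF this, symmetric] show ?thesis
      by (simp add: ip_def time_deriv_def[abs_def] sum.distrib add_divide_distrib tuple_inner_sym[of _ _ "hat R (\<alpha> 0) x"])
  qed
  then have "sphere_int R (\<lambda>x. frechet_derivative ?F (at (0, x)) (1, 0)) = time_pairing R \<alpha> \<beta> + time_pairing R \<beta> \<alpha>"
    unfolding time_pairing_def
    by (subst sphere_int_add[symmetric]) (auto intro!: sphere_int_cong continuous_on_time_pairing[OF R I] a b)
  then show ?thesis using sphere_int_has_derivative[OF R I(1,2) sF] by simp
qed

text \<open>The derivative at \<open>t = 0\<close> of the self-adjointness of \<open>dirac\<close>
  along \<phi>_t; for the iterates it rearranges to the symmetry of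
  \<open>A(j+1,l) - A(j,l+1)\<close>.\<close>

lemma time_pairing_dirac:
  assumes v: "variation I R \<phi>" and 0: "0 \<in> I" and a: "family I R \<phi> \<alpha>" and b: "family I R \<phi> \<beta>"
  shows "time_pairing R (\<lambda>t. dirac R (\<phi> t) (\<alpha> t)) \<beta> + time_pairing R \<beta> (\<lambda>t. dirac R (\<phi> t) (\<alpha> t)) =
    time_pairing R \<alpha> (\<lambda>t. dirac R (\<phi> t) (\<beta> t)) + time_pairing R (\<lambda>t. dirac R (\<phi> t) (\<beta> t)) \<alpha>"
proof -
  note R = variationD(1)[OF v] and I = variationD(2)[OF v]
  note fs = family_smooth_family
  have 1: "((\<lambda>t. sphere_int R (\<lambda>x. ip (hat R (dirac R (\<phi> t) (\<alpha> t)) x) (hat R (\<beta> t) x))) has_real_derivative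
      time_pairing R (\<lambda>t. dirac R (\<phi> t) (\<alpha> t)) \<beta> + time_pairing R \<beta> (\<lambda>t. dirac R (\<phi> t) (\<alpha> t))) (at 0)"
    by (rule pairing_derivative[OF R I 0 fs[OF family_dirac[OF v a]] fs[OF b]])
  have 2: "((\<lambda>t. sphere_int R (\<lambda>x. ip (hat R (\<alpha> t) x) (hat R (dirac R (\<phi> t) (\<beta> t)) x))) has_real_derivative
      time_pairing R \<alpha> (\<lambda>t. dirac R (\<phi> t) (\<beta> t)) + time_pairing R (\<lambda>t. dirac R (\<phi> t) (\<beta> t)) \<alpha>) (at 0)"
    by (rule pairing_derivative[OF R I 0 fs[OF a] fs[OF family_dirac[OF v b]]])
  have "((\<lambda>t. sphere_int R (\<lambda>x. ip (hat R (dirac R (\<phi> t) (\<alpha> t)) x) (hat R (\<beta> t) x))) has_real_derivative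
      time_pairing R \<alpha> (\<lambda>t. dirac R (\<phi> t) (\<beta> t)) + time_pairing R (\<lambda>t. dirac R (\<phi> t) (\<beta> t)) \<alpha>) (at 0)"
  proof (rule has_field_derivative_transform_within_open[OF 2 I 0])
    fix t assume t: "t \<in> I"
    show "sphere_int R (\<lambda>x. ip (hat R (\<alpha> t) x) (hat R (dirac R (\<phi> t) (\<beta> t)) x)) =
        sphere_int R (\<lambda>x. ip (hat R (dirac R (\<phi> t) (\<alpha> t)) x) (hat R (\<beta> t) x))"
      by (rule dirac_self_adjoint[OF variation_const[OF v t] family_is_form[OF v a t] family_is_form[OF v b t], symmetric])
  qed
  from DERIV_unique[OF 1 this] show ?thesis .
qed

lemma cov_zero: "cov R \<phi> (\<lambda>x vs. 0) x u vs = 0"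
  by (simp add: cov_def hat_def linear_0[OF linear_tproj])

lemma dirac_zero: "dirac R \<phi> (\<lambda>x vs. 0) = (\<lambda>x vs. 0)"
  by (intro ext) (simp add: dirac_def codiff_def extdiff_def cov_zero alt_sum_0 cov_zero[abs_def])

lemma time_pairing_zero: "\<beta> 0 = (\<lambda>x vs. 0) \<Longrightarrow> time_pairing R \<alpha> \<beta> = 0"
  by (simp add: time_pairing_def hat_def[abs_def])

text \<open>
  This replaces the computation of the derivative of the operator \<open>d\<^sup>* + d\<close> along the variation
  (a curvature term): where the family vanishes at \<open>t = 0\<close>, that derivative does not contribute.
\<close>

lemma time_pairing_dirac_vanishing:
  assumes v: "variation I R \<phi>" and 0: "0 \<in> I" and a: "family I R \<phi> \<alpha>" and b: "family I R \<phi> \<beta>"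
    and z: "\<alpha> 0 = (\<lambda>x vs. 0)"
  shows "time_pairing R (\<lambda>t. dirac R (\<phi> t) (\<alpha> t)) \<beta> = time_pairing R \<alpha> (\<lambda>t. dirac R (\<phi> t) (\<beta> t))"
  using time_pairing_dirac[OF v 0 a b] time_pairing_zero[of \<alpha> R "\<lambda>t. dirac R (\<phi> t) (\<beta> t)"] z
    time_pairing_zero[of "\<lambda>t. dirac R (\<phi> t) (\<alpha> t)" R \<beta>] by (simp add: dirac_zero)

lemma smooth_family_lincomb:
  assumes "open I" "smooth_family I R \<alpha>" "smooth_family I R \<beta>"
  shows "smooth_family I R (\<lambda>t x vs. \<alpha> t x vs - c *\<^sub>R \<beta> t x vs)"
proof -
  have "smooth_on (I \<times> (- {0})) (\<lambda>p. hat R (\<alpha> (fst p)) (snd p) vs - c *\<^sub>R hat R (\<beta> (fst p)) (snd p) vs)" for vs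
    using assms by (intro smooth_on_diff smooth_on_scaleR smooth_on_const smooth_familyD) auto
  then show ?thesis by (simp add: smooth_family_def hat_def)
qed

lemma time_pairing_lincomb_left:
  assumes R: "R > 0" and I: "open I" "0 \<in> I" and a: "smooth_family I R \<alpha>" and b: "smooth_family I R \<beta>"
    and g: "smooth_family I R \<gamma>"
  shows "time_pairing R (\<lambda>t x vs. \<alpha> t x vs - c *\<^sub>R \<beta> t x vs) \<gamma> = time_pairing R \<alpha> \<gamma> - c * time_pairing R \<beta> \<gamma>"
proof -
  have "time_deriv R (\<lambda>t x vs. \<alpha> t x vs - c *\<^sub>R \<beta> t x vs) x = (\<lambda>vs. time_deriv R \<alpha> x vs - c *\<^sub>R time_deriv R \<beta> x vs)"
    if "norm x = R" for x
  proof (rule ext, rule time_deriv_eqI[OF smooth_family_lincomb[OF I(1) a b] I(2)])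
    show x0: "x \<noteq> 0" using that R by auto
    fix vs
    have "((\<lambda>t. hat R (\<alpha> t) x vs - c *\<^sub>R hat R (\<beta> t) x vs) has_vector_derivative
        time_deriv R \<alpha> x vs - c *\<^sub>R time_deriv R \<beta> x vs) (at 0)"
      by (intro has_vector_derivative_diff bounded_linear.has_vector_derivative[OF bounded_linear_scaleR_right]
          time_deriv_vector_derivative[OF a I(2) x0] time_deriv_vector_derivative[OF b I(2) x0])
    then show "((\<lambda>t. hat R (\<lambda>x vs. \<alpha> t x vs - c *\<^sub>R \<beta> t x vs) x vs) has_vector_derivative
        time_deriv R \<alpha> x vs - c *\<^sub>R time_deriv R \<beta> x vs) (at 0)" by (simp add: hat_def)
  qed
  then have "time_pairing R (\<lambda>t x vs. \<alpha> t x vs - c *\<^sub>R \<beta> t x vs) \<gamma> =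
      sphere_int R (\<lambda>x. ip (time_deriv R \<alpha> x) (hat R (\<gamma> 0) x) - c * ip (time_deriv R \<beta> x) (hat R (\<gamma> 0) x))"
    unfolding time_pairing_def
    by (intro sphere_int_cong) (simp add: ip_sym[of _ "hat R (\<gamma> 0) _"] ip_diff_right ip_scaleR_right)
  also have "\<dots> = time_pairing R \<alpha> \<gamma> - c * time_pairing R \<beta> \<gamma>"
    unfolding time_pairing_def
    by (subst sphere_int_diff) (auto intro!: continuous_on_time_pairing[OF R I] continuous_on_mult_left a b g simp: sphere_int_cmult)
  finally show ?thesis .
qed

text \<open>Identities such as the linearity of \<open>dirac\<close> are available only for
  \<open>t \<in> I\<close>, where the families consist of forms; a derivative at 0 sees no more than
  that.\<close>

lemma time_pairing_cong_left:
  assumes R: "R > 0" and I: "open I" "0 \<in> I" and a: "smooth_family I R \<alpha>" and b: "smooth_family I R \<beta>"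
    and e: "\<And>t. t \<in> I \<Longrightarrow> \<alpha> t = \<beta> t"
  shows "time_pairing R \<alpha> \<gamma> = time_pairing R \<beta> \<gamma>"
proof -
  have "time_deriv R \<alpha> x vs = time_deriv R \<beta> x vs" if x: "norm x = R" for x vs
  proof (rule time_deriv_eqI[OF a I(2)])
    show x0: "x \<noteq> 0" using x R by auto
    show "((\<lambda>t. hat R (\<alpha> t) x vs) has_vector_derivative time_deriv R \<beta> x vs) (at 0)"
      by (rule has_vector_derivative_transform_within_open[OF time_deriv_vector_derivative[OF b I(2) x0] I]) (simp add: e)
  qed
  then show ?thesis unfolding time_pairing_def by (intro sphere_int_cong arg_cong2[where f = ip] ext refl)
qed

lemma cov_lincomb:
  assumes "is_form R \<phi> \<omega>" "is_form R \<phi> \<eta>" "x \<noteq> 0"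
  shows "cov R \<phi> (\<lambda>x vs. \<omega> x vs - c *\<^sub>R \<eta> x vs) x u vs = cov R \<phi> \<omega> x u vs - c *\<^sub>R cov R \<phi> \<eta> x u vs"
proof -
  have "((\<lambda>y. hat R \<omega> y vs - c *\<^sub>R hat R \<eta> y vs) has_derivative
     (\<lambda>u. frechet_derivative (\<lambda>y. hat R \<omega> y vs) (at x) u - c *\<^sub>R frechet_derivative (\<lambda>y. hat R \<eta> y vs) (at x) u)) (at x)"
    by (intro has_derivative_diff has_derivative_scaleR_right is_form_has_derivative[OF assms(1,3)]
        is_form_has_derivative[OF assms(2,3)])
  from frechet_derivative_at[OF this, symmetric] show ?thesis
    by (simp add: cov_def hat_def linear_diff[OF linear_tproj] linear_cmul[OF linear_tproj])
qed

lemma alt_sum_lincomb: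
  "alt_sum vs (\<lambda>u ws. A u ws - c *\<^sub>R B u ws) = alt_sum vs A - c *\<^sub>R alt_sum vs B"
  by (induction vs arbitrary: A B) (auto simp: algebra_simps)

lemma dirac_lincomb:
  assumes "R > 0" "is_form R \<phi> \<omega>" "is_form R \<phi> \<eta>"
  shows "dirac R \<phi> (\<lambda>x vs. \<omega> x vs - c *\<^sub>R \<eta> x vs) = (\<lambda>x vs. dirac R \<phi> \<omega> x vs - c *\<^sub>R dirac R \<phi> \<eta> x vs)"
proof (intro ext)
  fix x vs
  show "dirac R \<phi> (\<lambda>x vs. \<omega> x vs - c *\<^sub>R \<eta> x vs) x vs = dirac R \<phi> \<omega> x vs - c *\<^sub>R dirac R \<phi> \<eta> x vs"
  proof (cases "tangent_at R x vs")
    case True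
    then have x0: "x \<noteq> 0" using assms(1) by (auto simp: tangent_at_def)
    have "cov R \<phi> (\<lambda>x vs. \<omega> x vs - c *\<^sub>R \<eta> x vs) x = (\<lambda>u ws. cov R \<phi> \<omega> x u ws - c *\<^sub>R cov R \<phi> \<eta> x u ws)"
      by (intro ext) (rule cov_lincomb[OF assms(2,3) x0])
    then show ?thesis using True
      by (simp add: dirac_def codiff_def extdiff_def alt_sum_lincomb sum_subtractf algebra_simps flip: scaleR_sum_right)
  qed (simp add: dirac_def codiff_def extdiff_def)
qed

text \<open>Walk along the antidiagonal from \<open>A 0 (2 * n)\<close> to \<open>A n n\<close>.
  Each of the \<open>n\<close> steps adds some \<open>\<delta> j l\<close> with
  \<open>j + l = 2 * n - 1\<close>. Exactly one index is then odd, and the shift together with the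
  symmetry brings every such term to \<open>\<kappa> ^ (n - 1) * \<delta> 1 0\<close>.\<close>

lemma recursion_closed_form:
  fixes A :: "nat \<Rightarrow> nat \<Rightarrow> real"
  defines "\<delta> \<equiv> \<lambda>j l. A (Suc j) l - A j (Suc l)"
  assumes sym: "\<And>j l. \<delta> j l = \<delta> l j" and shift: "\<And>j l. \<delta> (j + 2) l = \<kappa> * \<delta> j l"
    and per: "\<And>j l. A j (l + 2) = \<kappa> * A j l" and n: "n \<ge> 1"
  shows "A n n = \<kappa> ^ n * A 0 0 + real n * \<kappa> ^ (n - 1) * \<delta> 1 0"
proof -
  have s1: "\<delta> (2 * p + j) l = \<kappa> ^ p * \<delta> j l" for p j l
    by (induction p) (use shift in \<open>simp_all add: algebra_simps\<close>)
  have s2: "\<delta> (2 * p + 1) (2 * q) = \<kappa> ^ (p + q) * \<delta> 1 0" for p q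
  proof -
    have "\<delta> (2 * p + 1) (2 * q) = \<kappa> ^ p * \<delta> (2 * q + 0) 1" using s1[of p 1 "2 * q"] sym[of 1 "2 * q"] by simp
    also have "\<dots> = \<kappa> ^ p * (\<kappa> ^ q * \<delta> 1 0)" unfolding s1 using sym[of 0 1] by simp
    finally show ?thesis by (simp add: power_add)
  qed
  have odd: "\<delta> j l = \<kappa> ^ (n - 1) * \<delta> 1 0" if "Suc (j + l) = 2 * n" for j l
  proof (cases "even j")
    case False
    then obtain p where p: "j = 2 * p + 1" by (elim oddE)
    then have "even l" using that by presburger
    then obtain q where q: "l = 2 * q" by (elim evenE)
    have "p + q = n - 1" using that p q by simp
    then show ?thesis using s2[of p q] p q by simp
  next
    case True
    then obtain q where q: "j = 2 * q" by (elim evenE)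
    then have "odd l" using that by presburger
    then obtain p where p: "l = 2 * p + 1" by (elim oddE)
    have "p + q = n - 1" using that p q by simp
    then show ?thesis using s2[of p q] sym[of j l] p q by simp
  qed
  have "A k (2 * n - k) = A 0 (2 * n) + real k * (\<kappa> ^ (n - 1) * \<delta> 1 0)" if "k \<le> 2 * n" for k
    using that
  proof (induction k)
    case (Suc k)
    have e: "2 * n - k = Suc (2 * n - Suc k)" using Suc.prems by simp
    have "A (Suc k) (2 * n - Suc k) = A k (2 * n - k) + \<delta> k (2 * n - Suc k)"
      unfolding \<delta>_def e by simp
    also have "\<delta> k (2 * n - Suc k) = \<kappa> ^ (n - 1) * \<delta> 1 0" using Suc.prems by (intro odd) simp
    finally show ?case using Suc by (simp add: algebra_simps)
  qed simp
  from this[of n] have "A n n = A 0 (2 * n) + real n * (\<kappa> ^ (n - 1) * \<delta> 1 0)" by (simp add: mult_2)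
  moreover have "A 0 (2 * n) = \<kappa> ^ n * A 0 0" for n
    by (induction n) (use per in \<open>simp_all add: algebra_simps\<close>)
  ultimately show ?thesis by simp
qed

text \<open>At \<open>t = 0\<close> the iterates repeat with period 2 up to the factor \<kappa>, so
  the iterate of index \<open>j + 2\<close> less \<kappa> times that of index \<open>j\<close>
  vanishes there. \<open>time_pairing_dirac_vanishing\<close> for these families gives the shift
  property of the differences.\<close>

lemma energy_derivative:
  assumes v: "variation I R \<phi>" and 0: "0 \<in> I" and n: "n \<ge> 1"
    and per: "iter_form R (\<phi> 0) 2 = (\<lambda>x vs. \<kappa> *\<^sub>R iter_form R (\<phi> 0) 0 x vs)"
  defines "A \<equiv> \<lambda>j l. time_pairing R (\<lambda>t. iter_form R (\<phi> t) j) (\<lambda>t. iter_form R (\<phi> t) l)"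
  shows "((\<lambda>t. 1/2 * sphere_int R (\<lambda>x. ip (hat R (iter_form R (\<phi> t) n) x) (hat R (iter_form R (\<phi> t) n) x)))
    has_real_derivative \<kappa> ^ n * A 0 0 + real n * \<kappa> ^ (n - 1) * (A 2 0 - A 1 1)) (at 0)"
proof -
  note R = variationD(1)[OF v] and I = variationD(2)[OF v]
  note W = family_iter_form[OF v]
  note sW = family_smooth_family[OF W]
  have per': "iter_form R (\<phi> 0) (j + 2) = (\<lambda>x vs. \<kappa> *\<^sub>R iter_form R (\<phi> 0) j x vs)" for j
  proof (induction j)
    case 0 show ?case using per by (simp add: numeral_2_eq_2)
  next
    case (Suc j)
    note f = family_is_form[OF v W 0]
    have "iter_form R (\<phi> 0) (Suc j + 2) = dirac R (\<phi> 0) (\<lambda>x vs. \<kappa> *\<^sub>R iter_form R (\<phi> 0) j x vs)"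
      using Suc by (simp add: iter_form_Suc)
    \<comment> \<open>The scalar multiple is put into the shape required by
      \<open>dirac_lincomb\<close>.\<close>
    also have "\<dots> = dirac R (\<phi> 0) (\<lambda>x vs. 0 *\<^sub>R iter_form R (\<phi> 0) j x vs - (- \<kappa>) *\<^sub>R iter_form R (\<phi> 0) j x vs)"
      by simp
    also have "\<dots> = (\<lambda>x vs. dirac R (\<phi> 0) (\<lambda>x vs. 0 *\<^sub>R iter_form R (\<phi> 0) j x vs) x vs
        - (- \<kappa>) *\<^sub>R dirac R (\<phi> 0) (iter_form R (\<phi> 0) j) x vs)"
      by (rule dirac_lincomb[OF R is_form_scaleR[OF f] f])
    also have "\<dots> = (\<lambda>x vs. \<kappa> *\<^sub>R iter_form R (\<phi> 0) (Suc j) x vs)"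
      by (simp add: dirac_zero iter_form_Suc)
    finally show ?case .
  qed
  have "A n n = \<kappa> ^ n * A 0 0 + real n * \<kappa> ^ (n - 1) * (A (Suc 1) 0 - A 1 (Suc 0))"
  proof (rule recursion_closed_form[OF _ _ _ n])
    show "A (Suc j) l - A j (Suc l) = A (Suc l) j - A l (Suc j)" for j l
      using time_pairing_dirac[OF v 0 W[of j] W[of l]] by (simp add: A_def iter_form_Suc)
    show "A j (l + 2) = \<kappa> * A j l" for j l
      unfolding A_def time_pairing_def per'
      by (simp add: hat_def[abs_def] ip_scaleR_right sphere_int_cmult)
    fix j l
    let ?\<alpha> = "\<lambda>t x vs. iter_form R (\<phi> t) (j + 2) x vs - \<kappa> *\<^sub>R iter_form R (\<phi> t) j x vs"
    have fa: "family I R \<phi> ?\<alpha>" by (rule family_lincomb[OF I W W])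
    have "time_pairing R (\<lambda>t. dirac R (\<phi> t) (?\<alpha> t)) (\<lambda>t. iter_form R (\<phi> t) l) =
        time_pairing R ?\<alpha> (\<lambda>t. dirac R (\<phi> t) (iter_form R (\<phi> t) l))"
      by (rule time_pairing_dirac_vanishing[OF v 0 fa W]) (simp only: per' diff_self)
    also have "\<dots> = A (j + 2) (Suc l) - \<kappa> * A j (Suc l)"
      using time_pairing_lincomb_left[OF R I 0 sW[of "j + 2"] sW[of j] sW[of "Suc l"], of \<kappa>]
      by (simp add: A_def iter_form_Suc)
    finally have 1: "time_pairing R (\<lambda>t. dirac R (\<phi> t) (?\<alpha> t)) (\<lambda>t. iter_form R (\<phi> t) l) = \<dots>" .
    \<comment> \<open>The same quantity with \<open>dirac\<close> distributed over the difference;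
      comparing the two values gives the shift property.\<close>
    have "time_pairing R (\<lambda>t. dirac R (\<phi> t) (?\<alpha> t)) (\<lambda>t. iter_form R (\<phi> t) l) =
       time_pairing R (\<lambda>t x vs. iter_form R (\<phi> t) (Suc (j + 2)) x vs - \<kappa> *\<^sub>R iter_form R (\<phi> t) (Suc j) x vs)
          (\<lambda>t. iter_form R (\<phi> t) l)"
    proof -
      have d: "dirac R (\<phi> t) (?\<alpha> t) = (\<lambda>x vs. iter_form R (\<phi> t) (Suc (j + 2)) x vs - \<kappa> *\<^sub>R iter_form R (\<phi> t) (Suc j) x vs)"
        if t: "t \<in> I" for t
        using dirac_lincomb[OF R family_is_form[OF v W t, of "j + 2"] family_is_form[OF v W t, of j], of \<kappa>]
        by (simp add: iter_form_Suc)
      then show ?thesis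
        by (intro time_pairing_cong_left[OF R I 0 family_smooth_family[OF family_dirac[OF v fa]]
            family_smooth_family[OF family_lincomb[OF I W W]]])
    qed
    also have "\<dots> = A (Suc (j + 2)) l - \<kappa> * A (Suc j) l"
      using time_pairing_lincomb_left[OF R I 0 sW sW sW] by (simp add: A_def)
    finally show "A (Suc (j + 2)) l - A (j + 2) (Suc l) = \<kappa> * (A (Suc j) l - A j (Suc l))"
      using 1 by (simp add: algebra_simps)
  qed
  moreover have "((\<lambda>t. sphere_int R (\<lambda>x. ip (hat R (iter_form R (\<phi> t) n) x) (hat R (iter_form R (\<phi> t) n) x)))
      has_real_derivative A n n + A n n) (at 0)"
    unfolding A_def by (rule pairing_derivative[OF R I 0 sW sW])
  from DERIV_cmult[OF this, of "1/2"] have "((\<lambda>t. 1/2 * sphere_int R (\<lambda>x. ip (hat R (iter_form R (\<phi> t) n) x) (hat R (iter_form R (\<phi> t) n) x)))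
      has_real_derivative A n n) (at 0)" by simp
  ultimately show ?thesis by (simp add: numeral_2_eq_2)
qed


section \<open>Variations of the small hypersphere\<close>

lemma tuple_inner_length_0: "(\<And>vs. length vs = n \<Longrightarrow> f vs \<bullet> g vs = 0) \<Longrightarrow> tuple_inner B n f g = 0"
proof (induction n arbitrary: f g)
  case (Suc n)
  show ?case unfolding tuple_inner.simps by (intro sum.neutral ballI Suc.IH Suc.prems) simp
qed simp

lemma ip_deg0:
  fixes f g :: "'a::euclidean_space list \<Rightarrow> 'b::real_inner"
  assumes "\<And>vs. vs \<noteq> [] \<Longrightarrow> f vs \<bullet> g vs = 0"
  shows "ip f g = f [] \<bullet> g []"
proof -
  have "ip f g = (\<Sum>k\<in>{0}. tuple_inner Basis k f g / fact k)"
    unfolding ip_def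
  proof (rule sum.mono_neutral_right)
    show "\<forall>k\<in>{..DIM('a)} - {0}. tuple_inner Basis k f g / fact k = 0"
      using assms by (auto intro!: tuple_inner_length_0)
  qed auto
  then show ?thesis by simp
qed

lemma ip_deg1:
  fixes f g :: "'a::euclidean_space list \<Rightarrow> 'b::real_inner"
  assumes "\<And>vs. length vs \<noteq> 1 \<Longrightarrow> f vs \<bullet> g vs = 0"
  shows "ip f g = (\<Sum>b\<in>Basis. f [b] \<bullet> g [b])"
proof -
  have "ip f g = (\<Sum>k\<in>{1}. tuple_inner Basis k f g / fact k)"
    unfolding ip_def
  proof (rule sum.mono_neutral_right)
    show "\<forall>k\<in>{..DIM('a)} - {1}. tuple_inner Basis k f g / fact k = 0"
      using assms by (auto intro!: tuple_inner_length_0)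
    show "{1} \<subseteq> {..DIM('a)}" using DIM_positive[where 'a = 'a] by (auto simp: Suc_le_eq)
  qed auto
  then show ?thesis by simp
qed

lemma is_form_eqI:
  assumes "R > 0" "is_form R \<phi> \<omega>" "is_form R \<psi> \<eta>" "\<And>x vs. norm x = R \<Longrightarrow> hat R \<omega> x vs = hat R \<eta> x vs"
  shows "\<omega> = \<eta>"
proof (intro ext)
  fix x vs
  show "\<omega> x vs = \<eta> x vs"
  proof (cases "tangent_at R x vs")
    case True
    then show ?thesis using assms(4)[of x vs] hat_tangent[OF assms(1) True] by (metis tangent_at_def)
  next
    case False
    then show ?thesis using assms(2,3) by (simp add: is_form_def pw_form_def)
  qed
qed

text \<open>Stated for arbitrary \<open>v\<close>, because it is traced over a basis of the ambient
  space.\<close>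

lemma tproj_has_derivative:
  assumes "x \<noteq> 0"
  shows "((\<lambda>y. tproj y v) has_derivative (\<lambda>u. - (((v \<bullet> u) / (x \<bullet> x) - (v \<bullet> x) * (2 * (x \<bullet> u)) / (x \<bullet> x)\<^sup>2) *\<^sub>R x
      + ((v \<bullet> x) / (x \<bullet> x)) *\<^sub>R u))) (at x)"
  unfolding tproj_def[abs_def] using assms
  by (auto intro!: derivative_eq_intros simp: inner_commute divide_simps power2_eq_square algebra_simps)

text \<open>The trace of the derivatives of the projections is the mean curvature vector of the
  sphere through \<open>x\<close>.\<close>

lemma sum_tproj_derivative:
  fixes x :: "'a::euclidean_space"
  assumes "x \<noteq> 0"
  shows "(\<Sum>b\<in>Basis. - (((b \<bullet> b) / (x \<bullet> x) - (b \<bullet> x) * (2 * (x \<bullet> b)) / (x \<bullet> x)\<^sup>2) *\<^sub>R x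
      + ((b \<bullet> x) / (x \<bullet> x)) *\<^sub>R b)) = - ((real DIM('a) - 1) / (x \<bullet> x)) *\<^sub>R x"
proof -
  have 1: "(\<Sum>b\<in>Basis. (b \<bullet> x) * (2 * (x \<bullet> b)) / (x \<bullet> x)\<^sup>2) = 2 / (x \<bullet> x)"
  proof -
    have "(\<Sum>b\<in>Basis. (b \<bullet> x) * (2 * (x \<bullet> b)) / (x \<bullet> x)\<^sup>2) = (\<Sum>b\<in>Basis. (x \<bullet> b) * (x \<bullet> b)) * (2 / (x \<bullet> x)\<^sup>2)"
      unfolding sum_distrib_right by (intro sum.cong refl) (simp add: inner_commute)
    also have "\<dots> = 2 / (x \<bullet> x)" using assms by (simp add: power2_eq_square flip: euclidean_inner)
    finally show ?thesis .
  qed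
  have 2: "(\<Sum>b\<in>Basis. ((b \<bullet> x) / (x \<bullet> x)) *\<^sub>R b) = (1 / (x \<bullet> x)) *\<^sub>R x"
  proof -
    have "(\<Sum>b\<in>Basis. ((b \<bullet> x) / (x \<bullet> x)) *\<^sub>R b) = (1 / (x \<bullet> x)) *\<^sub>R (\<Sum>b\<in>Basis. (x \<bullet> b) *\<^sub>R b)"
      by (simp add: scaleR_sum_right inner_commute)
    then show ?thesis by (simp add: euclidean_representation)
  qed
  have "(\<Sum>b\<in>Basis. - (((b \<bullet> b) / (x \<bullet> x) - (b \<bullet> x) * (2 * (x \<bullet> b)) / (x \<bullet> x)\<^sup>2) *\<^sub>R x
      + ((b \<bullet> x) / (x \<bullet> x)) *\<^sub>R b)) =
    - ((\<Sum>b\<in>Basis. (b \<bullet> b) / (x \<bullet> x) - (b \<bullet> x) * (2 * (x \<bullet> b)) / (x \<bullet> x)\<^sup>2) *\<^sub>R x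
        + (\<Sum>b\<in>(Basis::'a set). ((b \<bullet> x) / (x \<bullet> x)) *\<^sub>R b))"
    by (simp only: sum_negf sum.distrib scaleR_sum_left)
  also have "\<dots> = - ((real DIM('a) / (x \<bullet> x) - 2 / (x \<bullet> x)) *\<^sub>R x + (1 / (x \<bullet> x)) *\<^sub>R x)"
    unfolding 2 sum_subtractf 1 by (simp add: inner_same_Basis)
  also have "\<dots> = - ((real DIM('a) - 1) / (x \<bullet> x)) *\<^sub>R x"
    by (simp add: diff_divide_distrib algebra_simps flip: scaleR_add_left)
  finally show ?thesis .
qed

text \<open>The trace of the projection onto a hyperplane, which is the dimension of the tangent
  space.\<close>

lemma sum_tproj_norm:
  fixes x :: "'a::euclidean_space"
  assumes "x \<noteq> 0"
  shows "(\<Sum>b\<in>Basis. tproj x b \<bullet> tproj x b) = real DIM('a) - 1"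
proof -
  have "tproj x b \<bullet> tproj x b = 1 - (x \<bullet> b) * (x \<bullet> b) / (x \<bullet> x)" if "b \<in> Basis" for b
  proof -
    have "tproj x b \<bullet> tproj x b = b \<bullet> tproj x b" using assms by (subst tproj_inner_tangent(1)) simp_all
    then show ?thesis using that by (simp add: tproj_def inner_diff_right inner_commute[of b x] inner_same_Basis)
  qed
  then have "(\<Sum>b\<in>Basis. tproj x b \<bullet> tproj x b) = real DIM('a) - (\<Sum>b\<in>Basis. (x \<bullet> b) * (x \<bullet> b)) / (x \<bullet> x)"
    by (simp add: sum_subtractf sum_divide_distrib)
  then show ?thesis using assms by (simp flip: euclidean_inner)
qed

lemma has_vector_derivative_chain:
  assumes "(f has_vector_derivative w) (at t)" "(g has_derivative D) (at (f t))"
  shows "((\<lambda>t. g (f t)) has_vector_derivative D w) (at t)"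
  unfolding has_vector_derivative_def
  by (rule has_derivative_eq_rhs[OF has_derivative_compose[OF assms(1)[unfolded has_vector_derivative_def] assms(2)] ext])
     (rule linear_cmul[OF has_derivative_linear[OF assms(2)]])

text \<open>A section as a form of degree 0; the value 0 off the sphere is the normalisation
  demanded by \<open>forms\<close>.\<close>

definition section_form :: "real \<Rightarrow> ('a::euclidean_space \<Rightarrow> 'b::euclidean_space) \<Rightarrow> 'a \<Rightarrow> 'a list \<Rightarrow> 'b" where
  "section_form R \<sigma> x vs = (if norm x = R \<and> vs = [] then \<sigma> x else 0)"

lemma hat_section_form: "R > 0 \<Longrightarrow> y \<noteq> 0 \<Longrightarrow> hat R (section_form R \<sigma>) y vs = (if vs = [] then \<sigma> (retr R y) else 0)"
  by (simp add: hat_def section_form_def)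

lemma family_section_form:
  fixes \<phi> \<sigma> :: "real \<Rightarrow> 'a::euclidean_space \<Rightarrow> 'b::euclidean_space"
  assumes R: "R > 0" and I: "open I" and s: "smooth_on (I \<times> (- {0})) (\<lambda>p. \<sigma> (fst p) (retr R (snd p)))"
    and t: "\<And>t x. t \<in> I \<Longrightarrow> norm x = R \<Longrightarrow> \<sigma> t x \<bullet> \<phi> t x = 0"
  shows "family I R \<phi> (\<lambda>t. section_form R (\<sigma> t))"
  unfolding family_def
proof (intro conjI ballI allI)
  have o: "open (I \<times> (- {0::'a}))" using I by simp
  show "pw_form R (\<phi> t) (section_form R (\<sigma> t))" if "t \<in> I" for t
    unfolding pw_form_def
  proof (intro conjI allI impI)
    show "section_form R (\<sigma> t) x vs = 0" if "\<not> tangent_at R x vs" for x vs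
      using that by (auto simp: section_form_def tangent_at_def)
    fix x :: 'a assume x: "norm x = R"
    then have x0: "x \<noteq> 0" using R by auto
    have e: "hat R (section_form R (\<sigma> t)) x = (\<lambda>vs. if vs = [] then \<sigma> t x else 0)"
      by (rule ext) (simp add: hat_section_form[OF R x0] retr_id[OF R x])
    show "alternating (hat R (section_form R (\<sigma> t)) x)"
      unfolding e by (simp add: alternating_def linear_iff)
    show "hat R (section_form R (\<sigma> t)) x vs \<bullet> \<phi> t x = 0" for vs
      unfolding e using t[OF that x] by simp
  qed
  fix vs :: "'a list"
  show "smooth_on (I \<times> (- {0})) (\<lambda>p. hat R (section_form R (\<sigma> (fst p))) (snd p) vs)"
  proof (cases "vs = []")
    case True
    show ?thesis
      by (rule smooth_on_cong[OF o s]) (use R True in \<open>simp add: hat_section_form mem_Times_iff\<close>)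
  next
    case False
    show ?thesis
      by (rule smooth_on_cong[OF o smooth_on_const[of _ 0]]) (use R False in \<open>simp add: hat_section_form mem_Times_iff\<close>)
  qed
qed

lemma cov_eqI:
  assumes "\<And>y. y \<noteq> 0 \<Longrightarrow> hat R \<omega> y vs = g y" "x \<noteq> 0" "(g has_derivative D) (at x)"
  shows "cov R \<phi> \<omega> x u vs = tproj (\<phi> x) (D u)"
proof -
  have "((\<lambda>y. hat R \<omega> y vs) has_derivative D) (at x)"
    by (rule has_derivative_transform_within_open[OF assms(3) open_compl0]) (use assms in auto)
  from frechet_derivative_at[OF this, symmetric] show ?thesis by (simp add: cov_def)
qed

lemma cov_eq_0:
  assumes "\<And>y. y \<noteq> 0 \<Longrightarrow> hat R \<omega> y vs = 0" "x \<noteq> 0"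
  shows "cov R \<phi> \<omega> x u vs = 0"
  using cov_eqI[OF assms has_derivative_const] by (simp add: linear_0[OF linear_tproj])

text \<open>In degree 0 the codifferential is zero and the exterior differential is the covariant
  differential.\<close>

lemma hat_dirac_section:
  assumes R: "R > 0" and x: "norm x = R" and f: "is_form R \<phi> (section_form R \<sigma>)"
    and d: "((\<lambda>y. \<sigma> (retr R y)) has_derivative D) (at x)"
  shows "hat R (dirac R \<phi> (section_form R \<sigma>)) x vs = (if length vs = 1 then tproj (\<phi> x) (D (vs ! 0)) else 0)"
proof -
  have x0: "x \<noteq> 0" using x R by auto
  have c0: "cov R \<phi> (section_form R \<sigma>) x u ws = 0" if "ws \<noteq> []" for u ws
    using that by (intro cov_eq_0 x0) (simp add: hat_section_form[OF R])
  have c1: "cov R \<phi> (section_form R \<sigma>) x u [] = tproj (\<phi> x) (D u)" for u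
    by (rule cov_eqI[OF _ x0 d]) (simp add: hat_section_form[OF R])
  have "hat R (codiff R \<phi> (section_form R \<sigma>)) x vs = 0"
    using c0 by (simp add: hat_codiff[OF R x0] retr_id[OF R x])
  moreover have "hat R (extdiff R \<phi> (section_form R \<sigma>)) x vs = (if length vs = 1 then tproj (\<phi> x) (D (vs ! 0)) else 0)"
  proof (cases "length vs = 1")
    case True
    then obtain v where v: "vs = [v]" by (auto simp: length_Suc_conv)
    have "cov R \<phi> (section_form R \<sigma>) x (tproj x v) [] = cov R \<phi> (section_form R \<sigma>) x v []"
      by (rule cov_tproj[OF f x0])
    then show ?thesis using v by (simp add: hat_extdiff[OF R x0] retr_id[OF R x] c1)
  next
    case False
    \<comment> \<open>Removing one argument leaves the empty list only when there was exactly
      one.\<close>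
    have "take i (map (tproj x) vs) @ drop (Suc i) (map (tproj x) vs) \<noteq> []" if "i < length vs" for i
    proof
      assume a: "take i (map (tproj x) vs) @ drop (Suc i) (map (tproj x) vs) = []"
      then have "length (take i (map (tproj x) vs) @ drop (Suc i) (map (tproj x) vs)) = 0" by (simp only: list.size)
      then show False using that False by simp
    qed
    then have "alt_sum (map (tproj x) vs) (cov R \<phi> (section_form R \<sigma>) x) = 0"
      unfolding alt_sum_eq by (intro sum.neutral) (simp add: c0)
    then show ?thesis using False by (simp add: hat_extdiff[OF R x0] retr_id[OF R x])
  qed
  ultimately show ?thesis by (simp add: hat_dirac)
qed

text \<open>Normal to the small hypersphere inside the unit sphere, pointing away from the pole
  \<open>(0, 1)\<close> and hence towards larger radii.\<close>

definition unit_normal :: "real \<Rightarrow> 'a::euclidean_space \<Rightarrow> 'a \<times> real" where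
  "unit_normal R x = ((sqrt (1 - R\<^sup>2) / R) *\<^sub>R x, - R)"

text \<open>The constant \<open>cc\<close> is, up to sign, the trace of the second fundamental form:
  the tension field of the small hypersphere is \<open>- cc\<close> times the unit normal.\<close>

locale hypersphere_variation =
  fixes I :: "real set" and R cc :: real and \<phi> :: "real \<Rightarrow> 'a::euclidean_space \<Rightarrow> 'a \<times> real"
  assumes v: "variation I R \<phi>" and I0: "0 \<in> I" and R1: "R < 1"
    and cc: "cc = (real DIM('a) - 1) * sqrt (1 - R\<^sup>2) / R"
    and base: "\<And>x. norm x = R \<Longrightarrow> \<phi> 0 x = small_hypersphere R x"
begin

abbreviation "ht \<equiv> sqrt (1 - R\<^sup>2)"
abbreviation "\<eta> \<equiv> unit_normal R :: 'a \<Rightarrow> 'a \<times> real"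
abbreviation "G \<equiv> \<lambda>p. \<phi> (fst p) (retr R (snd p))"
abbreviation "V x \<equiv> frechet_derivative G (at (0, x)) (1, 0)"
abbreviation "W j t \<equiv> iter_form R (\<phi> t) j"

lemmas R = variationD(1)[OF v] and Iopen = variationD(2)[OF v]

section \<open>Geometry of the small hypersphere and the iterates at time 0\<close>

lemma ht: "ht\<^sup>2 = 1 - R\<^sup>2" "ht * ht = 1 - R\<^sup>2" "ht > 0"
proof -
  have "R\<^sup>2 < 1" using R R1 by (simp add: power_less_one_iff abs_square_less_1)
  then show "ht\<^sup>2 = 1 - R\<^sup>2" "ht * ht = 1 - R\<^sup>2" "ht > 0" by auto
qed

lemma abs_ht [simp]: "\<bar>1 - R\<^sup>2\<bar> = 1 - R\<^sup>2"
  using ht(1) by (metis abs_of_nonneg zero_le_power2)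

lemma nz: "norm x = R \<Longrightarrow> x \<noteq> 0"
  using R by auto

lemma xx: "norm x = R \<Longrightarrow> x \<bullet> x = R\<^sup>2"
  by (simp add: dot_square_norm)

lemma base_inner: "norm x = R \<Longrightarrow> \<phi> 0 x \<bullet> \<phi> 0 x = 1"
  by (simp add: base small_hypersphere_def xx ht)

lemma normal_inner: "norm x = R \<Longrightarrow> \<eta> x \<bullet> \<phi> 0 x = 0"
  using R by (simp add: base small_hypersphere_def unit_normal_def xx power2_eq_square)

lemma normal_unit: "norm x = R \<Longrightarrow> \<eta> x \<bullet> \<eta> x = 1"
proof -
  assume x: "norm x = R"
  have "\<eta> x \<bullet> \<eta> x = (ht / R) * ((ht / R) * R\<^sup>2) + R\<^sup>2"
    by (simp only: unit_normal_def inner_Pair inner_scaleR_left inner_scaleR_right xx[OF x])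
       (simp add: power2_eq_square)
  also have "(ht / R) * ((ht / R) * R\<^sup>2) = ht * ht" using R by (simp add: power2_eq_square)
  finally show ?thesis by (simp add: ht(2))
qed

text \<open>The coefficients are the inner products of \<open>(x, 0)\<close> with two orthonormal
  vectors. The mean curvature vector of the source sphere is a multiple of \<open>(x, 0)\<close>, so
  its normal component is read off from here.\<close>

lemma horizontal: "norm x = R \<Longrightarrow> (x, 0) = R\<^sup>2 *\<^sub>R \<phi> 0 x + (R * ht) *\<^sub>R \<eta> x"
proof -
  assume x: "norm x = R"
  have "R * ht * (ht / R) = 1 - R\<^sup>2" using R ht(2) by simp
  then have "R\<^sup>2 *\<^sub>R x + (R * ht * (ht / R)) *\<^sub>R x = x"
    by (simp flip: scaleR_add_left)
  then show ?thesis
    by (simp add: base[OF x] small_hypersphere_def unit_normal_def power2_eq_square)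
qed

lemma tangent_orth: "norm x = R \<Longrightarrow> (tproj x u, 0) \<bullet> \<phi> 0 x = 0"
  using nz[of x] by (simp add: base small_hypersphere_def)

lemma v0: "variation UNIV R (\<lambda>_. \<phi> 0)"
  by (rule variation_const[OF v I0])

lemma base_deriv:
  assumes x: "norm x = R"
  shows "frechet_derivative G (at (0, x)) (0, u) = (tproj x u, 0)"
proof -
  have x0: "x \<noteq> 0" using nz[OF x] .
  have "((\<lambda>y. (retr R y, ht)) has_derivative (\<lambda>u. (tproj x u, 0))) (at x)"
    by (intro has_derivative_Pair retr_has_derivative[OF R x] has_derivative_const)
  then have "((\<lambda>y. \<phi> 0 (retr R y)) has_derivative (\<lambda>u. (tproj x u, 0))) (at x)"
    by (rule has_derivative_transform_within_open[OF _ open_compl0])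
       (use x0 R in \<open>simp_all add: base small_hypersphere_def\<close>)
  moreover have "((\<lambda>y. \<phi> 0 (retr R y)) has_derivative (\<lambda>u. frechet_derivative G (at (0, x)) (0, u))) (at x)"
    using has_derivative_slice_snd[OF variation_deriv[OF v I0 x0]] by simp
  ultimately have "(\<lambda>u. (tproj x u, 0)) = (\<lambda>u. frechet_derivative G (at (0, x)) (0, u))"
    by (rule has_derivative_unique)
  from fun_cong[OF this, of u] show ?thesis by simp
qed

lemma hat_W0: "y \<noteq> 0 \<Longrightarrow> hat R (W 0 0) y vs = (if length vs = 1 then (tproj y (vs ! 0), 0) else 0)"
  using hat_d_map[OF v I0, of y vs] base_deriv[of "retr R y"] R by (simp add: iter_form_def)

text \<open>The hypersphere is umbilic, and \<open>ht / R\<close> is its principal curvature up to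
  sign.\<close>

lemma normal_deriv:
  "norm x = R \<Longrightarrow> ((\<lambda>y. \<eta> (retr R y)) has_derivative (\<lambda>u. ((ht / R) *\<^sub>R tproj x u, 0))) (at x)"
  unfolding unit_normal_def
  by (intro has_derivative_Pair has_derivative_scaleR_right retr_has_derivative[OF R] has_derivative_const)

lemma smooth_normal: "smooth_on (UNIV \<times> (- {0})) (\<lambda>p::real \<times> 'a. \<eta> (retr R (snd p)))"
  unfolding unit_normal_def
  by (intro smooth_on_Pair smooth_on_scaleR smooth_on_const smooth_on_retr smooth_on_snd open_prod_compl0 open_UNIV) auto

lemma is_form_normal: "is_form R (\<phi> 0) (section_form R \<eta>)"
  by (rule family_is_form[OF v0 family_section_form[OF R open_UNIV smooth_normal], of 0])
     (auto simp: normal_inner)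

lemma is_form_W0: "is_form R (\<phi> 0) (W j 0)"
  by (rule is_form_iter_form[OF v0])

text \<open>The codifferential of \<open>di\<close> is minus the mean curvature vector of the source
  sphere, projected to the tangent space of the target: \<open>(DIM('a) - 1) / R\<^sup>2\<close>
  times the normal component \<open>R * ht\<close> of \<open>(x, 0)\<close>, which is
  \<open>cc\<close>. The exterior differential of \<open>di\<close> is zero.\<close>

lemma W1: "W 1 0 = (\<lambda>x vs. cc *\<^sub>R section_form R \<eta> x vs)"
proof (rule is_form_eqI[OF R is_form_W0 is_form_scaleR[OF is_form_normal]])
  fix x :: 'a and vs assume x: "norm x = R"
  note x0 = nz[OF x]
  let ?\<omega> = "W 0 0"
  let ?D = "\<lambda>w u. - (((w \<bullet> u) / (x \<bullet> x) - (w \<bullet> x) * (2 * (x \<bullet> u)) / (x \<bullet> x)\<^sup>2) *\<^sub>R x + ((w \<bullet> x) / (x \<bullet> x)) *\<^sub>R u)"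
  have c0: "cov R (\<phi> 0) ?\<omega> x u ws = 0" if "length ws \<noteq> 1" for u ws
    using that by (intro cov_eq_0 x0) (simp add: hat_W0)
  have c1: "cov R (\<phi> 0) ?\<omega> x u [w] = tproj (\<phi> 0 x) (?D w u, 0)" for u w
    by (rule cov_eqI[OF _ x0 has_derivative_Pair[OF tproj_has_derivative[OF x0] has_derivative_const]]) (simp add: hat_W0)
  have d: "hat R (codiff R (\<phi> 0) ?\<omega>) x vs = (if vs = [] then cc *\<^sub>R \<eta> x else 0)"
  proof (cases "vs = []")
    case True
    have "hat R (codiff R (\<phi> 0) ?\<omega>) x [] = - (\<Sum>b\<in>Basis. tproj (\<phi> 0 x) (?D b b, 0))"
      by (simp add: hat_codiff[OF R x0] retr_id[OF R x] c1)
    also have "\<dots> = - tproj (\<phi> 0 x) (\<Sum>b\<in>Basis. ?D b b, 0)"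
    proof -
      have "(\<Sum>b\<in>Basis. (?D b b, 0)) = (\<Sum>b\<in>Basis. ?D b b, 0::real)" by (simp add: sum_prod)
      then show ?thesis by (simp only: linear_sum[OF linear_tproj, symmetric])
    qed
    also have "(\<Sum>b\<in>Basis. ?D b b) = - ((real DIM('a) - 1) / (x \<bullet> x)) *\<^sub>R x" by (rule sum_tproj_derivative[OF x0])
    also have "(- ((real DIM('a) - 1) / (x \<bullet> x)) *\<^sub>R x, 0) = - ((real DIM('a) - 1) / R\<^sup>2) *\<^sub>R (x, 0::real)"
      by (simp add: xx[OF x])
    also have "- tproj (\<phi> 0 x) \<dots> = ((real DIM('a) - 1) / R\<^sup>2) *\<^sub>R tproj (\<phi> 0 x) (x, 0)"
      by (simp only: linear_cmul[OF linear_tproj]) simp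
    also have "tproj (\<phi> 0 x) (x, 0) = (R * ht) *\<^sub>R \<eta> x"
    proof -
      have "\<phi> 0 x \<noteq> 0" using base_inner[OF x] by auto
      then show ?thesis unfolding horizontal[OF x]
        by (simp add: linear_add[OF linear_tproj] linear_cmul[OF linear_tproj] tproj_id normal_inner[OF x])
    qed
    finally show ?thesis using True R by (simp add: power2_eq_square cc)
  next
    case False
    then show ?thesis by (simp add: hat_codiff[OF R x0] retr_id[OF R x] c0)
  qed
  have e: "hat R (extdiff R (\<phi> 0) ?\<omega>) x vs = 0"
  proof (cases "length vs = 2")
    case True
    then obtain a b where ab: "vs = [a, b]" by (auto simp: length_Suc_conv numeral_2_eq_2)
    \<comment> \<open>The second derivative of the inclusion is symmetric in tangent vectors, so the
      two terms of \<open>alt_sum\<close> cancel.\<close>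
    have "?D (tproj x b) (tproj x a) = ?D (tproj x a) (tproj x b)"
      using x0 by (simp add: inner_commute)
    then show ?thesis unfolding ab by (simp add: hat_extdiff[OF R x0] retr_id[OF R x] c1)
  next
    case False
    have L: "length (take i (map (tproj x) vs) @ drop (Suc i) (map (tproj x) vs)) \<noteq> 1" if "i < length vs" for i
      using that False by simp
    then have "alt_sum (map (tproj x) vs) (cov R (\<phi> 0) ?\<omega> x) = 0"
      unfolding alt_sum_eq by (intro sum.neutral ballI) (use c0[OF L] in simp)
    then show ?thesis by (simp add: hat_extdiff[OF R x0] retr_id[OF R x])
  qed
  have "hat R (W 1 0) x vs = hat R (codiff R (\<phi> 0) ?\<omega>) x vs + hat R (extdiff R (\<phi> 0) ?\<omega>) x vs"
    by (simp add: iter_form_Suc hat_dirac)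
  then show "hat R (W 1 0) x vs = hat R (\<lambda>x vs. cc *\<^sub>R section_form R \<eta> x vs) x vs"
    unfolding d e using hat_section_form[OF R x0, of \<eta> vs] by (simp add: hat_def retr_id[OF R x])
qed

text \<open>By umbilicity the covariant differential of the normal is a multiple of
  \<open>di\<close>.\<close>

lemma dirac_normal: "dirac R (\<phi> 0) (section_form R \<eta>) = (\<lambda>x vs. (ht / R) *\<^sub>R W 0 0 x vs)"
proof (rule is_form_eqI[OF R is_form_dirac[OF v0 is_form_normal] is_form_scaleR[OF is_form_W0]])
  fix x :: 'a and vs assume x: "norm x = R"
  have "tproj (\<phi> 0 x) ((ht / R) *\<^sub>R tproj x u, 0) = (ht / R) *\<^sub>R (tproj x u, 0)" for u
  proof -
    have "((ht / R) *\<^sub>R tproj x u, 0) = (ht / R) *\<^sub>R (tproj x u, 0::real)" by simp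
    then show ?thesis by (simp only: linear_cmul[OF linear_tproj] tproj_id[OF tangent_orth[OF x]])
  qed
  then show "hat R (dirac R (\<phi> 0) (section_form R \<eta>)) x vs = hat R (\<lambda>x vs. (ht / R) *\<^sub>R W 0 0 x vs) x vs"
    using hat_dirac_section[OF R x is_form_normal normal_deriv[OF x], of vs] hat_W0[OF nz[OF x], of vs]
    by (simp add: hat_def)
qed

text \<open>The factor is the constant \<kappa> of the overview,
  \<open>(DIM('a) - 1) * ht\<^sup>2 / R\<^sup>2\<close>.\<close>

lemma W2: "W 2 0 = (\<lambda>x vs. (cc * (ht / R)) *\<^sub>R W 0 0 x vs)"
proof -
  have "W 2 0 = dirac R (\<phi> 0) (\<lambda>x vs. 0 *\<^sub>R section_form R \<eta> x vs - (- cc) *\<^sub>R section_form R \<eta> x vs)"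
    using W1 by (simp add: numeral_2_eq_2 iter_form_Suc)
  also have "\<dots> = (\<lambda>x vs. cc *\<^sub>R dirac R (\<phi> 0) (section_form R \<eta>) x vs)"
    by (subst dirac_lincomb[OF R is_form_scaleR[OF is_form_normal] is_form_normal]) (simp add: dirac_zero)
  finally show ?thesis by (simp add: dirac_normal)
qed

section \<open>The two pairings that determine the first variation\<close>

definition "J = sphere_int R (\<lambda>x. V x \<bullet> \<eta> x)"

lemma G_t: "norm x = R \<Longrightarrow> ((\<lambda>t. \<phi> t x) has_vector_derivative V x) (at 0)"
  using has_derivative_slice_fst[OF variation_deriv[OF v I0 nz]] R by (simp add: retr_id)

lemma V_normal: "norm x = R \<Longrightarrow> V x \<bullet> \<phi> 0 x = 0"
  by (rule variation_normal[OF v I0])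

lemma sW: "smooth_family I R (\<lambda>t. W j t)"
  by (rule family_smooth_family[OF family_iter_form[OF v]])

text \<open>Integrating by parts before differentiating avoids mixed derivatives: for each
  \<open>t\<close> the integral of \<langle>d\<phi>_t, di\<rangle> is that of
  \<open>(DIM('a) - 1) / R\<^sup>2\<close> times \<phi>_t \<bullet> (x, 0), whose time derivative
  involves the variation field alone.\<close>

lemma energy_00: "time_pairing R (\<lambda>t. W 0 t) (\<lambda>t. W 0 t) = cc * J"
proof -
  let ?m = "real DIM('a) - 1"
  \<comment> \<open>Freezing the second form at \<open>t = 0\<close> removes the second term of the
    product rule.\<close>
  have sb: "smooth_family I R (\<lambda>_. W 0 0)"
    unfolding smooth_family_def
    using smooth_on_snd_compose[OF is_form_smooth[OF is_form_W0] Iopen open_compl0] by simp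
  have "time_deriv R (\<lambda>_. W 0 0) x vs = 0" if "norm x = R" for x vs
    by (rule time_deriv_eqI[OF sb I0 nz[OF that] has_vector_derivative_const])
  then have z: "time_pairing R (\<lambda>_. W 0 0) (\<lambda>t. W 0 t) = 0"
    unfolding time_pairing_def using sphere_int_cong[of R "\<lambda>x. ip (time_deriv R (\<lambda>_. W 0 0) x) (hat R (W 0 0) x)" "\<lambda>x. 0"]
    by (simp add: ip_def tuple_inner_length_0)
  have 1: "((\<lambda>t. sphere_int R (\<lambda>x. ip (hat R (W 0 t) x) (hat R (W 0 0) x))) has_real_derivative
     time_pairing R (\<lambda>t. W 0 t) (\<lambda>t. W 0 t)) (at 0)"
    using pairing_derivative[OF R Iopen I0 sW[of 0] sb] z by (simp add: time_pairing_def)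
  have o: "open (I \<times> (- {0::'a}))" using Iopen by simp
  let ?F = "\<lambda>p. (?m / R\<^sup>2) * (G p \<bullet> (retr R (snd p), 0))"
  have sF: "smooth_on (I \<times> (- {0})) ?F"
    by (intro smooth_on_mult smooth_on_inner smooth_on_Pair smooth_on_const smooth_on_retr smooth_on_snd variationD(4)[OF v] o) auto
  have 2: "((\<lambda>t. sphere_int R (\<lambda>x. ?F (t, x))) has_real_derivative sphere_int R (\<lambda>x. frechet_derivative ?F (at (0, x)) (1, 0))) (at 0)"
    by (rule sphere_int_has_derivative[OF R Iopen I0 sF])
  have dF: "frechet_derivative ?F (at (0, x)) (1, 0) = cc * (V x \<bullet> \<eta> x)" if x: "norm x = R" for x
  proof -
    have "((\<lambda>t. ?F (t, x)) has_vector_derivative frechet_derivative ?F (at (0, x)) (1, 0)) (at 0)"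
      using nz[OF x] I0 by (intro has_derivative_slice_fst smooth_on_has_derivative[OF sF]) auto
    moreover have "((\<lambda>t. (?m / R\<^sup>2) * (\<phi> t x \<bullet> (x, 0))) has_vector_derivative (?m / R\<^sup>2) * (V x \<bullet> (x, 0))) (at 0)"
      by (intro bounded_linear.has_vector_derivative[OF bounded_linear_mult_right]
          bounded_linear.has_vector_derivative[OF bounded_linear_inner_left] G_t[OF x])
    ultimately have "frechet_derivative ?F (at (0, x)) (1, 0) = (?m / R\<^sup>2) * (V x \<bullet> (x, 0))"
      using R x by (intro vector_derivative_unique_at[where x = 0]) (simp_all add: retr_id)
    \<comment> \<open>The component of \<open>(x, 0)\<close> along \<phi>_0 is lost because
      \<open>V x\<close> is tangent to the unit sphere there.\<close>
    also have "V x \<bullet> (x, 0) = R * ht * (V x \<bullet> \<eta> x)"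
      unfolding horizontal[OF x] by (simp add: inner_add_right V_normal[OF x])
    finally show ?thesis using R by (simp add: power2_eq_square cc)
  qed
  have "sphere_int R (\<lambda>x. ip (hat R (W 0 t) x) (hat R (W 0 0) x)) = sphere_int R (\<lambda>x. ?F (t, x))" if t: "t \<in> I" for t
  proof -
    \<comment> \<open>These are the components of the tangential part of the first factor of
      \<phi>_t; the divergence of this field is the difference of the two integrands.\<close>
    let ?X = "\<lambda>b y. \<phi> t (retr R y) \<bullet> (tproj y b, 0::real)"
    let ?Dt = "\<lambda>x u. frechet_derivative G (at (t, x)) (0, u)"
    let ?D = "\<lambda>x w u. - (((w \<bullet> u) / (x \<bullet> x) - (w \<bullet> x) * (2 * (x \<bullet> u)) / (x \<bullet> x)\<^sup>2) *\<^sub>R x + ((w \<bullet> x) / (x \<bullet> x)) *\<^sub>R u)"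
    have sp: "smooth_on (- {0}) (\<lambda>y. \<phi> t (retr R y))"
      using smooth_on_slice[OF variationD(4)[OF v] Iopen open_compl0 t] by simp
    have sX: "smooth_on (- {0}) (?X b)" for b
      by (intro smooth_on_inner smooth_on_Pair smooth_on_const smooth_on_tproj smooth_on_ident sp open_compl0) auto
    have "sphere_int R (\<lambda>x. \<Sum>b\<in>Basis. frechet_derivative (?X b) (at x) b) = 0"
    proof (rule sphere_int_divergence[OF R sX])
      show "?X b (c *\<^sub>R y) = ?X b y" if "c > 0" for b y :: 'a and c
        using that by (simp add: retr_scale tproj_scale)
      fix x :: 'a assume x: "norm x = R"
      have "(\<Sum>b\<in>Basis. (x \<bullet> b) * ?X b x) = \<phi> t x \<bullet> (tproj x (\<Sum>b\<in>Basis. (x \<bullet> b) *\<^sub>R b), 0)"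
        unfolding linear_sum[OF linear_tproj] linear_cmul[OF linear_tproj]
        by (simp add: retr_id[OF R x] inner_Pair_0 inner_sum_right)
      then show "(\<Sum>b\<in>Basis. (x \<bullet> b) * ?X b x) = 0"
        using nz[OF x] by (simp add: euclidean_representation inner_Pair_0)
    qed
    moreover have "(\<Sum>b\<in>Basis. frechet_derivative (?X b) (at x) b) = ip (hat R (W 0 t) x) (hat R (W 0 0) x) - ?F (t, x)"
      if x: "norm x = R" for x
    proof -
      note x0 = nz[OF x]
      have "((\<lambda>y. \<phi> t (retr R y)) has_derivative ?Dt x) (at x)"
        using has_derivative_slice_snd[OF variation_deriv[OF v t x0]] by simp
      then have "(?X b has_derivative (\<lambda>u. \<phi> t (retr R x) \<bullet> (?D x b u, 0) + ?Dt x u \<bullet> (tproj x b, 0))) (at x)" for b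
        by (intro has_derivative_inner has_derivative_Pair tproj_has_derivative[OF x0] has_derivative_const)
      from frechet_derivative_at[OF this, symmetric]
      have "(\<Sum>b\<in>Basis. frechet_derivative (?X b) (at x) b) =
          (\<Sum>b\<in>Basis. \<phi> t x \<bullet> (?D x b b, 0)) + (\<Sum>b\<in>Basis. ?Dt x b \<bullet> (tproj x b, 0))"
        by (simp add: sum.distrib retr_id[OF R x])
      also have "(\<Sum>b\<in>Basis. \<phi> t x \<bullet> (?D x b b, 0)) = \<phi> t x \<bullet> (\<Sum>b\<in>Basis. ?D x b b, 0)"
        by (simp only: inner_Pair_0 inner_sum_right)
      also have "(\<Sum>b\<in>Basis. ?D x b b) = - (?m / (x \<bullet> x)) *\<^sub>R x" by (rule sum_tproj_derivative[OF x0])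
      also have "\<phi> t x \<bullet> (- (?m / (x \<bullet> x)) *\<^sub>R x, 0) = - ?F (t, x)"
        by (simp add: xx[OF x] inner_Pair_0 retr_id[OF R x])
      also have "(\<Sum>b\<in>Basis. ?Dt x b \<bullet> (tproj x b, 0)) = ip (hat R (W 0 t) x) (hat R (W 0 0) x)"
        using hat_d_map_sphere[OF v t x]
        by (subst ip_deg1) (simp_all add: hat_W0[OF x0], simp add: iter_form_def)
      finally show ?thesis by simp
    qed
    ultimately have "sphere_int R (\<lambda>x. ip (hat R (W 0 t) x) (hat R (W 0 0) x) - ?F (t, x)) = 0"
      using sphere_int_cong[of R "\<lambda>x. \<Sum>b\<in>Basis. frechet_derivative (?X b) (at x) b"
          "\<lambda>x. ip (hat R (W 0 t) x) (hat R (W 0 0) x) - ?F (t, x)"] by simp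
    moreover have "continuous_on (sphere 0 R) (\<lambda>x. ip (hat R (W 0 t) x) (hat R (W 0 0) x))"
      by (rule continuous_on_ip_forms[OF R family_is_form[OF v family_iter_form[OF v] t] is_form_W0])
    moreover have "continuous_on (sphere 0 R) (\<lambda>x. ?F (t, x))"
      by (rule smooth_on_sphere_cont[OF R smooth_on_slice[OF sF Iopen open_compl0 t]])
    ultimately show ?thesis by (simp add: sphere_int_diff)
  qed
  then have "((\<lambda>t. sphere_int R (\<lambda>x. ip (hat R (W 0 t) x) (hat R (W 0 0) x))) has_real_derivative
      sphere_int R (\<lambda>x. frechet_derivative ?F (at (0, x)) (1, 0))) (at 0)"
    by (intro has_field_derivative_transform_within_open[OF 2 Iopen I0]) simp
  from DERIV_unique[OF 1 this] have "time_pairing R (\<lambda>t. W 0 t) (\<lambda>t. W 0 t) = sphere_int R (\<lambda>x. frechet_derivative ?F (at (0, x)) (1, 0))" .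
  also have "\<dots> = sphere_int R (\<lambda>x. cc * (V x \<bullet> \<eta> x))" by (rule sphere_int_cong) (rule dF)
  finally show ?thesis by (simp only: sphere_int_cmult J_def)
qed

lemma normal_section: "norm x = R \<Longrightarrow> tproj (\<phi> 0 x) (\<eta> x) = \<eta> x"
  by (rule tproj_id) (rule normal_inner)

lemma phi_nz: "t \<in> I \<Longrightarrow> norm x = R \<Longrightarrow> \<phi> t x \<noteq> 0"
  using variationD(3)[OF v] by force

text \<open>Carries the normal along the variation: a section along every \<phi>_t that equals the
  unit normal at \<open>t = 0\<close>, so that \<open>cc\<close> times it agrees with
  \<open>W 1\<close> there.\<close>

abbreviation "Z t \<equiv> section_form R (\<lambda>x. tproj (\<phi> t x) (\<eta> x))"

lemma family_Z: "family I R \<phi> Z"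
proof (rule family_section_form[OF R Iopen])
  have o: "open (I \<times> (- {0::'a}))" using Iopen by simp
  have "smooth_on (I \<times> (- {0})) (\<lambda>p::real \<times> 'a. \<eta> (retr R (snd p)))"
    by (rule smooth_on_subset[OF smooth_normal]) auto
  then show "smooth_on (I \<times> (- {0})) (\<lambda>p. tproj (\<phi> (fst p) (retr R (snd p))) (\<eta> (retr R (snd p))))"
    by (rule smooth_on_tproj[OF o variationD(4)[OF v]]) (use R phi_nz in \<open>simp add: mem_Times_iff\<close>)
  show "\<And>t x. t \<in> I \<Longrightarrow> norm x = R \<Longrightarrow> tproj (\<phi> t x) (\<eta> x) \<bullet> \<phi> t x = 0"
    using phi_nz by simp
qed

text \<open>Under projection to the moving tangent spaces the normal changes, to first order, only
  in the direction of \<phi>_0, to which it is orthogonal.\<close>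

lemma time_pairing_Z_W1: "time_pairing R Z (\<lambda>t. W 1 t) = 0"
proof -
  have "ip (time_deriv R Z x) (hat R (W 1 0) x) = 0" if x: "norm x = R" for x
  proof -
    note x0 = nz[OF x]
    have h: "hat R (W 1 0) x vs = (if vs = [] then cc *\<^sub>R \<eta> x else 0)" for vs
      using hat_section_form[OF R x0, of \<eta> vs] unfolding W1 by (simp add: hat_def retr_id[OF R x])
    have "((\<lambda>t. tproj (\<phi> t x) (\<eta> x)) has_vector_derivative
        - (((\<eta> x \<bullet> V x) / (\<phi> 0 x \<bullet> \<phi> 0 x) - (\<eta> x \<bullet> \<phi> 0 x) * (2 * (\<phi> 0 x \<bullet> V x)) / (\<phi> 0 x \<bullet> \<phi> 0 x)\<^sup>2) *\<^sub>R \<phi> 0 x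
          + ((\<eta> x \<bullet> \<phi> 0 x) / (\<phi> 0 x \<bullet> \<phi> 0 x)) *\<^sub>R V x)) (at 0)"
      by (rule has_vector_derivative_chain[OF G_t[OF x] tproj_has_derivative[OF phi_nz[OF I0 x]]])
    then have "((\<lambda>t. hat R (Z t) x []) has_vector_derivative - (\<eta> x \<bullet> V x) *\<^sub>R \<phi> 0 x) (at 0)"
      by (simp add: hat_section_form[OF R x0] retr_id[OF R x] base_inner[OF x] normal_inner[OF x])
    then have "time_deriv R Z x [] = - (\<eta> x \<bullet> V x) *\<^sub>R \<phi> 0 x"
      by (rule time_deriv_eqI[OF family_smooth_family[OF family_Z] I0 x0])
    then show ?thesis
      by (subst ip_deg0) (simp_all del: One_nat_def add: h normal_inner[OF x] inner_commute[of "\<phi> 0 x"])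
  qed
  then show ?thesis unfolding time_pairing_def using sphere_int_cong[of R _ "\<lambda>x::'a. 0"] by simp
qed

text \<open>Differentiate \<open>\<eta> - (\<eta> \<bullet> \<phi>) \<phi>\<close> in space and
  project along \<phi>; the multiples of \<phi> drop out.\<close>

lemma hat_dirac_Z:
  assumes t: "t \<in> I" and x: "norm x = R"
  shows "hat R (dirac R (\<phi> t) (Z t)) x [b] = tproj (\<phi> t x) ((ht / R) *\<^sub>R tproj x b, 0)
    - (\<eta> x \<bullet> \<phi> t x) *\<^sub>R frechet_derivative G (at (t, x)) (0, b)"
proof -
  note x0 = nz[OF x]
  let ?p = "\<lambda>y. \<phi> t (retr R y)"
  let ?n = "\<lambda>y. \<eta> (retr R y)"
  let ?s = "\<lambda>y. (?n y \<bullet> ?p y) / (?p y \<bullet> ?p y)"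
  have rx: "retr R x = x" by (rule retr_id[OF R x])
  have pp: "\<phi> t x \<bullet> \<phi> t x = 1" using variationD(3)[OF v t x] by (simp add: dot_square_norm)
  have dp: "(?p has_derivative (\<lambda>u. frechet_derivative G (at (t, x)) (0, u))) (at x)"
    using has_derivative_slice_snd[OF variation_deriv[OF v t x0]] by simp
  have sp: "smooth_on (- {0}) ?p"
    using smooth_on_slice[OF variationD(4)[OF v] Iopen open_compl0 t] by simp
  have sn: "smooth_on (- {0}) ?n"
    using smooth_on_slice[OF smooth_normal open_UNIV open_compl0, of 0] by simp
  have "smooth_on (- {0}) ?s"
    using R phi_nz[OF t] by (intro smooth_on_divide smooth_on_inner sp sn open_compl0) auto
  \<comment> \<open>The value of \<open>s'\<close> stays unspecified: it multiplies \<phi>_t, which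
    the projection removes.\<close>
  then obtain s' where s': "(?s has_derivative s') (at x)"
    using smooth_on_has_derivative x0 by blast
  have "((\<lambda>y. tproj (?p y) (?n y)) has_derivative
      (\<lambda>u. ((ht / R) *\<^sub>R tproj x u, 0) - (?s x *\<^sub>R frechet_derivative G (at (t, x)) (0, u) + s' u *\<^sub>R ?p x))) (at x)"
    unfolding tproj_def[of "?p _"]
    by (intro has_derivative_diff normal_deriv[OF x] has_derivative_scaleR s' dp)
  from hat_dirac_section[OF R x family_is_form[OF v family_Z t] this, of "[b]"]
  have "hat R (dirac R (\<phi> t) (Z t)) x [b] = tproj (\<phi> t x) (((ht / R) *\<^sub>R tproj x b, 0) -
      ((\<eta> x \<bullet> \<phi> t x) *\<^sub>R frechet_derivative G (at (t, x)) (0, b) + s' b *\<^sub>R \<phi> t x))"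
    by (simp add: rx pp)
  also have "tproj (\<phi> t x) (frechet_derivative G (at (t, x)) (0, b)) = frechet_derivative G (at (t, x)) (0, b)"
    by (rule tproj_id[OF variation_normal[OF v t x]])
  then have "tproj (\<phi> t x) (((ht / R) *\<^sub>R tproj x b, 0) -
      ((\<eta> x \<bullet> \<phi> t x) *\<^sub>R frechet_derivative G (at (t, x)) (0, b) + s' b *\<^sub>R \<phi> t x)) =
    tproj (\<phi> t x) ((ht / R) *\<^sub>R tproj x b, 0) - (\<eta> x \<bullet> \<phi> t x) *\<^sub>R frechet_derivative G (at (t, x)) (0, b)"
    using phi_nz[OF t x]
    by (simp only: linear_diff[OF linear_tproj] linear_add[OF linear_tproj] linear_cmul[OF linear_tproj] tproj_self) simp
  finally show ?thesis .
qed

text \<open>Only the term \<open>- (\<eta> \<bullet> V) di\<close> of the product rule survives at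
  \<open>t = 0\<close>: the projected term moves along \<phi>_0, orthogonally to \<open>di\<close>,
  and the derivative of d\<phi>_t is multiplied by \<open>\<eta> \<bullet> \<phi> = 0\<close>. The
  factor \<open>DIM('a) - 1\<close> is the squared norm of \<open>di\<close>.\<close>

lemma time_pairing_dirac_Z_W0: "time_pairing R (\<lambda>t. dirac R (\<phi> t) (Z t)) (\<lambda>t. W 0 t) = - (real DIM('a) - 1) * J"
proof -
  have "ip (time_deriv R (\<lambda>t. dirac R (\<phi> t) (Z t)) x) (hat R (W 0 0) x) = - (real DIM('a) - 1) * (V x \<bullet> \<eta> x)"
    if x: "norm x = R" for x
  proof -
    note x0 = nz[OF x]
    have T: "time_deriv R (\<lambda>t. dirac R (\<phi> t) (Z t)) x [b] \<bullet> (tproj x b, 0) = - (V x \<bullet> \<eta> x) * (tproj x b \<bullet> tproj x b)" for b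
    proof -
      let ?w = "((ht / R) *\<^sub>R tproj x b, 0::real)"
      have w: "?w \<bullet> \<phi> 0 x = 0" using x0 by (simp add: base[OF x] small_hypersphere_def)
      have "(\<lambda>p. frechet_derivative G (at p) (0, b)) differentiable (at (0, x))"
        using smooth_on_has_derivative[OF smooth_on_frechet_derivative[OF variationD(4)[OF v]], of "(0, x)"] I0 x0
        unfolding differentiable_def by auto
      \<comment> \<open>A mixed second derivative that is never evaluated, since its coefficient
        vanishes at \<open>t = 0\<close>.\<close>
      then obtain D where "((\<lambda>p. frechet_derivative G (at p) (0, b)) has_derivative D) (at (0, x))"
        by (auto simp: differentiable_def)
      from has_derivative_slice_fst[OF this]
      have g: "((\<lambda>t. frechet_derivative G (at (t, x)) (0, b)) has_vector_derivative D (1, 0)) (at 0)" .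
      have d1: "((\<lambda>t. tproj (\<phi> t x) ?w) has_vector_derivative
        - (((?w \<bullet> V x) / (\<phi> 0 x \<bullet> \<phi> 0 x) - (?w \<bullet> \<phi> 0 x) * (2 * (\<phi> 0 x \<bullet> V x)) / (\<phi> 0 x \<bullet> \<phi> 0 x)\<^sup>2) *\<^sub>R \<phi> 0 x
          + ((?w \<bullet> \<phi> 0 x) / (\<phi> 0 x \<bullet> \<phi> 0 x)) *\<^sub>R V x)) (at 0)"
        by (rule has_vector_derivative_chain[OF G_t[OF x] tproj_has_derivative[OF phi_nz[OF I0 x]]])
      have d2: "((\<lambda>t. (\<eta> x \<bullet> \<phi> t x) *\<^sub>R frechet_derivative G (at (t, x)) (0, b)) has_vector_derivative
          (\<eta> x \<bullet> \<phi> 0 x) *\<^sub>R D (1, 0) + (\<eta> x \<bullet> V x) *\<^sub>R frechet_derivative G (at (0, x)) (0, b)) (at 0)"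
        by (intro has_vector_derivative_scaleR g)
           (simp add: has_real_derivative_iff_has_vector_derivative
             bounded_linear.has_vector_derivative[OF bounded_linear_inner_right G_t[OF x]])
      have "((\<lambda>t. tproj (\<phi> t x) ?w - (\<eta> x \<bullet> \<phi> t x) *\<^sub>R frechet_derivative G (at (t, x)) (0, b)) has_vector_derivative
          - (?w \<bullet> V x) *\<^sub>R \<phi> 0 x - (\<eta> x \<bullet> V x) *\<^sub>R (tproj x b, 0)) (at 0)"
        using has_vector_derivative_diff[OF d1 d2] w
        by (simp add: base_inner[OF x] normal_inner[OF x] base_deriv[OF x])
      then have "((\<lambda>t. hat R (dirac R (\<phi> t) (Z t)) x [b]) has_vector_derivative
          - (?w \<bullet> V x) *\<^sub>R \<phi> 0 x - (\<eta> x \<bullet> V x) *\<^sub>R (tproj x b, 0)) (at 0)"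
        by (rule has_vector_derivative_transform_within_open[OF _ Iopen I0]) (simp only: hat_dirac_Z[OF _ x])
      then have "time_deriv R (\<lambda>t. dirac R (\<phi> t) (Z t)) x [b] = - (?w \<bullet> V x) *\<^sub>R \<phi> 0 x - (\<eta> x \<bullet> V x) *\<^sub>R (tproj x b, 0)"
        by (rule time_deriv_eqI[OF family_smooth_family[OF family_dirac[OF v family_Z]] I0 x0])
      then have "time_deriv R (\<lambda>t. dirac R (\<phi> t) (Z t)) x [b] \<bullet> (tproj x b, 0) =
          - (?w \<bullet> V x) * (\<phi> 0 x \<bullet> (tproj x b, 0)) - (\<eta> x \<bullet> V x) * ((tproj x b, 0::real) \<bullet> (tproj x b, 0))"
        by (simp only: inner_diff_left inner_scaleR_left)
      also have "\<phi> 0 x \<bullet> (tproj x b, 0) = 0" using tangent_orth[OF x, of b] by (simp only: inner_commute)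
      finally show ?thesis by (simp add: inner_commute[of "V x"])
    qed
    have "ip (time_deriv R (\<lambda>t. dirac R (\<phi> t) (Z t)) x) (hat R (W 0 0) x) =
        (\<Sum>b\<in>Basis. time_deriv R (\<lambda>t. dirac R (\<phi> t) (Z t)) x [b] \<bullet> (tproj x b, 0))"
      by (subst ip_deg1) (simp_all add: hat_W0[OF x0])
    also have "\<dots> = - (V x \<bullet> \<eta> x) * (\<Sum>b\<in>Basis. tproj x b \<bullet> tproj x b)"
      unfolding T by (simp only: sum_distrib_left)
    finally show ?thesis unfolding sum_tproj_norm[OF x0] by (simp add: algebra_simps)
  qed
  then have "time_pairing R (\<lambda>t. dirac R (\<phi> t) (Z t)) (\<lambda>t. W 0 t) = sphere_int R (\<lambda>x. - (real DIM('a) - 1) * (V x \<bullet> \<eta> x))"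
    unfolding time_pairing_def by (rule sphere_int_cong)
  then show ?thesis by (simp only: sphere_int_cmult J_def)
qed

text \<open>The family \<open>W 1\<close> less \<open>cc\<close> times \<open>Z\<close> vanishes at
  \<open>t = 0\<close>, so \<open>dirac\<close> passes across its pairing with \<open>W 0\<close>.
  As \<open>Z\<close> pairs to zero with \<open>W 1\<close>, the defect becomes \<open>cc\<close>
  times the pairing of \<open>dirac\<close> applied to \<open>Z\<close> with
  \<open>W 0\<close>.\<close>

lemma energy_defect:
  "time_pairing R (\<lambda>t. W 2 t) (\<lambda>t. W 0 t) - time_pairing R (\<lambda>t. W 1 t) (\<lambda>t. W 1 t) = - cc * (real DIM('a) - 1) * J"
proof -
  note fW = family_iter_form[OF v]
  note fs = family_smooth_family
  let ?\<alpha> = "\<lambda>t x vs. W 1 t x vs - cc *\<^sub>R Z t x vs"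
  have fa: "family I R \<phi> ?\<alpha>" by (rule family_lincomb[OF Iopen fW family_Z])
  have Z0: "Z 0 = section_form R \<eta>"
    by (intro ext) (simp add: section_form_def normal_section)
  have "time_pairing R (\<lambda>t. dirac R (\<phi> t) (?\<alpha> t)) (\<lambda>t. W 0 t) = time_pairing R ?\<alpha> (\<lambda>t. dirac R (\<phi> t) (W 0 t))"
    by (rule time_pairing_dirac_vanishing[OF v I0 fa fW]) (simp only: W1 Z0 diff_self)
  also have "(\<lambda>t. dirac R (\<phi> t) (W 0 t)) = (\<lambda>t. W 1 t)" by (simp add: iter_form_Suc)
  also have "time_pairing R ?\<alpha> (\<lambda>t. W 1 t) = time_pairing R (\<lambda>t. W 1 t) (\<lambda>t. W 1 t)"
    using time_pairing_lincomb_left[OF R Iopen I0 sW fs[OF family_Z] sW, of 1 cc 1] time_pairing_Z_W1 by simp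
  finally have 1: "time_pairing R (\<lambda>t. dirac R (\<phi> t) (?\<alpha> t)) (\<lambda>t. W 0 t) = time_pairing R (\<lambda>t. W 1 t) (\<lambda>t. W 1 t)" .
  have "dirac R (\<phi> t) (?\<alpha> t) = (\<lambda>x vs. W 2 t x vs - cc *\<^sub>R dirac R (\<phi> t) (Z t) x vs)" if "t \<in> I" for t
    using dirac_lincomb[OF R family_is_form[OF v fW that, of 1] family_is_form[OF v family_Z that], of cc]
    by (simp add: numeral_2_eq_2 iter_form_Suc)
  then have "time_pairing R (\<lambda>t. dirac R (\<phi> t) (?\<alpha> t)) (\<lambda>t. W 0 t) =
      time_pairing R (\<lambda>t x vs. W 2 t x vs - cc *\<^sub>R dirac R (\<phi> t) (Z t) x vs) (\<lambda>t. W 0 t)"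
    by (intro time_pairing_cong_left[OF R Iopen I0 fs[OF family_dirac[OF v fa]]
        smooth_family_lincomb[OF Iopen sW fs[OF family_dirac[OF v family_Z]]]])
  also have "\<dots> = time_pairing R (\<lambda>t. W 2 t) (\<lambda>t. W 0 t) - cc * time_pairing R (\<lambda>t. dirac R (\<phi> t) (Z t)) (\<lambda>t. W 0 t)"
    by (rule time_pairing_lincomb_left[OF R Iopen I0 sW fs[OF family_dirac[OF v family_Z]] sW])
  finally show ?thesis using 1 by (simp add: time_pairing_dirac_Z_W0 algebra_simps)
qed

text \<open>Both terms of the general formula contain \<open>cc * (DIM('a) - 1) * J\<close>: the
  factor \<open>DIM('a) - 1\<close> comes from \<kappa> in one and from \<open>energy_defect\<close>
  in the other. The difference that remains decides criticality.\<close>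

lemma first_variation:
  assumes n: "n \<ge> 1"
  shows "((\<lambda>t. ES_energy (Suc n) (sphere 0 R) (sphere_measure R) (sphere 0 1) (\<phi> t)) has_real_derivative
    (cc * (ht / R)) ^ (n - 1) * cc * (real DIM('a) - 1) * J * (ht\<^sup>2 / R\<^sup>2 - real n)) (at 0)"
proof -
  have "W 2 0 = (\<lambda>x vs. (cc * (ht / R)) *\<^sub>R W 0 0 x vs)" by (rule W2)
  from energy_derivative[OF v I0 n this]
  have "((\<lambda>t. 1/2 * sphere_int R (\<lambda>x. ip (hat R (W n t) x) (hat R (W n t) x))) has_real_derivative
    (cc * (ht / R)) ^ n * (cc * J) + real n * (cc * (ht / R)) ^ (n - 1) * (- cc * (real DIM('a) - 1) * J)) (at 0)"
    unfolding energy_00 energy_defect .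
  moreover have "(cc * (ht / R)) ^ n * (cc * J) + real n * (cc * (ht / R)) ^ (n - 1) * (- cc * (real DIM('a) - 1) * J) =
      (cc * (ht / R)) ^ (n - 1) * cc * (real DIM('a) - 1) * J * (ht\<^sup>2 / R\<^sup>2 - real n)"
  proof -
    have q: "cc * (ht / R) = (real DIM('a) - 1) * (ht\<^sup>2 / R\<^sup>2)"
      unfolding cc power2_eq_square by simp
    have "(cc * (ht / R)) ^ n = (cc * (ht / R)) ^ (n - 1) * ((real DIM('a) - 1) * (ht\<^sup>2 / R\<^sup>2))"
      unfolding q[symmetric] using n by (cases n) simp_all
    moreover have "p * (m * h) * (c * j) + k * p * (- c * m * j) = p * c * m * j * (h - k)" for p m h c j k :: real
      by (simp add: algebra_simps)
    ultimately show ?thesis by (simp only:)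
  qed
  ultimately have "((\<lambda>t. 1/2 * sphere_int R (\<lambda>x. ip (hat R (W n t) x) (hat R (W n t) x))) has_real_derivative
    (cc * (ht / R)) ^ (n - 1) * cc * (real DIM('a) - 1) * J * (ht\<^sup>2 / R\<^sup>2 - real n)) (at 0)"
    by (rule DERIV_cong)
  then show ?thesis
    by (rule has_field_derivative_transform_within_open[OF _ Iopen I0])
       (rule ES_energy_eq[OF variation_const[OF v], symmetric])
qed

end


section \<open>Critical radii\<close>

lemma variation_of_smooth_map:
  fixes \<Phi> :: "real \<times> 'a::euclidean_space \<Rightarrow> 'b::euclidean_space"
  assumes "R > 0" "smooth_map ({-e<..<e} \<times> sphere 0 R) (sphere 0 1) \<Phi>"
  shows "variation {-e<..<e} R (\<lambda>t x. \<Phi> (t, x))"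
proof -
  have "smooth_on ({-e<..<e} \<times> (- {0})) (\<lambda>p. \<Phi> (fst p, retr R (snd p)))"
    by (rule smooth_map_on_variation[OF assms(1) _ conjunct1[OF assms(2)[unfolded smooth_map_def]]]) simp
  moreover have "norm (\<Phi> (t, x)) = 1" if "t \<in> {-e<..<e}" "norm x = R" for t x
  proof -
    have "(t, x) \<in> {-e<..<e} \<times> sphere 0 R" using that by simp
    then have "\<Phi> (t, x) \<in> sphere 0 1"
      using subsetD[OF conjunct2[OF assms(2)[unfolded smooth_map_def]] imageI] by simp
    then show ?thesis by simp
  qed
  ultimately show ?thesis using assms(1) by (simp add: variation_def)
qed

lemma smooth_small_hypersphere:
  "smooth_on (UNIV \<times> (- {0})) (\<lambda>p::real \<times> 'a::euclidean_space. small_hypersphere R (retr R (snd p)))"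
  unfolding small_hypersphere_def
  by (intro smooth_on_Pair smooth_on_const smooth_on_retr smooth_on_snd open_prod_compl0 open_UNIV) auto

lemma norm_small_hypersphere:
  assumes "0 < R" "R < 1" "norm x = R"
  shows "norm (small_hypersphere R x) = 1"
proof -
  have "R\<^sup>2 < 1" using assms by (simp add: power_less_one_iff abs_square_less_1)
  then show ?thesis using assms(3) by (simp add: small_hypersphere_def norm_Pair)
qed

lemma hypersphere_variationI:
  fixes \<phi> :: "real \<Rightarrow> 'a::euclidean_space \<Rightarrow> 'a \<times> real"
  assumes "variation I R \<phi>" "0 \<in> I" "R < 1" "\<And>x. norm x = R \<Longrightarrow> \<phi> 0 x = small_hypersphere R x"
  shows "hypersphere_variation I R ((real DIM('a) - 1) * sqrt (1 - R\<^sup>2) / R) \<phi>"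
  using assms by unfold_locales auto

lemma hypersphere_variation_const:
  assumes "0 < R" "R < 1"
  shows "hypersphere_variation UNIV R ((real DIM('a::euclidean_space) - 1) * sqrt (1 - R\<^sup>2) / R)
    (\<lambda>_::real. small_hypersphere R :: 'a \<Rightarrow> _)"
proof (rule hypersphere_variationI)
  show "variation UNIV R (\<lambda>_::real. small_hypersphere R :: 'a \<Rightarrow> _)"
    unfolding variation_def
    using assms by (intro conjI smooth_small_hypersphere ballI allI impI norm_small_hypersphere) auto
qed (use assms in auto)

lemma isometric_small_hypersphere:
  assumes "0 < R" "R < 1"
  shows "isometric_immersion (sphere (0::'a::euclidean_space) R) (sphere 0 1) (small_hypersphere R)"
proof -
  have "smooth_on (- {0}) (\<lambda>y::'a. small_hypersphere R (retr R y))"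
    using smooth_on_slice[OF smooth_small_hypersphere[of R] open_UNIV open_compl0, of 0] by simp
  then have "smooth_map (sphere (0::'a) R) (sphere 0 1) (small_hypersphere R)"
    unfolding smooth_map_def smooth_map_on_sphere[OF assms(1)]
    by (intro conjI image_subsetI) (simp_all add: norm_small_hypersphere[OF assms])
  moreover have "differential (sphere 0 R) (small_hypersphere R) x u = (u, 0)"
    if "x \<in> sphere 0 R" "u \<in> tangent_space (sphere 0 R) x" for x u :: 'a
  proof -
    have x: "norm x = R" "u \<bullet> x = 0" using that tangent_space_sphere[OF assms(1) that(1)] by auto
    have "((\<lambda>y. small_hypersphere R (retr R y)) has_derivative (\<lambda>u. (tproj x u, 0))) (at x)"
      unfolding small_hypersphere_def
      by (intro has_derivative_Pair retr_has_derivative[OF assms(1) x(1)] has_derivative_const)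
    from differential_sphere[OF assms(1) x this] show ?thesis using x by (simp add: tproj_id)
  qed
  ultimately show ?thesis by (simp add: isometric_immersion_def)
qed

text \<open>The tension field is \<open>- cc\<close> times the unit normal, and \<open>cc\<close> is
  nonzero because \<open>R < 1\<close> and the sphere has dimension at least 1.\<close>

lemma not_harmonic_small_hypersphere:
  assumes "0 < R" "R < 1" "DIM('a::euclidean_space) \<ge> 2"
  shows "\<not> harmonic_map (sphere (0::'a) R) (sphere_measure R) (sphere 0 1) (small_hypersphere R)"
proof -
  interpret hypersphere_variation UNIV R "(real DIM('a) - 1) * sqrt (1 - R\<^sup>2) / R" "\<lambda>_. small_hypersphere R :: 'a \<Rightarrow> _"
    by (rule hypersphere_variation_const[OF assms(1,2)])
  obtain b :: 'a where b: "b \<in> Basis" using nonempty_Basis by blast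
  define x where "x = R *\<^sub>R b"
  have x: "norm x = R" using assms b by (simp add: x_def)
  have t: "tangent_at R x []" using x by (simp add: tangent_at_def)
  let ?c = "(real DIM('a) - 1) * sqrt (1 - R\<^sup>2) / R"
  have "tension_field (sphere 0 R) (sphere_measure R) (sphere 0 1) (small_hypersphere R) x =
      - codiff R (small_hypersphere R) (d_map (sphere 0 R) (small_hypersphere R)) x []"
    using ext_d_adj_eq[OF v, of "d_map (sphere 0 R) (small_hypersphere R)"] is_form_W0[of 0]
    by (simp add: tension_field_def iter_form_def)
  also have "codiff R (small_hypersphere R) (d_map (sphere 0 R) (small_hypersphere R)) x [] =
      iter_form R (small_hypersphere R) 1 x []"
    using t by (simp add: iter_form_def dirac_def extdiff_def)
  also have "\<dots> = ?c *\<^sub>R unit_normal R x"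
    using x by (simp only: W1) (simp add: section_form_def)
  finally have "tension_field (sphere 0 R) (sphere_measure R) (sphere 0 1) (small_hypersphere R) x =
      - (?c *\<^sub>R unit_normal R x)" .
  moreover have "unit_normal R x \<noteq> 0" using normal_unit[OF x] by auto
  moreover have "?c \<noteq> 0" using assms ht(3) by auto
  ultimately have "tension_field (sphere 0 R) (sphere_measure R) (sphere 0 1) (small_hypersphere R) x \<noteq> 0"
    by simp
  then show ?thesis using x by (auto simp: harmonic_map_def)
qed

text \<open>The left-hand equation says \<open>1 / R\<^sup>2 = n + 1\<close>, and
  \<open>Suc n\<close> is the order \<open>r\<close>.\<close>

lemma radius_eq_iff:
  assumes "0 < R" "n \<ge> 1"
  shows "(1 - R\<^sup>2) / R\<^sup>2 = real n \<longleftrightarrow> R = 1 / sqrt (real (Suc n))"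
proof -
  have "(1 - R\<^sup>2) / R\<^sup>2 = real n \<longleftrightarrow> R\<^sup>2 = 1 / real (Suc n)"
    using assms by (simp add: field_simps)
  also have "1 / real (Suc n) = (1 / sqrt (real (Suc n)))\<^sup>2"
    by (simp add: power_divide)
  also have "R\<^sup>2 = (1 / sqrt (real (Suc n)))\<^sup>2 \<longleftrightarrow> R = 1 / sqrt (real (Suc n))"
    using assms by (intro power2_eq_iff_nonneg) auto
  finally show ?thesis .
qed

text \<open>Every admissible variation is an instance of the locale, and at this radius the last
  factor of \<open>first_variation\<close> is zero.\<close>

lemma ES_harmonic_small_hypersphere:
  assumes R: "0 < R" "R < 1" and n: "n \<ge> 1" and e: "(1 - R\<^sup>2) / R\<^sup>2 = real n"
  shows "ES_harmonic_map (Suc n) (sphere (0::'a::euclidean_space) R) (sphere_measure R) (sphere 0 1) (small_hypersphere R)"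
  unfolding ES_harmonic_map_def
proof (intro conjI allI impI)
  show "smooth_map (sphere (0::'a) R) (sphere 0 1) (small_hypersphere R)"
    by (rule conjunct1[OF isometric_small_hypersphere[OF R, unfolded isometric_immersion_def]])
  fix \<epsilon> :: real and \<Phi> :: "real \<times> 'a \<Rightarrow> 'a \<times> real"
  assume "\<epsilon> > 0" and \<Phi>: "smooth_map ({-\<epsilon><..<\<epsilon>} \<times> sphere 0 R) (sphere 0 1) \<Phi> \<and>
      (\<forall>x\<in>sphere 0 R. \<Phi> (0, x) = small_hypersphere R x)"
  then interpret hypersphere_variation "{-\<epsilon><..<\<epsilon>}" R "(real DIM('a) - 1) * sqrt (1 - R\<^sup>2) / R" "\<lambda>t x. \<Phi> (t, x)"
    using R by (intro hypersphere_variationI variation_of_smooth_map) auto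
  show "((\<lambda>t. ES_energy (Suc n) (sphere 0 R) (sphere_measure R) (sphere 0 1) (\<lambda>x. \<Phi> (t, x)))
      has_real_derivative 0) (at 0)"
    using first_variation[OF n] unfolding ht(1) e by simp
qed

text \<open>Moves the points along great circles through the parallel hyperspheres. Adding a
  multiple of the normal and renormalising keeps the formula free of trigonometry; the velocity at 0
  is the unit normal.\<close>

definition latitude_variation :: "real \<Rightarrow> real \<times> 'a::euclidean_space \<Rightarrow> 'a \<times> real" where
  "latitude_variation R p = retr 1 (small_hypersphere R (snd p) + fst p *\<^sub>R unit_normal R (snd p))"

text \<open>Stated for all nonzero \<open>y\<close>, since smoothness is needed on a neighbourhood
  of the sphere. If the sum were 0, its two components would force
  \<open>1 + t * t = 0\<close>.\<close>

lemma latitude_variation_nz: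
  assumes "0 < R" "R < 1" "y \<noteq> 0"
  shows "small_hypersphere R y + t *\<^sub>R unit_normal R y \<noteq> 0"
proof
  assume z: "small_hypersphere R y + t *\<^sub>R unit_normal R y = 0"
  have a: "y + (t * (sqrt (1 - R\<^sup>2) / R)) *\<^sub>R y = 0"
    using arg_cong[OF z, of fst] by (simp add: small_hypersphere_def unit_normal_def)
  have b: "sqrt (1 - R\<^sup>2) = t * R"
    using arg_cong[OF z, of snd] by (simp add: small_hypersphere_def unit_normal_def)
  have "(1 + t * (sqrt (1 - R\<^sup>2) / R)) *\<^sub>R y = 0" using a by (simp add: scaleR_add_left)
  then have "1 + t * t = 0" using assms b by simp
  moreover have "t * t \<ge> 0" by simp
  ultimately show False by linarith
qed

lemma smooth_latitude_variation:
  assumes "0 < R" "R < 1"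
  shows "smooth_map ({-1<..<1} \<times> sphere (0::'a::euclidean_space) R) (sphere 0 1) (latitude_variation R)"
proof -
  have o: "open (UNIV \<times> (- {0::'a}) :: (real \<times> 'a) set)" by simp
  have s: "smooth_on (UNIV \<times> (- {0::'a})) (latitude_variation R)"
    unfolding latitude_variation_def
  proof (rule smooth_on_retr[OF o])
    show "smooth_on (UNIV \<times> (- {0})) (\<lambda>p::real \<times> 'a. small_hypersphere R (snd p) + fst p *\<^sub>R unit_normal R (snd p))"
      unfolding small_hypersphere_def unit_normal_def
      by (intro smooth_on_add smooth_on_Pair smooth_on_const smooth_on_scaleR smooth_on_fst smooth_on_snd o)
    show "small_hypersphere R (snd p) + fst p *\<^sub>R unit_normal R (snd p) \<noteq> 0"
      if "p \<in> UNIV \<times> (- {0})" for p :: "real \<times> 'a"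
      using that by (intro latitude_variation_nz[OF assms]) auto
  qed
  have "smooth_map_on ({-1<..<1} \<times> sphere 0 R) (latitude_variation R :: real \<times> 'a \<Rightarrow> _)"
    unfolding smooth_map_on_def
    by (intro ballI exI[of _ "UNIV \<times> (- {0})"] exI[of _ "latitude_variation R"])
       (use s o assms in \<open>auto simp: smooth_on_def\<close>)
  moreover have "latitude_variation R (t, x) \<in> sphere 0 1" if "norm x = R" for t and x :: 'a
  proof -
    have "x \<noteq> 0" using that assms by auto
    then show ?thesis by (simp add: latitude_variation_def latitude_variation_nz[OF assms])
  qed
  ultimately show ?thesis by (auto simp: smooth_map_def)
qed

text \<open>Along the latitude variation \<open>V\<close> is the unit normal, so \<open>J\<close> is
  the area of the sphere. All factors of the first variation other than the last are then nonzero,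
  and criticality forces the last one to vanish.\<close>

lemma not_ES_harmonic_small_hypersphere:
  assumes R01: "0 < R" "R < 1" and D: "DIM('a::euclidean_space) \<ge> 2" and n: "n \<ge> 1"
    and ES: "ES_harmonic_map (Suc n) (sphere (0::'a) R) (sphere_measure R) (sphere 0 1) (small_hypersphere R)"
  shows "(1 - R\<^sup>2) / R\<^sup>2 = real n"
proof -
  let ?\<Phi> = "latitude_variation R :: real \<times> 'a \<Rightarrow> _"
  have b: "?\<Phi> (0, x) = small_hypersphere R x" if "norm x = R" for x
    using norm_small_hypersphere[OF R01 that] by (simp add: latitude_variation_def retr_id)
  interpret hypersphere_variation "{-1<..<1}" R "(real DIM('a) - 1) * sqrt (1 - R\<^sup>2) / R" "\<lambda>t x. ?\<Phi> (t, x)"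
    using R01 b by (intro hypersphere_variationI variation_of_smooth_map smooth_latitude_variation) auto
  let ?c = "(real DIM('a) - 1) * sqrt (1 - R\<^sup>2) / R"
  have V: "V x = unit_normal R x" if x: "norm x = R" for x
  proof (rule vector_derivative_unique_at[OF G_t[OF x]])
    have n1: "norm (small_hypersphere R x) = 1" by (rule norm_small_hypersphere[OF R01 x])
    have "unit_normal R x \<bullet> small_hypersphere R x = 0" using normal_inner[OF x] base[OF x] by simp
    from curve_derivative[OF _ n1 this]
    show "((\<lambda>t. ?\<Phi> (t, x)) has_vector_derivative unit_normal R x) (at 0)"
      by (simp add: latitude_variation_def)
  qed
  have "J = sphere_int R (\<lambda>x::'a. 1)"
    unfolding J_def by (rule sphere_int_cong) (simp only: V normal_unit)
  \<comment> \<open>A point of the sphere, at which a vanishing area would force 1 = 0 by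
    \<open>sphere_int_eq_0\<close>.\<close>
  moreover obtain a :: 'a where "a \<in> Basis" using nonempty_Basis by blast
  then have "norm (R *\<^sub>R a) = R" using R01 by simp
  then have "sphere_int R (\<lambda>x::'a. 1) \<noteq> 0"
    using sphere_int_eq_0[OF R01(1), of "\<lambda>x::'a. 1" "R *\<^sub>R a"] by auto
  ultimately have J: "J \<noteq> 0" by simp
  have "((\<lambda>t. ES_energy (Suc n) (sphere 0 R) (sphere_measure R) (sphere 0 1) (\<lambda>x. ?\<Phi> (t, x)))
      has_real_derivative 0) (at 0)"
    using ES smooth_latitude_variation[OF R01] b unfolding ES_harmonic_map_def
    by (elim conjE allE[of _ "1::real"] allE[of _ ?\<Phi>]) auto
  from DERIV_unique[OF this first_variation[OF n]]
  have "(?c * (ht / R)) ^ (n - 1) * ?c * (real DIM('a) - 1) * J * (ht\<^sup>2 / R\<^sup>2 - real n) = 0" by simp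
  moreover have "?c \<noteq> 0" "ht / R \<noteq> 0" "real DIM('a) - 1 \<noteq> 0" using D R01 ht(3) by auto
  ultimately have "ht\<^sup>2 / R\<^sup>2 - real n = 0" using J by (simp only: mult_eq_0_iff power_eq_0_iff) blast
  then show ?thesis unfolding ht(1) by simp
qed

theorem theorem2p1:
  fixes r :: nat and R :: real
  assumes "r \<ge> 2" and "CARD('m::finite) \<ge> 2" and "0 < R" and "R < 1"
  shows "proper_ES_harmonic_submanifold r
           (sphere (0 :: real ^ 'm) R) (sphere_measure R)
           (sphere (0 :: (real ^ 'm) \<times> real) 1) (small_hypersphere R)
         \<longleftrightarrow> R = 1 / sqrt (real r)"
proof -
  obtain n where r: "r = Suc n" and n: "n \<ge> 1" using assms(1) by (cases r) auto
  have D: "DIM(real ^ 'm) \<ge> 2" using assms(2) by simp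
  have "ES_harmonic_map (Suc n) (sphere (0 :: real ^ 'm) R) (sphere_measure R) (sphere 0 1) (small_hypersphere R)
      \<longleftrightarrow> R = 1 / sqrt (real r)"
    unfolding r radius_eq_iff[OF assms(3) n, symmetric]
    using ES_harmonic_small_hypersphere[OF assms(3,4) n, where 'a = "real ^ 'm"] not_ES_harmonic_small_hypersphere[OF assms(3,4) D n] by blast
  then show ?thesis
    unfolding proper_ES_harmonic_submanifold_def r
    using isometric_small_hypersphere[OF assms(3,4), where 'a = "real ^ 'm"] not_harmonic_small_hypersphere[OF assms(3,4) D] by simp
qed

end
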